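(* Let $k$ be a positive integer, let $M,N$ be positive integers, let $Q\geq 1$ be a real number with $N^{1/(2k)} \leq Q \leq N^{1/k}$, and let $\{a_n\}$ be a sequence of complex numbers. Then for every $\varepsilon>0$, $$\sum_{q \leq Q}\ \sum_{\substack{a=1\\ (a,q)=1}}^{q^k} \left\vert \sum_{n=M+1}^{M+N} a_n\, e\!\left(\frac{a}{q^k}n\right)\right\vert^2 \ll (QN)^{\varepsilon}\,Q^{1+\frac{1}{k+1}}\,N^{1-\frac{1}{k(k+1)}} \sum_{n=M+1}^{M+N} \vert a_n\vert^2,$$ where the implied constant depends only on $\varepsilon$ and $k$.
   Context: Here $e(\alpha)=\exp(2\pi i\alpha)$ for real $\alpha$, and the outer sum runs over positive integers $q\le Q$. *)

theory Defs
  imports Complex_Main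
begin

definition e :: "real \<Rightarrow> complex" where
  "e \<alpha> = exp (2 * complex_of_real pi * \<i> * complex_of_real \<alpha>)"

end

theory Submission
  imports Defs "HOL-Analysis.Analysis" "HOL-Number_Theory.Cong"
begin

text \<open>
  By duality with a Fejer kernel, the large sieve sum is at most \<open>N\<close> times the largest number of
  fractions \<open>b / q ^ k\<close> in a window of length \<open>1 / N\<close> modulo one, up to a constant. With
  \<open>\<delta> = Q ^ k / N\<close>, such a window gives a set \<open>A\<close> of moduli \<open>q\<close> for which \<open>\<beta> q ^ k\<close> lies within
  \<open>\<delta>\<close> of an integer coprime to \<open>q\<close>. If \<open>\<beta>\<close> is close to a fraction of denominator less than about
  \<open>1 / \<delta>\<close>, coprimality leaves at most one such \<open>q\<close>. Otherwise put \<open>s = k (k + 1) / 2\<close>: the vectors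
  of power sums of degrees \<open>1, \<dots>, k\<close> of \<open>s\<close> elements of \<open>A\<close> take \<open>O(\<delta> Q ^ s)\<close> values, so by
  Cauchy-Schwarz the critical estimate \<open>O(Q ^ \<epsilon> * card A ^ s)\<close> for the number of solutions of
  Vinogradov's system with all variables in \<open>A\<close> yields \<open>card A ^ s = O(Q ^ (s + \<epsilon>) * \<delta>)\<close>.

  The mean value estimate is obtained from \<open>\<ell>\<^sup>2\<close> decoupling for the moment curve over residue classes
  modulo powers of a fixed prime \<open>p > k\<close>, a \<open>p\<close>-adic version of the argument of Guo, Li, Yung and
  Zorin-Kranich (equivalently, nested efficient congruencing). Two waves on classes of levels \<open>a\<close> and
  \<open>b\<close> that are distinct modulo \<open>p\<close> are considered jointly; the second one is invariant under shifts
  that see the first class as a nondegenerate curve in dimension \<open>l < k\<close>, so the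
  first one can be decoupled to level \<open>(k - l + 1) b / l\<close> by induction on the dimension. Hoelder's
  inequality then exchanges the two waves, and iterating beats every positive exponent.
\<close>


section \<open>Power mean inequalities\<close>

text \<open>Modulo powers of \<open>p\<close> all means are finite averages and localisation is
  exact: a suitable shift acts on a residue class by a genuine phase, with no tails to control.
  Rescaling a class preserves the moment curve only modulo \<open>p\<close>, so every estimate is
  stated for all curves congruent to it modulo \<open>p\<close>. The condition \<open>p > k\<close>
  keeps the factors produced by differentiating powers up to degree \<open>k\<close> invertible. In
  the bilinear iteration something is saved only at \<open>l = 0\<close>, where a class of level
  \<open>b\<close> has exponent \<eta> (n - b) instead of \<eta> n. Each round passes this saving on
  to other values of \<open>l\<close>, but returning from level \<open>b\<close> to level 1 costs a
  factor \<open>p ^ (2 * b * tri k)\<close>, exponential in \<open>b\<close> as well. Hence many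
  rounds are needed, their number depending on a lower bound for \<eta>; the resulting improvement
  of \<eta> is uniform above that bound, so finitely many improvements suffice. The set
  \<open>A\<close> of moduli has no structure, which is why decoupling for arbitrary index sets is
  used and not only the mean value over a full interval.\<close>

lemma convex_on_power_nonneg: "convex_on {0::real..} (\<lambda>x. x ^ n)"
proof (cases "even n")
  case True
  then show ?thesis using convex_on_subset[OF convex_power_even] by auto
next
  case False
  then show ?thesis by (rule convex_power_odd)
qed

text \<open>Hoelder with exponents \<open>t / m\<close> and \<open>t / (t - m)\<close>, raised to
  the power \<open>t\<close> so that no roots enter the statement. After division by the sums
  \<open>SX\<close> and \<open>SY\<close>, the weighted arithmetic-geometric inequality bounds each
  term, and the weights \<open>al + be = 1\<close> add up.\<close>

lemma sum_power_holder:
  fixes U X Y :: "'a \<Rightarrow> real"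
  assumes fin: "finite A" and "m \<le> t" "0 < t"
    and nn: "\<And>a. a \<in> A \<Longrightarrow> 0 \<le> U a" "\<And>a. a \<in> A \<Longrightarrow> 0 \<le> X a" "\<And>a. a \<in> A \<Longrightarrow> 0 \<le> Y a"
    and le: "\<And>a. a \<in> A \<Longrightarrow> U a ^ t \<le> X a ^ m * Y a ^ (t - m)"
  shows "sum U A ^ t \<le> sum X A ^ m * sum Y A ^ (t - m)"
proof -
  consider "m = 0" | "m = t" | "0 < m" "m < t" using assms by linarith
  then show ?thesis
  proof cases
    case 1
    have "U a \<le> Y a" if "a \<in> A" for a
      using le[OF that] 1 nn[OF that] \<open>0 < t\<close> by (simp add: power_mono_iff)
    then have "sum U A \<le> sum Y A" by (rule sum_mono)
    then show ?thesis using 1 nn by (simp add: power_mono sum_nonneg)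
  next
    case 2
    have "U a \<le> X a" if "a \<in> A" for a
      using le[OF that] 2 nn[OF that] \<open>0 < t\<close> by (simp add: power_mono_iff)
    then have "sum U A \<le> sum X A" by (rule sum_mono)
    then show ?thesis using 2 nn by (simp add: power_mono sum_nonneg)
  next
    case 3
    have U0: "U a = 0" if "a \<in> A" "X a = 0 \<or> Y a = 0" for a
    proof -
      have "U a ^ t \<le> 0" using le[OF that(1)] that(2) 3 by (auto simp: zero_power)
      then show ?thesis using nn(1)[OF that(1)] \<open>0 < t\<close>
        by (metis linorder_not_le order_antisym_conv zero_less_power)
    qed
    show ?thesis
    proof (cases "sum X A = 0 \<or> sum Y A = 0")
      case True
      then have "U a = 0" if "a \<in> A" for a
        using U0[OF that] that nn fin by (auto simp: sum_nonneg_eq_0_iff)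
      then have "sum U A = 0" by simp
      then show ?thesis using \<open>0 < t\<close> nn by (simp add: sum_nonneg zero_power)
    next
      case False
      define SX where "SX = sum X A"
      define SY where "SY = sum Y A"
      have pos: "SX > 0" "SY > 0"
        using False nn by (auto simp: SX_def SY_def less_le sum_nonneg)
      define al where "al = real m / real t"
      define be where "be = real (t - m) / real t"
      have ab: "0 \<le> al" "0 \<le> be" "al + be = 1"
        using \<open>0 < t\<close> \<open>m \<le> t\<close> by (auto simp: al_def be_def field_simps of_nat_diff)
      define G where "G = SX powr al * SY powr be"
      have Gpos: "G > 0" using pos by (simp add: G_def)
      have pw: "(x powr al * y powr be) ^ t = x ^ m * y ^ (t - m)" if "x > 0" "y > 0" for x y :: real
      proof -
        have "(x powr al) ^ t = x ^ m" "(y powr be) ^ t = y ^ (t - m)"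
          using that \<open>0 < t\<close> by (simp_all add: al_def be_def powr_powr flip: powr_realpow)
        then show ?thesis by (simp add: power_mult_distrib)
      qed
      have "U a \<le> G * (al * (X a / SX) + be * (Y a / SY))" if "a \<in> A" for a
      proof (cases "X a = 0 \<or> Y a = 0")
        case True
        then show ?thesis using U0[OF that] Gpos pos nn[OF that] ab by simp
      next
        case False
        then have p: "X a > 0" "Y a > 0" using nn[OF that] by auto
        have "U a ^ t \<le> (X a powr al * Y a powr be) ^ t"
          using le[OF that] pw[OF p] by simp
        then have "U a \<le> X a powr al * Y a powr be"
          using nn[OF that] \<open>0 < t\<close> by (subst (asm) power_mono_iff) auto
        also have "\<dots> = G * ((X a / SX) powr al * (Y a / SY) powr be)"
          using p pos by (simp add: G_def powr_divide)
        also have "\<dots> \<le> G * (al * (X a / SX) + be * (Y a / SY))"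
          using Gpos p pos ab by (intro mult_left_mono Youngs_inequality_0) auto
        finally show ?thesis .
      qed
      then have "sum U A \<le> (\<Sum>a\<in>A. G * (al * (X a / SX) + be * (Y a / SY)))"
        by (rule sum_mono)
      also have "\<dots> = G * (al * (\<Sum>a\<in>A. X a / SX) + be * (\<Sum>a\<in>A. Y a / SY))"
        by (simp only: sum.distrib sum_distrib_left[symmetric])
      also have "\<dots> = G * (al * (SX / SX) + be * (SY / SY))"
        by (simp only: SX_def SY_def sum_divide_distrib)
      also have "\<dots> = G" using pos ab by simp
      finally have "sum U A ^ t \<le> G ^ t" using nn by (simp add: power_mono sum_nonneg)
      then show ?thesis using pw[OF pos] by (simp add: G_def SX_def SY_def)
    qed
  qed
qed

text \<open>Minkowski's inequality in a weighted L^s for the functions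
  \<open>root s (Y j a)\<close>. With \<open>B j\<close> the norm of the j-th function, Jensen's
  inequality for \<open>x ^ s\<close> with weights \<open>B j / T\<close> reduces it to functions of
  norm one.\<close>

lemma minkowski_root:
  fixes W :: "'a \<Rightarrow> real" and Y :: "'j \<Rightarrow> 'a \<Rightarrow> real"
  assumes fin: "finite A" "finite J" and s: "0 < s"
    and W: "\<And>a. a \<in> A \<Longrightarrow> 0 \<le> W a"
    and Y: "\<And>j a. j \<in> J \<Longrightarrow> a \<in> A \<Longrightarrow> 0 \<le> Y j a"
  shows "(\<Sum>a\<in>A. W a * (\<Sum>j\<in>J. root s (Y j a)) ^ s)
       \<le> (\<Sum>j\<in>J. root s (\<Sum>a\<in>A. W a * Y j a)) ^ s"
proof -
  define B where "B j = root s (\<Sum>a\<in>A. W a * Y j a)" for j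
  define T where "T = sum B J"
  have S0: "0 \<le> (\<Sum>a\<in>A. W a * Y j a)" if "j \<in> J" for j
    using W Y that by (intro sum_nonneg) auto
  have B0: "0 \<le> B j" if "j \<in> J" for j
    using S0[OF that] s by (simp add: B_def)
  have Bs: "B j ^ s = (\<Sum>a\<in>A. W a * Y j a)" if "j \<in> J" for j
    using S0[OF that] s by (simp add: B_def)
  \<comment> \<open>A function of norm zero vanishes wherever \<open>W a > 0\<close>, so the
    convention x / 0 = 0 is harmless in the quotients by \<open>B j\<close> below.\<close>
  have z: "W a * Y j a = 0" if "a \<in> A" "j \<in> J" "B j = 0" for a j
    using Bs[OF that(2)] that s W Y fin
    by (simp add: zero_power sum_nonneg_eq_0_iff)
  have T0: "0 \<le> T" unfolding T_def using B0 by (rule sum_nonneg)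
  have main: "W a * (\<Sum>j\<in>J. root s (Y j a)) ^ s
      \<le> T ^ s * (\<Sum>j\<in>J. B j / T * (W a * Y j a / B j ^ s))" if a: "a \<in> A" for a
  proof (cases "W a = 0")
    case True then show ?thesis by simp
  next
    case False
    then have Wp: "W a > 0" using W[OF a] by simp
    have Y0: "Y j a = 0" if "j \<in> J" "B j = 0" for j using z[OF a that] Wp by simp
    show ?thesis
    proof (cases "T = 0")
      case True
      then have "B j = 0" if "j \<in> J" for j
        using B0 that fin by (simp add: T_def sum_nonneg_eq_0_iff)
      then have "(\<Sum>j\<in>J. root s (Y j a)) = 0" using Y0 by (intro sum.neutral) auto
      then show ?thesis using s True by (simp add: zero_power)
    next
      case False
      then have Tp: "T > 0" using T0 by simp
      then have "J \<noteq> {}" by (auto simp: T_def)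
      have "(\<Sum>j\<in>J. root s (Y j a)) = T * (\<Sum>j\<in>J. (B j / T) *\<^sub>R (root s (Y j a) / B j))"
        unfolding sum_distrib_left using Tp Y0 by (intro sum.cong) auto
      then have "(\<Sum>j\<in>J. root s (Y j a)) ^ s = T ^ s * (\<Sum>j\<in>J. (B j / T) *\<^sub>R (root s (Y j a) / B j)) ^ s"
        by (simp add: power_mult_distrib)
      also have "\<dots> \<le> T ^ s * (\<Sum>j\<in>J. (B j / T) * (root s (Y j a) / B j) ^ s)"
      proof (intro mult_left_mono convex_on_sum[OF fin(2) \<open>J \<noteq> {}\<close> convex_on_power_nonneg])
        show "(\<Sum>i\<in>J. B i / T) = 1" using Tp by (simp add: T_def flip: sum_divide_distrib)
      qed (use B0 Tp Y a s in auto)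
      also have "(\<Sum>j\<in>J. (B j / T) * (root s (Y j a) / B j) ^ s) = (\<Sum>j\<in>J. (B j / T) * (Y j a / B j ^ s))"
        using s Y a by (intro sum.cong) (auto simp: power_divide)
      finally have "W a * (\<Sum>j\<in>J. root s (Y j a)) ^ s \<le> W a * (T ^ s * (\<Sum>j\<in>J. (B j / T) * (Y j a / B j ^ s)))"
        using Wp by simp
      also have "\<dots> = T ^ s * (\<Sum>j\<in>J. B j / T * (W a * Y j a / B j ^ s))"
        by (simp add: sum_distrib_left mult_ac)
      finally show ?thesis .
    qed
  qed
  have "(\<Sum>a\<in>A. W a * (\<Sum>j\<in>J. root s (Y j a)) ^ s)
      \<le> (\<Sum>a\<in>A. T ^ s * (\<Sum>j\<in>J. B j / T * (W a * Y j a / B j ^ s)))"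
    by (intro sum_mono main)
  also have "\<dots> = T ^ s * (\<Sum>j\<in>J. \<Sum>a\<in>A. B j / T * (W a * Y j a / B j ^ s))"
    by (subst sum.swap) (simp add: sum_distrib_left)
  also have "\<dots> = T ^ s * (\<Sum>j\<in>J. B j / T * (B j ^ s / B j ^ s))"
    using Bs by (intro arg_cong[where f="\<lambda>x. T ^ s * x"] sum.cong refl)
      (simp only: Bs sum_distrib_left[symmetric] sum_divide_distrib[symmetric])
  also have "\<dots> \<le> T ^ s * (\<Sum>j\<in>J. B j / T)"
    using T0 B0 by (intro mult_left_mono sum_mono) auto
  also have "\<dots> \<le> T ^ s"
    using T0 s by (cases "T = 0") (auto simp: zero_power T_def simp flip: sum_divide_distrib)
  finally show ?thesis by (simp add: T_def B_def)
qed

lemma sum_power_le_power_sum: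
  fixes u :: "'a \<Rightarrow> real"
  assumes "finite J" "0 < s" "\<And>j. j \<in> J \<Longrightarrow> 0 \<le> u j"
  shows "(\<Sum>j\<in>J. u j ^ s) \<le> (\<Sum>j\<in>J. u j) ^ s"
proof -
  obtain r where s: "s = Suc r" using assms(2) gr0_conv_Suc by auto
  have "(\<Sum>j\<in>J. u j ^ s) \<le> (\<Sum>j\<in>J. u j * sum u J ^ r)"
    unfolding s power_Suc using assms
    by (intro sum_mono mult_left_mono power_mono member_le_sum) auto
  then show ?thesis by (simp add: s sum_distrib_right)
qed

lemma power_sum_le_card_power:
  fixes u :: "'a \<Rightarrow> real"
  assumes "finite J" "card J \<le> P" "0 < r" "\<And>j. j \<in> J \<Longrightarrow> 0 \<le> u j"
  shows "(\<Sum>j\<in>J. u j) ^ r \<le> real P ^ r * (\<Sum>j\<in>J. u j ^ r)"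
proof (cases "J = {}")
  case False
  then have "Max (u ` J) \<in> u ` J" using assms by (intro Max_in) auto
  then obtain m where m: "m \<in> J" "u m = Max (u ` J)" by auto
  have le: "u j \<le> u m" if "j \<in> J" for j using that m assms by auto
  have "sum u J \<le> real (card J) * u m" using le by (rule sum_bounded_above)
  also have "\<dots> \<le> real P * u m" using assms m(1) by (intro mult_right_mono) auto
  finally have "sum u J ^ r \<le> (real P * u m) ^ r" using assms by (simp add: power_mono sum_nonneg)
  also have "\<dots> = real P ^ r * u m ^ r" by (rule power_mult_distrib)
  also have "\<dots> \<le> real P ^ r * (\<Sum>j\<in>J. u j ^ r)"
    using assms m by (intro mult_left_mono member_le_sum) auto
  finally show ?thesis .
qed (use assms in \<open>simp add: zero_power\<close>)

text \<open>Either one term dominates, and the sum is at most \<open>1 + P * \<kappa>\<close> times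
  that term, or a second term exceeds \<open>\<kappa>\<close> times the largest and a single
  off-diagonal product controls everything. A factor \<open>\<rho>\<close> close to one matters: it
  is paid once per level in the induction on \<open>n\<close>.\<close>

lemma broad_narrow:
  fixes \<rho> :: real
  assumes "\<rho> > 1" "0 < s"
  obtains C where "C \<ge> 0"
    "\<And>(J :: 'a set) u. finite J \<Longrightarrow> card J \<le> P \<Longrightarrow> (\<And>j. j \<in> J \<Longrightarrow> (0::real) \<le> u j) \<Longrightarrow>
      (\<Sum>j\<in>J. u j) ^ (2 * s) \<le> \<rho> * (\<Sum>j\<in>J. u j ^ (2 * s)) + C * (\<Sum>j\<in>J. \<Sum>i\<in>J - {j}. u j ^ s * u i ^ s)"
proof -
  define \<kappa> where "\<kappa> = (root (2 * s) \<rho> - 1) / (real P + 1)"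
  have \<kappa>: "\<kappa> > 0" using assms by (simp add: \<kappa>_def)
  have k1: "(1 + real P * \<kappa>) ^ (2 * s) \<le> \<rho>"
  proof -
    have "real P * \<kappa> \<le> (real P + 1) * \<kappa>" using \<kappa> by simp
    also have "\<dots> = root (2 * s) \<rho> - 1" by (simp add: \<kappa>_def)
    finally have "1 + real P * \<kappa> \<le> root (2 * s) \<rho>" by simp
    then have "(1 + real P * \<kappa>) ^ (2 * s) \<le> root (2 * s) \<rho> ^ (2 * s)"
      using \<kappa> by (intro power_mono) auto
    then show ?thesis using assms by simp
  qed
  define C where "C = real P ^ (2 * s) / \<kappa> ^ s"
  have C0: "C \<ge> 0" using \<kappa> by (simp add: C_def)
  show ?thesis
  proof (rule that[OF C0])
    fix J :: "'a set" and u :: "'a \<Rightarrow> real"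
    assume fin: "finite J" and card: "card J \<le> P" and u: "\<And>j. j \<in> J \<Longrightarrow> 0 \<le> u j"
    let ?R = "\<Sum>j\<in>J. \<Sum>i\<in>J - {j}. u j ^ s * u i ^ s"
    have R0: "?R \<ge> 0" using u by (intro sum_nonneg) auto
    show "(\<Sum>j\<in>J. u j) ^ (2 * s) \<le> \<rho> * (\<Sum>j\<in>J. u j ^ (2 * s)) + C * ?R"
    proof (cases "J = {}")
      case True
      then show ?thesis using assms by (simp add: zero_power)
    next
      case False
      then have "Max (u ` J) \<in> u ` J" using fin by (intro Max_in) auto
      then obtain m where m: "m \<in> J" "u m = Max (u ` J)" by auto
      have le: "u j \<le> u m" if "j \<in> J" for j using that m fin by auto
      show ?thesis
      proof (cases "\<forall>i\<in>J - {m}. u i \<le> \<kappa> * u m")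
        case True
        have "sum u J = u m + sum u (J - {m})" using fin m by (simp add: sum.remove)
        also have "sum u (J - {m}) \<le> real (card (J - {m})) * (\<kappa> * u m)"
          using True by (intro sum_bounded_above) auto
        also have "\<dots> \<le> real P * (\<kappa> * u m)"
          using card \<kappa> u m(1) card_mono[OF fin, of "J - {m}"] by (intro mult_right_mono) auto
        finally have "sum u J \<le> (1 + real P * \<kappa>) * u m" by (simp add: algebra_simps)
        then have "sum u J ^ (2 * s) \<le> ((1 + real P * \<kappa>) * u m) ^ (2 * s)"
          using u by (simp add: power_mono sum_nonneg)
        also have "\<dots> = (1 + real P * \<kappa>) ^ (2 * s) * u m ^ (2 * s)" by (rule power_mult_distrib)
        also have "\<dots> \<le> \<rho> * u m ^ (2 * s)" using k1 by (intro mult_right_mono) auto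
        also have "\<dots> \<le> \<rho> * (\<Sum>j\<in>J. u j ^ (2 * s))"
          using assms fin m by (intro mult_left_mono member_le_sum) auto
        finally show ?thesis using C0 R0 by (simp add: add_increasing2)
      next
        case False
        then obtain i where i: "i \<in> J" "i \<noteq> m" "u i > \<kappa> * u m" by (force simp: not_le)
        have um: "0 \<le> u m" using u m(1) by auto
        have "sum u J \<le> real (card J) * u m" using le by (rule sum_bounded_above)
        also have "\<dots> \<le> real P * u m" using card um by (intro mult_right_mono) auto
        finally have "sum u J ^ (2 * s) \<le> (real P * u m) ^ (2 * s)" using u by (simp add: power_mono sum_nonneg)
        also have "\<dots> = real P ^ (2 * s) * (u m ^ s * u m ^ s)"
          by (simp add: power_mult_distrib power_mult power2_eq_square mult_ac flip: power_mult_distrib)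
        also have "\<dots> = C * (u m ^ s * (\<kappa> * u m) ^ s)"
          using \<kappa> by (simp add: C_def power_mult_distrib)
        also have "\<dots> \<le> C * (u m ^ s * u i ^ s)"
          using C0 um i \<kappa> by (intro mult_left_mono power_mono) auto
        also have "u m ^ s * u i ^ s \<le> (\<Sum>i\<in>J - {m}. u m ^ s * u i ^ s)"
          using fin i u m(1) by (intro member_le_sum) auto
        also have "\<dots> \<le> ?R"
          using fin m(1) u by (intro member_le_sum[of m J "\<lambda>m. \<Sum>i\<in>J - {m}. u m ^ s * u i ^ s"]) (auto intro!: sum_nonneg)
        finally have "sum u J ^ (2 * s) \<le> C * ?R" using C0 by (simp add: mult_left_mono)
        moreover have "0 \<le> \<rho> * (\<Sum>j\<in>J. u j ^ (2 * s))"
          using assms by (auto intro!: mult_nonneg_nonneg sum_nonneg)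
        ultimately show ?thesis by linarith
      qed
    qed
  qed
qed

section \<open>Averages of exponential sums\<close>

lemma e_add: "e (x + y) = e x * e y"
  by (simp add: e_def exp_add ring_distribs)

lemma e_0 [simp]: "e 0 = 1"
  by (simp add: e_def)

lemma cmod_e [simp]: "cmod (e x) = 1"
  by (simp add: e_def norm_exp_eq_Re)

lemma cnj_e: "cnj (e x) = e (- x)"
  by (simp add: e_def exp_cnj)

lemma e_of_int [simp]: "e (real_of_int m) = 1"
proof -
  have "2 * complex_of_real pi * \<i> * complex_of_real (real_of_int m) = of_int (2 * m) * pi * \<i>" by simp
  then show ?thesis unfolding e_def exp_eq_1 by auto
qed

lemma e_sum: "e (sum f A) = (\<Prod>a\<in>A. e (f a))"
  by (induction A rule: infinite_finite_induct) (auto simp: e_add)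

lemma e_power: "e x ^ n = e (real n * x)"
  by (induction n) (auto simp: e_add ring_distribs)

lemma e_cong:
  assumes "[a = b] (mod int q)"
  shows "e (real_of_int a / real q) = e (real_of_int b / real q)"
proof (cases "q = 0")
  case False
  obtain c where "a = b + int q * c"
    using cong_sym[OF assms] by (auto simp: cong_iff_lin mult.commute)
  then have "real_of_int a / real q = real_of_int b / real q + real_of_int c"
    using False by (simp add: field_simps)
  then show ?thesis by (simp add: e_add)
qed simp

lemma e_eq_1_iff: "e x = 1 \<longleftrightarrow> x \<in> \<int>"
proof
  assume "e x = 1"
  then obtain n :: int where "2 * pi * x = real_of_int (2 * n) * pi"
    by (auto simp: e_def exp_eq_1)
  then have "x = real_of_int n" by simp
  then show "x \<in> \<int>" by simp
next
  assume "x \<in> \<int>"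
  then show "e x = 1" by (auto elim: Ints_cases)
qed

lemma sum_e_eq_0:
  assumes "0 < q" "\<not> int q dvd m"
  shows "(\<Sum>a\<in>{0..<int q}. e (real_of_int (a * m) / real q)) = 0"
proof -
  let ?w = "e (real_of_int m / real q)"
  have "?w \<noteq> 1"
  proof
    assume "?w = 1"
    then obtain c :: int where "real_of_int m / real q = real_of_int c"
      by (auto simp: e_eq_1_iff elim: Ints_cases)
    then have "real_of_int m = real_of_int (int q * c)" using assms by (simp add: field_simps)
    then have "m = int q * c" by linarith
    then show False using assms by simp
  qed
  have "(\<Sum>a\<in>{0..<int q}. e (real_of_int (a * m) / real q)) = (\<Sum>a<q. ?w ^ a)"
    by (rule sum.reindex_bij_witness[of _ int nat]) (auto simp: e_power)
  also have "\<dots> = (?w ^ q - 1) / (?w - 1)" using \<open>?w \<noteq> 1\<close> by (rule geometric_sum)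
  also have "?w ^ q = 1" using assms by (simp add: e_power)
  finally show ?thesis by simp
qed

section \<open>Averages over boxes of residues, and exponential sums along curves\<close>

definition resbox :: "nat \<Rightarrow> nat \<Rightarrow> (nat \<Rightarrow> int) set" where
  "resbox l q = {1..l} \<rightarrow>\<^sub>E {0..<int q}"

definition avg :: "nat \<Rightarrow> nat \<Rightarrow> ((nat \<Rightarrow> int) \<Rightarrow> real) \<Rightarrow> real" where
  "avg l q h = (\<Sum>\<alpha>\<in>resbox l q. h \<alpha>) / real q ^ l"

lemma finite_resbox [simp]: "finite (resbox l q)"
  by (simp add: resbox_def finite_PiE)

lemma card_resbox: "card (resbox l q) = q ^ l"
  by (simp add: resbox_def card_PiE)

lemma avg_const: "0 < q \<Longrightarrow> avg l q (\<lambda>_. c) = c"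
  by (simp add: avg_def card_resbox)

lemma avg_mono: "(\<And>\<alpha>. \<alpha> \<in> resbox l q \<Longrightarrow> g \<alpha> \<le> h \<alpha>) \<Longrightarrow> avg l q g \<le> avg l q h"
  unfolding avg_def by (intro divide_right_mono sum_mono) auto

lemma avg_nonneg: "(\<And>\<alpha>. \<alpha> \<in> resbox l q \<Longrightarrow> 0 \<le> g \<alpha>) \<Longrightarrow> 0 \<le> avg l q g"
  unfolding avg_def by (intro divide_nonneg_nonneg sum_nonneg) auto

lemma avg_add: "avg l q (\<lambda>\<alpha>. g \<alpha> + h \<alpha>) = avg l q g + avg l q h"
  by (simp add: avg_def sum.distrib add_divide_distrib)

lemma avg_cmult: "avg l q (\<lambda>\<alpha>. c * g \<alpha>) = c * avg l q g"
  by (simp add: avg_def sum_distrib_left)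

lemma avg_sum: "avg l q (\<lambda>\<alpha>. \<Sum>i\<in>I. g i \<alpha>) = (\<Sum>i\<in>I. avg l q (g i))"
  unfolding avg_def by (subst sum.swap) (simp add: sum_divide_distrib)

lemma avg_swap: "avg l q (\<lambda>\<alpha>. avg l' q' (\<lambda>\<sigma>. h \<alpha> \<sigma>)) = avg l' q' (\<lambda>\<sigma>. avg l q (\<lambda>\<alpha>. h \<alpha> \<sigma>))"
  unfolding avg_def by (subst sum_divide_distrib[symmetric], subst sum.swap)
    (simp add: sum_divide_distrib[symmetric] mult.commute)

text \<open>Elements of \<open>resbox\<close> are extensional functions, so a shifted point usually
  leaves the box. Functions are therefore taken on all integer vectors, and periodicity makes
  \<open>avg\<close> invariant under shifts.\<close>

definition periodic :: "nat \<Rightarrow> nat \<Rightarrow> ((nat \<Rightarrow> int) \<Rightarrow> 'a) \<Rightarrow> bool" where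
  "periodic l q h \<longleftrightarrow> (\<forall>\<alpha> \<beta>. (\<forall>j\<in>{1..l}. [\<alpha> j = \<beta> j] (mod int q)) \<longrightarrow> h \<alpha> = h \<beta>)"

lemma avg_shift:
  assumes "0 < q" "periodic l q h"
  shows "avg l q (\<lambda>\<alpha>. h (\<lambda>j. \<alpha> j + v j)) = avg l q h"
proof -
  have "(\<Sum>\<alpha>\<in>resbox l q. h (\<lambda>j. \<alpha> j + v j)) = (\<Sum>\<alpha>\<in>resbox l q. h \<alpha>)"
  proof (rule sum.reindex_bij_witness[of _ "\<lambda>\<alpha>. \<lambda>j\<in>{1..l}. (\<alpha> j - v j) mod int q"
        "\<lambda>\<alpha>. \<lambda>j\<in>{1..l}. (\<alpha> j + v j) mod int q"])
    fix \<alpha> assume a: "\<alpha> \<in> resbox l q"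
    show "(\<lambda>j\<in>{1..l}. ((\<lambda>j\<in>{1..l}. (\<alpha> j + v j) mod int q) j - v j) mod int q) = \<alpha>"
      using a assms(1) by (intro ext) (auto simp: resbox_def restrict_def mod_simps PiE_iff extensional_def)
    show "(\<lambda>j\<in>{1..l}. ((\<lambda>j\<in>{1..l}. (\<alpha> j - v j) mod int q) j + v j) mod int q) = \<alpha>"
      using a assms(1) by (intro ext) (auto simp: resbox_def restrict_def mod_simps PiE_iff extensional_def)
    show "h (\<lambda>j\<in>{1..l}. (\<alpha> j + v j) mod int q) = h (\<lambda>j. \<alpha> j + v j)"
      using assms(2)[unfolded periodic_def, rule_format, of "\<lambda>j\<in>{1..l}. (\<alpha> j + v j) mod int q" "\<lambda>j. \<alpha> j + v j"]
      by (auto simp: cong_def)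
  qed (use assms(1) in \<open>auto simp: resbox_def\<close>)
  then show ?thesis by (simp add: avg_def)
qed

text \<open>The device by which one estimate is inserted into another: the average is unfolded over
  a family of shifts, and for fixed \<open>\<alpha>\<close> the inner average over
  \<open>\<sigma>\<close> may have another dimension and modulus.\<close>

lemma avg_avg_shift:
  assumes "0 < q" "0 < q'" "periodic l q h"
  shows "avg l q h = avg l q (\<lambda>\<alpha>. avg l' q' (\<lambda>\<sigma>. h (\<lambda>j. \<alpha> j + v \<sigma> j)))"
  by (subst avg_swap) (simp add: avg_shift[OF assms(1,3)] avg_const assms(2))

text \<open>The index set is kept apart from the map \<open>pos\<close> to positions on the curve, so that rescaling a
  residue class changes only \<open>pos\<close>.\<close>

definition wave :: "(nat \<Rightarrow> int poly) \<Rightarrow> nat \<Rightarrow> nat \<Rightarrow> (int \<Rightarrow> complex) \<Rightarrow> (int \<Rightarrow> int) \<Rightarrow> int set \<Rightarrow> (nat \<Rightarrow> int) \<Rightarrow> complex" where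
  "wave z l q f pos S \<alpha> = (\<Sum>x\<in>S. f x * e (real_of_int (\<Sum>j=1..l. \<alpha> j * poly (z j) (pos x)) / real q))"

lemma periodic_wave: "periodic l q (wave z l q f pos S)"
  unfolding periodic_def wave_def
  by (intro allI impI sum.cong refl arg_cong2[where f="(*)"] e_cong cong_sum cong_mult) auto

lemma periodic_comp: "periodic l q h \<Longrightarrow> periodic l q (\<lambda>\<alpha>. g (h \<alpha>))"
  unfolding periodic_def by metis

lemma periodic_comp2: "periodic l q h \<Longrightarrow> periodic l q h' \<Longrightarrow> periodic l q (\<lambda>\<alpha>. g (h \<alpha>) (h' \<alpha>))"
  unfolding periodic_def by metis

lemma sum_resbox_e:
  assumes "0 < q"
  shows "(\<Sum>\<alpha>\<in>resbox l q. e (real_of_int (\<Sum>j=1..l. \<alpha> j * v j) / real q))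
      = (if \<forall>j\<in>{1..l}. int q dvd v j then of_nat q ^ l else 0)"
proof -
  have "(\<Sum>\<alpha>\<in>resbox l q. e (real_of_int (\<Sum>j=1..l. \<alpha> j * v j) / real q))
      = (\<Sum>\<alpha>\<in>resbox l q. \<Prod>j=1..l. e (real_of_int (\<alpha> j * v j) / real q))"
    by (simp add: sum_divide_distrib e_sum)
  also have "\<dots> = (\<Prod>j=1..l. \<Sum>a\<in>{0..<int q}. e (real_of_int (a * v j) / real q))"
    unfolding resbox_def by (rule prod_sum_PiE[symmetric]) auto
  also have "\<dots> = (if \<forall>j\<in>{1..l}. int q dvd v j then of_nat q ^ l else 0)"
  proof (cases "\<forall>j\<in>{1..l}. int q dvd v j")
    case True
    have "(\<Sum>a\<in>{0..<int q}. e (real_of_int (a * v j) / real q)) = of_nat q" if j: "j \<in> {1..l}" for j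
    proof -
      have "e (real_of_int (a * v j) / real q) = 1" for a
        using e_cong[of "a * v j" 0 q] True j by (auto simp: cong_0_iff)
      then show ?thesis by simp
    qed
    then show ?thesis using True by simp
  next
    case False
    then show ?thesis using sum_e_eq_0[OF assms] by (auto intro!: prod_zero)
  qed
  finally show ?thesis .
qed

lemma avg_parseval:
  fixes c :: "'i \<Rightarrow> complex" and v :: "'i \<Rightarrow> nat \<Rightarrow> int"
  assumes "0 < q" "finite I"
  shows "complex_of_real (avg l q (\<lambda>\<alpha>. (cmod (\<Sum>i\<in>I. c i * e (real_of_int (\<Sum>j=1..l. \<alpha> j * v i j) / real q)))\<^sup>2))
     = (\<Sum>i\<in>I. \<Sum>i'\<in>I. if \<forall>j\<in>{1..l}. [v i j = v i' j] (mod int q) then c i * cnj (c i') else 0)"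
proof -
  let ?E = "\<lambda>i \<alpha>. e (real_of_int (\<Sum>j=1..l. \<alpha> j * v i j) / real q)"
  have EE: "?E i \<alpha> * cnj (?E i' \<alpha>) = e (real_of_int (\<Sum>j=1..l. \<alpha> j * (v i j - v i' j)) / real q)" for i i' \<alpha>
    by (simp add: cnj_e sum_subtractf right_diff_distrib diff_divide_distrib flip: e_add)
  have "complex_of_real (avg l q (\<lambda>\<alpha>. (cmod (\<Sum>i\<in>I. c i * ?E i \<alpha>))\<^sup>2))
     = (\<Sum>\<alpha>\<in>resbox l q. complex_of_real ((cmod (\<Sum>i\<in>I. c i * ?E i \<alpha>))\<^sup>2)) / of_nat q ^ l"
    by (simp add: avg_def)
  also have "\<dots> = (\<Sum>\<alpha>\<in>resbox l q. \<Sum>i\<in>I. \<Sum>i'\<in>I. (c i * cnj (c i')) * (?E i \<alpha> * cnj (?E i' \<alpha>))) / of_nat q ^ l"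
    by (simp only: complex_norm_square cnj_sum complex_cnj_mult sum_product mult_ac)
  also have "\<dots> = (\<Sum>i\<in>I. \<Sum>i'\<in>I. (c i * cnj (c i')) * (\<Sum>\<alpha>\<in>resbox l q. ?E i \<alpha> * cnj (?E i' \<alpha>))) / of_nat q ^ l"
    unfolding sum_distrib_left
    by (subst sum.swap) (intro arg_cong2[where f="(/)"] sum.cong refl sum.swap)
  also have "\<dots> = (\<Sum>i\<in>I. \<Sum>i'\<in>I. if \<forall>j\<in>{1..l}. [v i j = v i' j] (mod int q) then c i * cnj (c i') else 0)"
    unfolding EE sum_resbox_e[OF assms(1)] sum_divide_distrib
    using assms by (intro sum.cong refl) (auto simp: cong_iff_dvd_diff)
  finally show ?thesis .
qed

section \<open>Partitions into residue classes\<close>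

definition part :: "nat \<Rightarrow> (int \<Rightarrow> int) \<Rightarrow> int set \<Rightarrow> int set set" where
  "part N pos S = (\<lambda>x. {y \<in> S. [pos y = pos x] (mod int N)}) ` S"

lemma finite_part [simp]: "finite S \<Longrightarrow> finite (part N pos S)"
  by (simp add: part_def)

lemma part_subset: "J \<in> part N pos S \<Longrightarrow> J \<subseteq> S"
  by (auto simp: part_def)

lemma part_nonempty: "J \<in> part N pos S \<Longrightarrow> J \<noteq> {}"
  by (auto simp: part_def)

lemma finite_part_elem: "finite S \<Longrightarrow> J \<in> part N pos S \<Longrightarrow> finite J"
  by (meson finite_subset part_subset)

lemma Union_part: "\<Union>(part N pos S) = S"
  by (auto simp: part_def)

lemma part_cong_elems: "J \<in> part N pos S \<Longrightarrow> x \<in> J \<Longrightarrow> y \<in> J \<Longrightarrow> [pos x = pos y] (mod int N)"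
  unfolding part_def cong_def by auto

lemma part_eqI: "J \<in> part N pos S \<Longrightarrow> x \<in> J \<Longrightarrow> J = {y \<in> S. [pos y = pos x] (mod int N)}"
  unfolding part_def cong_def by auto

lemma part_disjoint: "J \<in> part N pos S \<Longrightarrow> J' \<in> part N pos S \<Longrightarrow> J \<noteq> J' \<Longrightarrow> J \<inter> J' = {}"
  using part_eqI by blast

lemma part_separated:
  "J \<in> part N pos S \<Longrightarrow> J' \<in> part N pos S \<Longrightarrow> J \<noteq> J' \<Longrightarrow> x \<in> J \<Longrightarrow> y \<in> J' \<Longrightarrow> \<not> [pos x = pos y] (mod int N)"
  unfolding part_def cong_def by auto

lemma sum_part:
  assumes "finite S"
  shows "(\<Sum>J\<in>part N pos S. \<Sum>x\<in>J. g x) = (\<Sum>x\<in>S. g x)"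
proof -
  have "(\<Sum>x\<in>\<Union>(part N pos S). g x) = (sum \<circ> sum) g (part N pos S)"
    using assms part_disjoint finite_part_elem by (intro sum.Union_disjoint) blast+
  then show ?thesis by (simp add: Union_part)
qed

lemma wave_part: "finite S \<Longrightarrow> wave z l q f pos S \<alpha> = (\<Sum>J\<in>part N pos S. wave z l q f pos J \<alpha>)"
  unfolding wave_def by (simp add: sum_part)

lemma part_eq:
  assumes "\<And>x y. x \<in> S \<Longrightarrow> y \<in> S \<Longrightarrow> [pos x = pos y] (mod int N) \<longleftrightarrow> [pos' x = pos' y] (mod int N')"
  shows "part N pos S = part N' pos' S"
  unfolding part_def using assms by (intro image_cong) auto

lemma part_refine:
  assumes "M dvd N"
  shows "part N pos S = (\<Union>I\<in>part M pos S. part N pos I)"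
proof -
  have *: "[a = b] (mod int M)" if "[a = b] (mod int N)" for a b
    using that assms by (meson cong_dvd_modulus int_dvd_int_iff)
  show ?thesis
  proof (intro subset_antisym subsetI)
    fix J assume "J \<in> part N pos S"
    then obtain x where x: "x \<in> S" "J = {y \<in> S. [pos y = pos x] (mod int N)}" by (auto simp: part_def)
    let ?I = "{y \<in> S. [pos y = pos x] (mod int M)}"
    have "?I \<in> part M pos S" "x \<in> ?I" "J = {y \<in> ?I. [pos y = pos x] (mod int N)}"
      using x * by (auto simp: part_def)
    then have "J \<in> part N pos ?I" by (auto simp: part_def)
    then show "J \<in> (\<Union>I\<in>part M pos S. part N pos I)" using \<open>?I \<in> part M pos S\<close> by blast
  next
    fix J assume "J \<in> (\<Union>I\<in>part M pos S. part N pos I)"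
    then obtain I x where I: "I \<in> part M pos S" "x \<in> I" "J = {y \<in> I. [pos y = pos x] (mod int N)}"
      by (auto simp: part_def)
    then have "x \<in> S" "J = {y \<in> S. [pos y = pos x] (mod int N)}"
      using part_subset[OF I(1)] part_eqI[OF I(1,2)] * by auto
    then show "J \<in> part N pos S" by (auto simp: part_def)
  qed
qed

lemma sum_part_refine:
  assumes "finite S" "M dvd N"
  shows "(\<Sum>J\<in>part N pos S. g J) = (\<Sum>I\<in>part M pos S. \<Sum>J\<in>part N pos I. g J)"
proof -
  have "part N pos I \<inter> part N pos I' = {}" if "I \<in> part M pos S" "I' \<in> part M pos S" "I \<noteq> I'" for I I'
    using part_disjoint[OF that] part_subset part_nonempty by blast
  then show ?thesis
    unfolding part_refine[OF assms(2), of pos S]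
    using assms finite_part_elem by (intro sum.UNION_disjoint) auto
qed

lemma part_self:
  assumes "S \<noteq> {}" "\<And>x y. x \<in> S \<Longrightarrow> y \<in> S \<Longrightarrow> [pos x = pos y] (mod int N)"
  shows "part N pos S = {S}"
  using assms unfolding part_def by (auto simp: image_iff) 

lemma card_part_le:
  assumes "0 < N"
  shows "card (part N pos S) \<le> N"
proof -
  have "part N pos S \<subseteq> (\<lambda>c. {y \<in> S. pos y mod int N = c}) ` {0..<int N}"
    using assms by (auto simp: part_def cong_def)
  then have "card (part N pos S) \<le> card {0..<int N}"
    by (meson card_image_le card_mono finite_atLeastLessThan_int finite_imageI le_trans)
  then show ?thesis by simp
qed

section \<open>Nondegenerate curves modulo prime powers\<close>

text \<open>Injectivity modulo \<open>p\<close> lifts to \<open>p ^ B\<close> by splitting off one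
  factor \<open>p\<close> at a time, and an injective self-map of the finite box
  \<open>resbox l q\<close> is onto. This replaces inverting the matrix \<open>C\<close>.\<close>

lemma linear_system_mod_prime_power:
  fixes C :: "nat \<Rightarrow> nat \<Rightarrow> int"
  assumes p: "prime p" and i: "i \<in> {1..l}"
    and nd: "\<And>\<beta>. (\<And>m. m \<in> {1..l} \<Longrightarrow> int p dvd (\<Sum>j=1..l. \<beta> j * C j m)) \<Longrightarrow> \<forall>j\<in>{1..l}. int p dvd \<beta> j"
  shows "\<exists>\<beta>. \<forall>m\<in>{1..l}. [(\<Sum>j=1..l. \<beta> j * C j m) = of_bool (m = i)] (mod int (p ^ B))"
proof -
  have p0: "p > 0" using p by (simp add: prime_gt_0_nat)
  have inj: "\<forall>j\<in>{1..l}. int p ^ B dvd \<beta> j"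
    if "\<And>m. m \<in> {1..l} \<Longrightarrow> int p ^ B dvd (\<Sum>j=1..l. \<beta> j * C j m)" for \<beta> B
    using that
  proof (induction B)
    case (Suc B)
    have "\<forall>j\<in>{1..l}. int p ^ B dvd \<beta> j"
      using Suc.prems by (intro Suc.IH) (metis dvd_trans le_imp_power_dvd lessI less_imp_le)
    then have "\<forall>j\<in>{1..l}. \<exists>b. \<beta> j = int p ^ B * b" by (auto simp: dvd_def)
    then obtain b where b: "\<And>j. j \<in> {1..l} \<Longrightarrow> \<beta> j = int p ^ B * b j" by metis
    have "\<forall>j\<in>{1..l}. int p dvd b j"
    proof (rule nd)
      fix m assume m: "m \<in> {1..l}"
      have "(\<Sum>j=1..l. \<beta> j * C j m) = int p ^ B * (\<Sum>j=1..l. b j * C j m)"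
        unfolding sum_distrib_left by (intro sum.cong) (auto simp: b)
      then have "int p ^ B * int p dvd int p ^ B * (\<Sum>j=1..l. b j * C j m)"
        using Suc.prems[OF m] by (simp add: mult.commute)
      then show "int p dvd (\<Sum>j=1..l. b j * C j m)" using p0 by simp
    qed
    then show ?case using b by (simp add: mult.commute mult_dvd_mono)
  qed simp
  define q where "q = p ^ B"
  have q0: "q > 0" using p0 by (simp add: q_def)
  define F where "F \<beta> = (\<lambda>m\<in>{1..l}. (\<Sum>j=1..l. \<beta> j * C j m) mod int q)" for \<beta>
  have "F ` resbox l q = resbox l q"
  proof (rule endo_inj_surj)
    show "F ` resbox l q \<subseteq> resbox l q" using q0 by (auto simp: F_def resbox_def)
    show "inj_on F (resbox l q)"
    proof (rule inj_onI)
      fix \<beta> \<gamma> assume bg: "\<beta> \<in> resbox l q" "\<gamma> \<in> resbox l q" "F \<beta> = F \<gamma>"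
      have "\<forall>j\<in>{1..l}. int p ^ B dvd \<beta> j - \<gamma> j"
      proof (rule inj)
        fix m assume m: "m \<in> {1..l}"
        have "(\<Sum>j=1..l. \<beta> j * C j m) mod int q = (\<Sum>j=1..l. \<gamma> j * C j m) mod int q"
          using fun_cong[OF bg(3), of m] m by (simp add: F_def)
        then have "int q dvd (\<Sum>j=1..l. \<beta> j * C j m) - (\<Sum>j=1..l. \<gamma> j * C j m)"
          by (simp add: mod_eq_dvd_iff)
        then show "int p ^ B dvd (\<Sum>j=1..l. (\<beta> j - \<gamma> j) * C j m)"
          by (simp add: q_def left_diff_distrib sum_subtractf)
      qed
      then have "\<beta> j = \<gamma> j" if "j \<in> {1..l}" for j
        using bg(1,2) that by (auto simp: resbox_def PiE_iff q_def mod_eq_dvd_iff[symmetric])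
      then show "\<beta> = \<gamma>" using bg(1,2) unfolding resbox_def by (metis PiE_ext)
    qed
  qed simp
  moreover have "(\<lambda>m\<in>{1..l}. of_bool (m = i) mod int q) \<in> resbox l q"
    using q0 by (auto simp: resbox_def)
  ultimately obtain \<beta> where "F \<beta> = (\<lambda>m\<in>{1..l}. of_bool (m = i) mod int q)" by (metis imageE)
  then have "F \<beta> m = of_bool (m = i) mod int q" if "m \<in> {1..l}" for m
    using that by simp
  then have "[(\<Sum>j=1..l. \<beta> j * C j m) = of_bool (m = i)] (mod int q)" if "m \<in> {1..l}" for m
    using that by (simp add: F_def cong_def)
  then show ?thesis unfolding q_def by blast
qed

section \<open>Nondegeneracy of shifted power curves modulo a prime\<close>

lemma pderiv_sum: "pderiv (sum f A) = (\<Sum>a\<in>A. pderiv (f a))"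
  by (induction A rule: infinite_finite_induct) (auto simp: pderiv_add)

lemma pcompose_power: "pcompose (p ^ n) r = pcompose p r ^ n"
  for p r :: "'a :: comm_semiring_1 poly"
  by (induction n) (auto simp: pcompose_mult pcompose_1)

text \<open>Modulo \<open>p\<close>, a linear polynomial \<omega> + t with nonzero \<omega> is
  invertible among power series in t, so the product vanishes to order \<open>l\<close> at 0 only if
  \<open>R\<close> does.\<close>

lemma prime_dvd_coeffs_linear_mult:
  fixes R :: "int poly"
  assumes p: "prime p" "\<not> int p dvd \<omega>"
    and "\<And>m. m < l \<Longrightarrow> int p dvd coeff ([:\<omega>, 1:] * R) m" and "m < l"
  shows "int p dvd coeff R m"
  using assms(4)
proof (induction m)
  case 0
  have "int p dvd \<omega> * coeff R 0" using assms(3)[of 0] 0 by simp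
  then show ?case using p by (simp add: prime_dvd_mult_iff)
next
  case (Suc m)
  have "int p dvd \<omega> * coeff R (Suc m) + coeff R m" using assms(3)[of "Suc m"] Suc.prems by simp
  moreover have "int p dvd coeff R m" using Suc by simp
  ultimately have "int p dvd \<omega> * coeff R (Suc m)" by (simp add: dvd_add_left_iff)
  then show ?case using p by (simp add: prime_dvd_mult_iff)
qed

lemma prime_dvd_coeffs_linear_power_mult:
  fixes R :: "int poly"
  assumes p: "prime p" "h = 0 \<or> \<not> int p dvd \<omega>"
    and "\<And>m. m < l \<Longrightarrow> int p dvd coeff ([:\<omega>, 1:] ^ h * R) m" and "m < l"
  shows "int p dvd coeff R m"
  using assms(2-)
proof (induction h arbitrary: R m)
  case (Suc h)
  show ?case
  proof (rule prime_dvd_coeffs_linear_mult[OF p(1) _ _ Suc.prems(3)])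
    show "\<not> int p dvd \<omega>" using Suc.prems by simp
    have "[:\<omega>, 1:] ^ Suc h * R = [:\<omega>, 1:] ^ h * ([:\<omega>, 1:] * R)"
      by (simp only: power_Suc2 mult.assoc)
    then have 1: "int p dvd coeff ([:\<omega>, 1:] ^ h * ([:\<omega>, 1:] * R)) m" if "m < l" for m
      using Suc.prems(2)[OF that] by simp
    have 2: "h = 0 \<or> \<not> int p dvd \<omega>" using Suc.prems(1) by simp
    fix m assume "m < l"
    with 1 show "int p dvd coeff ([:\<omega>, 1:] * R) m"
      by (rule Suc.IH[OF 2])
  qed
qed auto

text \<open>The derivative of a combination of the powers \<open>(\<omega> + t) ^ (h + j)\<close> equals \<open>(\<omega> + t) ^ h\<close> times
  a polynomial of degree less than \<open>l\<close>.\<close>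

lemma shifted_powers_nondegenerate:
  fixes \<beta> :: "nat \<Rightarrow> int"
  assumes p: "prime p" and hl: "h + l < p" and \<omega>: "h = 0 \<or> \<not> int p dvd \<omega>"
    and van: "\<And>m. m \<in> {1..l} \<Longrightarrow> int p dvd coeff (\<Sum>j=1..l. smult (\<beta> j) ([:\<omega>, 1:] ^ (h + j))) m"
    and j: "j \<in> {1..l}"
  shows "int p dvd \<beta> j"
proof -
  define Q where "Q = (\<Sum>j=1..l. smult (\<beta> j) ([:\<omega>, 1:] ^ (h + j)))"
  define R where "R = (\<Sum>j=1..l. smult (\<beta> j * int (h + j)) ([:\<omega>, 1:] ^ (j - 1)))"
  have der: "pderiv Q = [:\<omega>, 1:] ^ h * R"
  proof -
    have "pderiv ([:\<omega>, 1:] ^ (h + j)) = smult (int (h + j)) ([:\<omega>, 1:] ^ (h + (j - 1)))"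
      if "j \<in> {1..l}" for j
      using that by (simp add: pderiv_power pderiv_pCons)
    then have "pderiv (smult (\<beta> j) ([:\<omega>, 1:] ^ (h + j)))
        = [:\<omega>, 1:] ^ h * smult (\<beta> j * int (h + j)) ([:\<omega>, 1:] ^ (j - 1))" if "j \<in> {1..l}" for j
      using that by (simp only: pderiv_smult power_add smult_smult mult_smult_right)
    then show ?thesis unfolding Q_def R_def pderiv_sum sum_distrib_left
      by (intro sum.cong refl)
  qed
  have "int p dvd coeff ([:\<omega>, 1:] ^ h * R) m" if "m < l" for m
    using van[of "Suc m"] that unfolding der[symmetric] coeff_pderiv Q_def by simp
  then have "int p dvd coeff R m" if "m < l" for m
    using prime_dvd_coeffs_linear_power_mult[OF p \<omega>] that by blast
  moreover have "coeff R m = 0" if "m \<ge> l" for m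
    using that j unfolding R_def coeff_sum
    by (intro sum.neutral ballI) (auto simp: degree_linear_power intro!: coeff_eq_0)
  ultimately have "int p dvd coeff R m" for m by (cases "m < l") auto
  then have "[:int p:] dvd R" by (simp add: const_poly_dvd_iff)
  \<comment> \<open>Recentring at -\<omega> turns \<open>R\<close> into a combination of distinct
    monomials, from which the coefficients can be read off.\<close>
  then have "[:int p:] dvd pcompose R [:-\<omega>, 1:]"
    by (auto simp: dvd_def pcompose_smult)
  also have "pcompose R [:-\<omega>, 1:] = (\<Sum>j=1..l. monom (\<beta> j * int (h + j)) (j - 1))"
  proof -
    have *: "[:0, 1:] ^ n = monom (1::int) n" for n by (simp add: monom_altdef)
    show ?thesis unfolding R_def pcompose_sum
      by (intro sum.cong refl) (simp add: pcompose_smult pcompose_power pcompose_pCons * smult_monom)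
  qed
  finally have "int p dvd coeff (\<Sum>j=1..l. monom (\<beta> j * int (h + j)) (j - 1)) (j - 1)"
    by (simp add: const_poly_dvd_iff)
  also have "coeff (\<Sum>j=1..l. monom (\<beta> j * int (h + j)) (j - 1)) (j - 1)
      = (\<Sum>i=1..l. if i = j then \<beta> j * int (h + j) else 0)"
    unfolding coeff_sum using j by (intro sum.cong) auto
  also have "\<dots> = \<beta> j * int (h + j)" using j by simp
  finally have "int p dvd \<beta> j \<or> int p dvd int (h + j)" using p by (simp add: prime_dvd_mult_iff del: of_nat_add)
  \<comment> \<open>The factor \<open>h + j\<close> produced by differentiation is a unit because
    \<open>p\<close> exceeds \<open>h + l\<close>; a small characteristic would break the argument
    here.\<close>
  moreover have "\<not> p dvd h + j" using hl j by (auto dest!: dvd_imp_le)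
  ultimately show ?thesis by (simp only: int_dvd_int_iff) simp
qed

text \<open>Expanded at \<open>\<xi>\<close>, the curve consists modulo \<open>p\<close> of powers
  of (\<xi> - \<eta>) + t, whose nondegeneracy makes the system for the Taylor coefficients of
  degrees 1 to \<open>l\<close> solvable. Constant terms stay free, since they only contribute
  phases. It is applied with \<open>h = 0\<close> to the curve itself, at any centre, and with
  \<open>h = k - l\<close> to the directions that are blind to a small class around
  \<open>\<eta>\<close>.\<close>

lemma dual_vector_exists:
  fixes \<zeta> :: "nat \<Rightarrow> int poly"
  assumes p: "prime p" and hl: "h + l < p" and \<omega>: "h = 0 \<or> \<not> int p dvd \<xi> - \<eta>"
    and \<zeta>: "\<And>j. j \<in> {1..l} \<Longrightarrow> \<exists>c. [:int p:] dvd \<zeta> j - ([:c:] + [:-\<eta>, 1:] ^ (h + j))"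
    and i: "i \<in> {1..l}"
  shows "\<exists>\<beta>. \<forall>m\<in>{1..l}. [coeff (pcompose (\<Sum>j=1..l. smult (\<beta> j) (\<zeta> j)) [:\<xi>, 1:]) m = of_bool (m = i)] (mod int (p ^ B))"
proof -
  define C where "C j m = coeff (pcompose (\<zeta> j) [:\<xi>, 1:]) m" for j m
  have C: "coeff (pcompose (\<Sum>j=1..l. smult (\<beta> j) (\<zeta> j)) [:\<xi>, 1:]) m = (\<Sum>j=1..l. \<beta> j * C j m)" for \<beta> m
    by (simp add: pcompose_sum pcompose_smult coeff_sum C_def)
  have Cc: "[C j m = coeff ([:\<xi> - \<eta>, 1:] ^ (h + j)) m] (mod int p)" if jm: "j \<in> {1..l}" "m \<in> {1..l}" for j m
  proof -
    obtain c r where "\<zeta> j - ([:c:] + [:-\<eta>, 1:] ^ (h + j)) = [:int p:] * r"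
      using \<zeta>[OF jm(1)] by (auto simp: dvd_def)
    then have "\<zeta> j = [:c:] + [:-\<eta>, 1:] ^ (h + j) + smult (int p) r" by (simp add: algebra_simps)
    then have "pcompose (\<zeta> j) [:\<xi>, 1:] = [:c:] + [:\<xi> - \<eta>, 1:] ^ (h + j) + smult (int p) (pcompose r [:\<xi>, 1:])"
      by (simp add: pcompose_add pcompose_smult pcompose_power pcompose_pCons)
    then have "C j m = coeff ([:\<xi> - \<eta>, 1:] ^ (h + j)) m + int p * coeff (pcompose r [:\<xi>, 1:]) m"
      using jm(2) by (simp add: C_def coeff_pCons split: nat.splits)
    then show ?thesis by (simp add: cong_iff_dvd_diff)
  qed
  show ?thesis unfolding C
  proof (rule linear_system_mod_prime_power[OF p i], intro ballI)
    fix \<beta> j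
    assume van: "\<And>m. m \<in> {1..l} \<Longrightarrow> int p dvd (\<Sum>j=1..l. \<beta> j * C j m)" and j: "j \<in> {1..l}"
    show "int p dvd \<beta> j"
    proof (rule shifted_powers_nondegenerate[OF p hl \<omega> _ j])
      fix m assume m: "m \<in> {1..l}"
      have "[(\<Sum>j=1..l. \<beta> j * C j m) = (\<Sum>j=1..l. \<beta> j * coeff ([:\<xi> - \<eta>, 1:] ^ (h + j)) m)] (mod int p)"
        by (intro cong_sum cong_mult cong_refl Cc m)
      then show "int p dvd coeff (\<Sum>j=1..l. smult (\<beta> j) ([:\<xi> - \<eta>, 1:] ^ (h + j))) m"
        using van[OF m] by (simp add: coeff_sum cong_dvd_iff)
    qed
  qed
qed

text \<open>Substituting \<open>p ^ a * t\<close> multiplies the term of degree \<open>i\<close> by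
  \<open>p ^ (a * i)\<close> and the terms above degree \<open>l\<close> by at least
  \<open>p ^ (a * (l + 1))\<close>. After removal of the common factor the latter keep a factor
  \<open>p ^ d\<close> with \<open>d \<ge> 1\<close>, so the rescaled coordinate is still t ^ i
  modulo \<open>p\<close>.\<close>

lemma rescaled_component_exists:
  fixes P :: "int poly"
  assumes i: "1 \<le> i" "i \<le> l" and a: "1 \<le> a"
    and P: "\<And>m. m \<in> {1..l} \<Longrightarrow> [coeff P m = of_bool (m = i)] (mod int (p ^ B))"
  shows "\<exists>z. [:int p:] dvd z - monom 1 i \<and>
    (\<forall>t. [poly P (int (p ^ a) * t) = coeff P 0 + int (p ^ (a * i)) * poly z t] (mod int (p ^ B)))"
proof -
  define V where "V = poly_shift (l + 1) P"
  define d where "d = a * (l + 1 - i)"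
  have d: "d \<ge> 1" "a * i + d = a * (l + 1)"
    using i a by (auto simp: d_def simp flip: add_mult_distrib2)
  define z where "z = monom 1 i + smult (int (p ^ d)) (monom 1 (l + 1) * pcompose V [:0, int (p ^ a):])"
  have "P = (\<Sum>m\<le>l. monom (coeff P m) m) + monom 1 (l + 1) * V"
    by (rule poly_eqI) (auto simp: coeff_sum V_def coeff_monom_mult coeff_poly_shift if_distrib cong: if_cong)
  then have polyP: "poly P y = (\<Sum>m\<le>l. coeff P m * y ^ m) + y ^ (l + 1) * poly V y" for y
    by (metis (no_types, lifting) poly_add poly_mult poly_monom poly_sum sum.cong mult_1)
  have "[:int p:] dvd z - monom 1 i"
  proof -
    have "int p dvd int (p ^ d)" using d by (simp add: dvd_power)
    then show ?thesis by (auto simp: z_def const_poly_dvd_iff)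
  qed
  moreover have "[poly P (int (p ^ a) * t) = coeff P 0 + int (p ^ (a * i)) * poly z t] (mod int (p ^ B))" for t
  proof -
    let ?y = "int (p ^ a) * t"
    have "(\<Sum>m\<le>l. coeff P m * ?y ^ m) = coeff P 0 + (\<Sum>m=1..l. coeff P m * ?y ^ m)"
      by (simp add: sum.atMost_shift sum.atLeast1_atMost_eq)
    moreover have "[(\<Sum>m=1..l. coeff P m * ?y ^ m) = (\<Sum>m=1..l. of_bool (m = i) * ?y ^ m)] (mod int (p ^ B))"
      by (intro cong_sum cong_mult cong_refl P)
    moreover have "(\<Sum>m=1..l. of_bool (m = i) * ?y ^ m) = ?y ^ i" using i by simp
    moreover have "?y ^ i + ?y ^ (l + 1) * poly V ?y = int (p ^ (a * i)) * poly z t"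
    proof -
      have y1: "?y ^ i = int (p ^ (a * i)) * t ^ i" by (simp add: power_mult_distrib power_mult)
      have y2: "?y ^ (l + 1) = int (p ^ (a * i)) * int (p ^ d) * t ^ (l + 1)"
      proof -
        have "int (p ^ (a * i)) * int (p ^ d) = int p ^ (a * (l + 1))"
          by (simp only: d(2)[symmetric] power_add of_nat_power)
        then show ?thesis by (simp only: power_mult_distrib of_nat_power power_mult)
      qed
      have "poly z t = t ^ i + int (p ^ d) * (t ^ (l + 1) * poly V ?y)"
        by (simp add: z_def poly_monom poly_pcompose mult.commute)
      then show ?thesis unfolding y1 y2 by (simp only: distrib_left mult_ac)
    qed
    ultimately show ?thesis unfolding polyP
      by (metis (no_types, lifting) add.assoc cong_add cong_refl)
  qed
  ultimately show ?thesis by blast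
qed

section \<open>Decoupling constants\<close>

definition tri :: "nat \<Rightarrow> nat" where "tri l = l * (l + 1) div 2"

lemma two_tri: "2 * tri l = l * (l + 1)"
  by (simp add: tri_def)

lemma tri_pos: "1 \<le> l \<Longrightarrow> 1 \<le> tri l"
  using two_tri[of l] by (cases l) auto

lemma tri_0 [simp]: "tri 0 = 0" and tri_1 [simp]: "tri (Suc 0) = 1"
  by (auto simp: tri_def)

lemma tri_Suc: "tri (Suc l) = tri l + Suc l"
  using two_tri[of l] two_tri[of "Suc l"] by simp

lemma tri_strict_mono: "l < k \<Longrightarrow> tri l < tri k"
  by (induction k) (auto simp: tri_Suc less_Suc_eq)

lemma tri_mono: "l \<le> k \<Longrightarrow> tri l \<le> tri k"
  using tri_strict_mono[of l k] by (cases "l = k") auto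

text \<open>Only the reduction modulo \<open>p\<close> is prescribed, because rescaling a residue
  class perturbs the moment curve by multiples of \<open>p\<close>; the polynomials may have any
  degree.\<close>

definition curve :: "nat \<Rightarrow> nat \<Rightarrow> (nat \<Rightarrow> int poly) \<Rightarrow> bool" where
  "curve p l z \<longleftrightarrow> (\<forall>i\<in>{1..l}. [:int p:] dvd z i - monom 1 i)"

text \<open>\<open>root (tri l)\<close> of the moment of order \<open>2 * tri l\<close> is the
  square of the corresponding norm, so this is the squared l^2 sum of norms over the classes of
  level \<open>n\<close>. With modulus \<open>p ^ (l * n)\<close>, a class of level \<open>a\<close>
  rescales exactly to the same situation with \<open>n - a\<close> for \<open>n\<close>.\<close>

definition block_sum :: "nat \<Rightarrow> nat \<Rightarrow> nat \<Rightarrow> (nat \<Rightarrow> int poly) \<Rightarrow> (int \<Rightarrow> complex) \<Rightarrow> (int \<Rightarrow> int) \<Rightarrow> int set \<Rightarrow> real" where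
  "block_sum p l n z f pos S = (\<Sum>J\<in>part (p ^ n) pos S. root (tri l)
     (avg l (p ^ (l * n)) (\<lambda>\<alpha>. cmod (wave z l (p ^ (l * n)) f pos J \<alpha>) ^ (2 * tri l))))"

text \<open>This is \<open>\<ell>\<^sup>2\<close> decoupling at the critical exponent \<open>2 * tri l = l (l + 1)\<close>; the constant \<open>D\<close> belongs
  to the inequality raised to that power.\<close>

definition decoupling :: "nat \<Rightarrow> nat \<Rightarrow> nat \<Rightarrow> real \<Rightarrow> bool" where
  "decoupling p l n D \<longleftrightarrow> (\<forall>z f pos S. curve p l z \<longrightarrow> finite S \<longrightarrow>
     avg l (p ^ (l * n)) (\<lambda>\<alpha>. cmod (wave z l (p ^ (l * n)) f pos S \<alpha>) ^ (2 * tri l))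
     \<le> D * block_sum p l n z f pos S ^ tri l)"

text \<open>Allows a decoupling inequality that holds for each fixed \<open>\<alpha>\<close> to be
  averaged against a nonnegative weight: by Minkowski the average moves inside the sum over the
  pieces.\<close>

lemma avg_minkowski:
  assumes "finite I" "0 < s" "0 \<le> D"
    and "\<And>\<alpha>. \<alpha> \<in> resbox k q \<Longrightarrow> 0 \<le> w \<alpha>"
    and "\<And>i \<alpha>. i \<in> I \<Longrightarrow> \<alpha> \<in> resbox k q \<Longrightarrow> 0 \<le> Y i \<alpha>"
    and le: "\<And>\<alpha>. \<alpha> \<in> resbox k q \<Longrightarrow> X \<alpha> \<le> D * (\<Sum>i\<in>I. root s (Y i \<alpha>)) ^ s"
  shows "avg k q (\<lambda>\<alpha>. w \<alpha> * X \<alpha>) \<le> D * (\<Sum>i\<in>I. root s (avg k q (\<lambda>\<alpha>. w \<alpha> * Y i \<alpha>))) ^ s"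
proof -
  let ?W = "\<lambda>\<alpha>. w \<alpha> / real q ^ k"
  have "avg k q (\<lambda>\<alpha>. w \<alpha> * X \<alpha>) = (\<Sum>\<alpha>\<in>resbox k q. ?W \<alpha> * X \<alpha>)"
    by (simp add: avg_def sum_divide_distrib)
  also have "\<dots> \<le> (\<Sum>\<alpha>\<in>resbox k q. ?W \<alpha> * (D * (\<Sum>i\<in>I. root s (Y i \<alpha>)) ^ s))"
    using assms by (intro sum_mono mult_left_mono le) auto
  also have "\<dots> = D * (\<Sum>\<alpha>\<in>resbox k q. ?W \<alpha> * (\<Sum>i\<in>I. root s (Y i \<alpha>)) ^ s)"
    by (simp add: sum_distrib_left mult_ac)
  also have "\<dots> \<le> D * (\<Sum>i\<in>I. root s (\<Sum>\<alpha>\<in>resbox k q. ?W \<alpha> * Y i \<alpha>)) ^ s"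
    using assms by (intro mult_left_mono minkowski_root) auto
  also have "(\<lambda>i. \<Sum>\<alpha>\<in>resbox k q. ?W \<alpha> * Y i \<alpha>) = (\<lambda>i. avg k q (\<lambda>\<alpha>. w \<alpha> * Y i \<alpha>))"
    by (simp add: avg_def sum_divide_distrib)
  finally show ?thesis .
qed

text \<open>The shift \<open>v\<close> multiplies the term at \<open>x\<close> by a character of the
  new variables \<open>\<sigma>\<close>, so for fixed \<open>\<alpha>\<close> the shifted wave is
  again a wave in \<open>\<sigma>\<close>, with the old phases absorbed into the coefficients. The
  common phase \<open>c\<close> disappears in the absolute value.\<close>

lemma wave_shift:
  assumes q: "0 < q" "0 < q'"
    and phase: "\<And>x. x \<in> S \<Longrightarrow> [(\<Sum>j=1..k. v j * poly (z j) (pos x)) =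
        c + (\<Sum>i=1..l. \<sigma> i * poly (z' i) (pos' x)) * int M] (mod int q)"
    and M: "M * q' = q"
  shows "cmod (wave z k q f pos S (\<lambda>j. \<alpha> j + v j))
       = cmod (wave z' l q' (\<lambda>x. f x * e (real_of_int (\<Sum>j=1..k. \<alpha> j * poly (z j) (pos x)) / real q)) pos' S \<sigma>)"
proof -
  have *: "e (real_of_int (\<Sum>j=1..k. (\<alpha> j + v j) * poly (z j) (pos x)) / real q)
     = e (real_of_int c / real q) * (e (real_of_int (\<Sum>j=1..k. \<alpha> j * poly (z j) (pos x)) / real q) *
        e (real_of_int (\<Sum>i=1..l. \<sigma> i * poly (z' i) (pos' x)) / real q'))" if "x \<in> S" for x
  proof -
    from e_cong[OF phase[OF that]] have "e (real_of_int (\<Sum>j=1..k. v j * poly (z j) (pos x)) / real q)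
      = e (real_of_int c / real q + real_of_int (\<Sum>i=1..l. \<sigma> i * poly (z' i) (pos' x)) * (real M / real q))"
      by (simp add: add_divide_distrib)
    also have "real M / real q = 1 / real q'" using q M by (auto simp: field_simps simp flip: of_nat_mult)
    finally show ?thesis
      by (simp add: distrib_right sum.distrib add_divide_distrib e_add)
  qed
  have "wave z k q f pos S (\<lambda>j. \<alpha> j + v j) = e (real_of_int c / real q) *
      wave z' l q' (\<lambda>x. f x * e (real_of_int (\<Sum>j=1..k. \<alpha> j * poly (z j) (pos x)) / real q)) pos' S \<sigma>"
    unfolding wave_def sum_distrib_left by (intro sum.cong refl) (simp only: * mult_ac)
  then show ?thesis by (simp add: norm_mult)
qed

text \<open>Decoupling over a residue class modulo \<open>p ^ a\<close>: the averaging parameter is shifted along the dual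
  vectors at the centre \<open>\<xi>\<close>, which turns the class into a full curve at scale \<open>n - a\<close>.\<close>

lemma decoupling_rescaled:
  fixes \<zeta> :: "nat \<Rightarrow> int poly" and \<beta> :: "nat \<Rightarrow> nat \<Rightarrow> int"
  assumes p: "prime p" and decoupling: "decoupling p l (n - a) D" and D: "0 \<le> D"
    and a: "1 \<le> a" "a \<le> n" and l: "1 \<le> l" and fin: "finite S"
    and S: "\<And>x. x \<in> S \<Longrightarrow> [pos x = \<xi>] (mod int (p ^ a))"
    and dual: "\<And>i m. i \<in> {1..l} \<Longrightarrow> m \<in> {1..l} \<Longrightarrow>
      [coeff (pcompose (\<Sum>j=1..l. smult (\<beta> i j) (\<zeta> j)) [:\<xi>, 1:]) m = of_bool (m = i)] (mod int (p ^ (l * n)))"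
  shows "avg l (p ^ (l * n)) (\<lambda>\<alpha>. cmod (wave \<zeta> l (p ^ (l * n)) f pos S \<alpha>) ^ (2 * tri l))
     \<le> D * block_sum p l n \<zeta> f pos S ^ tri l"
proof -
  define q where "q = p ^ (l * n)"
  define q' where "q' = p ^ (l * (n - a))"
  define M where "M = p ^ (l * a)"
  have p0: "p > 0" using p by (simp add: prime_gt_0_nat)
  have q0: "q > 0" "q' > 0" using p0 by (auto simp: q_def q'_def)
  have Mq: "M * q' = q" using a by (simp add: M_def q'_def q_def diff_mult_distrib2 flip: power_add)
  define P where "P i = pcompose (\<Sum>j=1..l. smult (\<beta> i j) (\<zeta> j)) [:\<xi>, 1:]" for i
  have "\<exists>z. [:int p:] dvd z - monom 1 i \<and>
    (\<forall>t. [poly (P i) (int (p ^ a) * t) = coeff (P i) 0 + int (p ^ (a * i)) * poly z t] (mod int (p ^ (l * n))))"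
    if "i \<in> {1..l}" for i
    unfolding P_def using that a by (intro rescaled_component_exists dual) auto
  then obtain z where z: "\<And>i. i \<in> {1..l} \<Longrightarrow> [:int p:] dvd z i - monom 1 i"
    "\<And>i t. i \<in> {1..l} \<Longrightarrow> [poly (P i) (int (p ^ a) * t) = coeff (P i) 0 + int (p ^ (a * i)) * poly (z i) t] (mod int q)"
    unfolding q_def by metis
  define pos' where "pos' x = (pos x - \<xi>) div int (p ^ a)" for x
  have pos: "pos x = \<xi> + int (p ^ a) * pos' x" if "x \<in> S" for x
    using S[OF that] by (simp add: pos'_def cong_iff_dvd_diff)
  \<comment> \<open>The weight \<open>p ^ (a * (l - i))\<close> complements the factor
    \<open>p ^ (a * i)\<close> of the i-th rescaled coordinate, so that all coordinates carry the
    same factor \<open>M = p ^ (l * a)\<close>.\<close>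
  define v where "v \<sigma> j = (\<Sum>i=1..l. \<sigma> i * int (p ^ (a * (l - i))) * \<beta> i j)" for \<sigma> :: "nat \<Rightarrow> int" and j
  define c where "c \<sigma> = (\<Sum>i=1..l. \<sigma> i * int (p ^ (a * (l - i))) * coeff (P i) 0)" for \<sigma> :: "nat \<Rightarrow> int"
  have phase: "[(\<Sum>j=1..l. v \<sigma> j * poly (\<zeta> j) (pos x)) =
        c \<sigma> + (\<Sum>i=1..l. \<sigma> i * poly (z i) (pos' x)) * int M] (mod int q)" if "x \<in> S" for x \<sigma>
  proof -
    have "(\<Sum>j=1..l. v \<sigma> j * poly (\<zeta> j) (pos x))
        = (\<Sum>i=1..l. \<sigma> i * int (p ^ (a * (l - i))) * (\<Sum>j=1..l. \<beta> i j * poly (\<zeta> j) (pos x)))"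
      unfolding v_def sum_distrib_right sum_distrib_left by (subst sum.swap) (simp add: mult_ac)
    also have "\<dots> = (\<Sum>i=1..l. \<sigma> i * int (p ^ (a * (l - i))) * poly (P i) (int (p ^ a) * pos' x))"
      by (simp add: P_def poly_pcompose poly_sum pos[OF that] add.commute)
    also have "[\<dots> = (\<Sum>i=1..l. \<sigma> i * int (p ^ (a * (l - i))) * (coeff (P i) 0 + int (p ^ (a * i)) * poly (z i) (pos' x)))] (mod int q)"
      by (intro cong_sum cong_mult cong_refl z(2))
    also have "(\<Sum>i=1..l. \<sigma> i * int (p ^ (a * (l - i))) * (coeff (P i) 0 + int (p ^ (a * i)) * poly (z i) (pos' x)))
        = c \<sigma> + (\<Sum>i=1..l. \<sigma> i * poly (z i) (pos' x) * (int (p ^ (a * (l - i))) * int (p ^ (a * i))))"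
      by (simp add: c_def distrib_left sum.distrib mult_ac)
    also have "(\<Sum>i=1..l. \<sigma> i * poly (z i) (pos' x) * (int (p ^ (a * (l - i))) * int (p ^ (a * i))))
        = (\<Sum>i=1..l. \<sigma> i * poly (z i) (pos' x)) * int M"
      unfolding sum_distrib_right
    proof (intro sum.cong refl)
      fix i assume "i \<in> {1..l}"
      then have "a * (l - i) + a * i = l * a" by (simp add: diff_mult_distrib2 mult.commute)
      then have "int (p ^ (a * (l - i))) * int (p ^ (a * i)) = int M"
        by (simp add: M_def flip: power_add)
      then show "\<sigma> i * poly (z i) (pos' x) * (int (p ^ (a * (l - i))) * int (p ^ (a * i))) = \<sigma> i * poly (z i) (pos' x) * int M"
        by simp
    qed
    finally show ?thesis .
  qed
  define F where "F \<alpha> x = f x * e (real_of_int (\<Sum>j=1..l. \<alpha> j * poly (\<zeta> j) (pos x)) / real q)" for \<alpha> x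
  define X where "X J \<alpha> = avg l q' (\<lambda>\<sigma>. cmod (wave z l q' (F \<alpha>) pos' J \<sigma>) ^ (2 * tri l))" for J \<alpha>
  have avgX: "avg l q (\<lambda>\<alpha>. cmod (wave \<zeta> l q f pos J \<alpha>) ^ (2 * tri l)) = avg l q (X J)" if "J \<subseteq> S" for J
  proof -
    have "cmod (wave \<zeta> l q f pos J (\<lambda>j. \<alpha> j + v \<sigma> j)) = cmod (wave z l q' (F \<alpha>) pos' J \<sigma>)" for \<alpha> \<sigma>
      unfolding F_def using that phase
      by (intro wave_shift[where c = "c \<sigma>", OF q0 _ Mq]) auto
    moreover have "periodic l q (\<lambda>\<alpha>. cmod (wave \<zeta> l q f pos J \<alpha>) ^ (2 * tri l))"
      by (rule periodic_comp[OF periodic_wave])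
    ultimately show ?thesis unfolding X_def
      by (subst avg_avg_shift[OF q0, where l' = l and v = v]) simp_all
  qed
  have X0: "0 \<le> X J \<alpha>" for J \<alpha> by (simp add: X_def avg_nonneg)
  have part: "part (p ^ n) pos S = part (p ^ (n - a)) pos' S"
  proof (rule part_eq)
    fix x y assume "x \<in> S" "y \<in> S"
    then have "pos x - pos y = int (p ^ a) * (pos' x - pos' y)" by (simp add: pos algebra_simps)
    moreover have "int (p ^ n) = int (p ^ a) * int (p ^ (n - a))" using a by (simp flip: power_add)
    ultimately show "[pos x = pos y] (mod int (p ^ n)) \<longleftrightarrow> [pos' x = pos' y] (mod int (p ^ (n - a)))"
      using p0 by (simp add: cong_iff_dvd_diff)
  qed
  have "avg l q (\<lambda>\<alpha>. 1 * X S \<alpha>) \<le> D * (\<Sum>J\<in>part (p ^ n) pos S. root (tri l) (avg l q (\<lambda>\<alpha>. 1 * X J \<alpha>))) ^ tri l"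
  proof (rule avg_minkowski)
    have "curve p l z" using z(1) by (simp add: curve_def)
    then show "X S \<alpha> \<le> D * (\<Sum>J\<in>part (p ^ n) pos S. root (tri l) (X J \<alpha>)) ^ tri l" for \<alpha>
      using decoupling fin unfolding decoupling_def block_sum_def X_def part q'_def by blast
  qed (use fin l D X0 tri_pos[OF l] in auto)
  then have "avg l q (X S) \<le> D * (\<Sum>J\<in>part (p ^ n) pos S. root (tri l) (avg l q (X J))) ^ tri l" by simp
  also have "(\<Sum>J\<in>part (p ^ n) pos S. root (tri l) (avg l q (X J)))
     = (\<Sum>J\<in>part (p ^ n) pos S. root (tri l) (avg l q (\<lambda>\<alpha>. cmod (wave \<zeta> l q f pos J \<alpha>) ^ (2 * tri l))))"
    using avgX[OF part_subset] by (intro sum.cong refl) (simp only:)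
  finally show ?thesis using avgX[of S] unfolding q_def block_sum_def by simp
qed

lemma curve_dual:
  assumes "prime p" "k < p" "curve p k z"
  obtains \<beta> where "\<And>i m. i \<in> {1..k} \<Longrightarrow> m \<in> {1..k} \<Longrightarrow>
      [coeff (pcompose (\<Sum>j=1..k. smult (\<beta> i j) (z j)) [:\<xi>, 1:]) m = of_bool (m = i)] (mod int (p ^ B))"
proof -
  have "\<exists>\<beta>. \<forall>m\<in>{1..k}. [coeff (pcompose (\<Sum>j=1..k. smult (\<beta> j) (z j)) [:\<xi>, 1:]) m = of_bool (m = i)] (mod int (p ^ B))"
    if "i \<in> {1..k}" for i
  proof (rule dual_vector_exists[where h = 0 and \<eta> = 0])
    fix j assume "j \<in> {1..k}"
    then have "[:int p:] dvd z j - ([:0:] + [:-0, 1:] ^ (0 + j))"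
      using assms(3) by (simp add: curve_def monom_altdef)
    then show "\<exists>c. [:int p:] dvd z j - ([:c:] + [:-0, 1:] ^ (0 + j))" by blast
  qed (use assms that in auto)
  then have "\<exists>\<beta>. \<forall>i\<in>{1..k}. \<forall>m\<in>{1..k}. [coeff (pcompose (\<Sum>j=1..k. smult (\<beta> i j) (z j)) [:\<xi>, 1:]) m = of_bool (m = i)] (mod int (p ^ B))"
    by (intro bchoice) auto
  then show ?thesis using that by blast
qed

text \<open>Shifting along the directions dual to \<open>(x - \<eta>) ^ i\<close>, \<open>i > k - l\<close>, leaves the wave over a small class
  around \<open>\<eta>\<close> unchanged up to a phase, whereas around \<open>\<xi>\<close> these directions span a nondegenerate curve
  in dimension \<open>l\<close>.\<close>

lemma decoupling_weighted:
  assumes p: "prime p" "k < p" and curve: "curve p k z"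
    and l: "1 \<le> l" "l \<le> k" and b': "l * b' = (k - l + 1) * b" and a: "1 \<le> a" "a \<le> b'" and n: "b' \<le> n" and b: "1 \<le> b"
    and fin: "finite S"
    and S: "\<And>x. x \<in> S \<Longrightarrow> [pos x = \<xi>] (mod int (p ^ a))"
    and S2: "\<And>x. x \<in> S2 \<Longrightarrow> [pos x = \<eta>] (mod int (p ^ b))"
    and sep: "\<not> int p dvd \<xi> - \<eta>"
    and decoupling: "decoupling p l (b' - a) D" and D: "0 \<le> D" and q: "q = p ^ (k * n)"
  shows "avg k q (\<lambda>\<alpha>. cmod (wave z k q f pos S2 \<alpha>) ^ r * cmod (wave z k q f pos S \<alpha>) ^ (2 * tri l))
     \<le> D * (\<Sum>J\<in>part (p ^ b') pos S. root (tri l)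
        (avg k q (\<lambda>\<alpha>. cmod (wave z k q f pos S2 \<alpha>) ^ r * cmod (wave z k q f pos J \<alpha>) ^ (2 * tri l)))) ^ tri l"
proof -
  define h where "h = k - l"
  have p0: "p > 0" using p by (simp add: prime_gt_0_nat)
  have lb: "l * b' \<le> k * n" using l n by (intro mult_le_mono) auto
  \<comment> \<open>On a class of level \<open>b\<close> around \<open>\<eta>\<close> the dual
    coordinates of index above \<open>h\<close> are constant modulo
    \<open>p ^ (b * (h + 1))\<close>, which is exactly \<open>p ^ (l * b')\<close>; this is what
    fixes the scale \<open>b'\<close>.\<close>
  define q' where "q' = p ^ (l * b')"
  define M where "M = p ^ (k * n - l * b')"
  have q0: "q > 0" "q' > 0" using p0 by (auto simp: q q'_def)
  have Mq: "M * q' = q" using lb by (simp add: M_def q'_def q flip: power_add)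
  obtain \<beta> where \<beta>: "\<And>i m. i \<in> {1..k} \<Longrightarrow> m \<in> {1..k} \<Longrightarrow>
      [coeff (pcompose (\<Sum>j=1..k. smult (\<beta> i j) (z j)) [:\<eta>, 1:]) m = of_bool (m = i)] (mod int (p ^ (k * n)))"
    using curve_dual[OF p curve] by metis
  define Z where "Z i = (\<Sum>j=1..k. smult (\<beta> i j) (z j))" for i
  define P where "P i = pcompose (Z i) [:\<eta>, 1:]" for i
  have P: "[coeff (P i) m = of_bool (m = i)] (mod int (p ^ (k * n)))" if "i \<in> {1..k}" "m \<in> {1..k}" for i m
    using \<beta>[OF that] by (simp add: P_def Z_def)
  have kn: "1 \<le> k * n" using l a n by (simp add: Suc_le_eq)
  have Zmod: "[:int p:] dvd Z i - ([:coeff (P i) 0:] + [:-\<eta>, 1:] ^ i)" if i: "i \<in> {1..k}" for i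
  proof -
    have "int p dvd coeff (P i - ([:coeff (P i) 0:] + monom 1 i)) m" for m
    proof -
      consider "m = 0" | "m \<in> {1..k}" | "m > k" by force
      then show ?thesis
      proof cases
        case 1
        then show ?thesis using i by simp
      next
        case 2
        have "[coeff (P i) m = of_bool (m = i)] (mod int p)"
          using P[OF i 2] kn by (metis cong_dvd_modulus dvd_power int_dvd_int_iff Suc_le_eq One_nat_def)
        then show ?thesis using 2 by (auto simp: cong_iff_dvd_diff coeff_pCons split: nat.splits)
      next
        \<comment> \<open>Above degree \<open>k\<close> the duality congruences say nothing; here it
          helps that \<open>z j\<close> itself is modulo \<open>p\<close> a power of degree at most
          \<open>k\<close>.\<close>
        case 3
        have zc: "int p dvd coeff (pcompose (z j) [:\<eta>, 1:]) m" if j: "j \<in> {1..k}" for j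
        proof -
          obtain r where "z j - monom 1 j = [:int p:] * r" using curve j unfolding curve_def dvd_def by blast
          then have "z j = [:0, 1:] ^ j + smult (int p) r" by (simp add: algebra_simps monom_altdef)
          then have "pcompose (z j) [:\<eta>, 1:] = [:\<eta>, 1:] ^ j + smult (int p) (pcompose r [:\<eta>, 1:])"
            by (simp add: pcompose_add pcompose_smult pcompose_power pcompose_pCons)
          moreover have "coeff ([:\<eta>, 1:] ^ j) m = 0" using 3 j by (intro coeff_eq_0) (simp add: degree_linear_power)
          ultimately show ?thesis by simp
        qed
        have "coeff (P i) m = (\<Sum>j=1..k. \<beta> i j * coeff (pcompose (z j) [:\<eta>, 1:]) m)"
          by (simp add: P_def Z_def pcompose_sum pcompose_smult coeff_sum)
        then have "int p dvd coeff (P i) m" using zc by (auto intro!: dvd_sum dvd_mult)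
        then show ?thesis using 3 i by (auto simp: coeff_pCons split: nat.splits)
      qed
    qed
    then have "[:int p:] dvd P i - ([:coeff (P i) 0:] + monom 1 i)" by (simp add: const_poly_dvd_iff)
    then obtain r where "P i - ([:coeff (P i) 0:] + monom 1 i) = [:int p:] * r" by (auto simp: dvd_def)
    then have "pcompose (P i - ([:coeff (P i) 0:] + monom 1 i)) [:-\<eta>, 1:] = pcompose ([:int p:] * r) [:-\<eta>, 1:]"
      by simp
    moreover have "pcompose (P i) [:-\<eta>, 1:] = Z i"
      by (simp add: P_def pcompose_pCons flip: pcompose_assoc)
    moreover have "pcompose (monom 1 i) [:-\<eta>, 1:] = [:-\<eta>, 1:] ^ i"
      by (simp add: monom_altdef pcompose_power pcompose_pCons)
    ultimately have "Z i - ([:coeff (P i) 0:] + [:-\<eta>, 1:] ^ i) = [:int p:] * pcompose r [:-\<eta>, 1:]"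
      by (simp add: pcompose_diff pcompose_add pcompose_mult pcompose_smult)
    then show ?thesis by (metis dvd_triv_left)
  qed
  define \<zeta> where "\<zeta> i = Z (h + i)" for i
  have "\<exists>\<gamma>. \<forall>m\<in>{1..l}. [coeff (pcompose (\<Sum>j=1..l. smult (\<gamma> j) (\<zeta> j)) [:\<xi>, 1:]) m = of_bool (m = i)] (mod int (p ^ (l * b')))"
    if "i \<in> {1..l}" for i
  proof (rule dual_vector_exists[where h = h and \<eta> = \<eta>])
    show "h + l < p" using l p by (simp add: h_def)
    fix j assume "j \<in> {1..l}"
    then have "h + j \<in> {1..k}" using l by (auto simp: h_def)
    from Zmod[OF this] show "\<exists>c. [:int p:] dvd \<zeta> j - ([:c:] + [:-\<eta>, 1:] ^ (h + j))"
      unfolding \<zeta>_def by blast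
  qed (use p sep that in auto)
  then have "\<exists>\<gamma>. \<forall>i\<in>{1..l}. \<forall>m\<in>{1..l}. [coeff (pcompose (\<Sum>j=1..l. smult (\<gamma> i j) (\<zeta> j)) [:\<xi>, 1:]) m = of_bool (m = i)] (mod int (p ^ (l * b')))"
    by (intro bchoice) auto
  then obtain \<gamma> where \<gamma>: "\<And>i m. i \<in> {1..l} \<Longrightarrow> m \<in> {1..l} \<Longrightarrow>
     [coeff (pcompose (\<Sum>j=1..l. smult (\<gamma> i j) (\<zeta> j)) [:\<xi>, 1:]) m = of_bool (m = i)] (mod int (p ^ (l * b')))" by blast
  define v where "v \<sigma> j = (\<Sum>i=1..l. \<sigma> i * int M * \<beta> (h + i) j)" for \<sigma> :: "nat \<Rightarrow> int" and j
  have vsum: "(\<Sum>j=1..k. v \<sigma> j * poly (z j) y) = (\<Sum>i=1..l. \<sigma> i * poly (\<zeta> i) y) * int M" for \<sigma> y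
  proof -
    have "(\<Sum>j=1..k. v \<sigma> j * poly (z j) y) = (\<Sum>i=1..l. \<sigma> i * int M * (\<Sum>j=1..k. \<beta> (h + i) j * poly (z j) y))"
      unfolding v_def sum_distrib_right sum_distrib_left by (subst sum.swap) (simp add: mult_ac)
    also have "\<dots> = (\<Sum>i=1..l. \<sigma> i * poly (\<zeta> i) y) * int M"
      by (simp add: \<zeta>_def Z_def poly_sum sum_distrib_left mult_ac)
    finally show ?thesis .
  qed
  define c where "c \<sigma> = (\<Sum>i=1..l. \<sigma> i * coeff (P (h + i)) 0) * int M" for \<sigma> :: "nat \<Rightarrow> int"
  have inv: "cmod (wave z k q f pos S2 (\<lambda>j. \<alpha> j + v \<sigma> j)) = cmod (wave z k q f pos S2 \<alpha>)" for \<alpha> \<sigma>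
  proof -
    \<comment> \<open>Dimension 0 on the right, an empty sum: the shift acts on the whole class by
      the single phase \<open>c \<sigma>\<close>.\<close>
    have ph: "[(\<Sum>j=1..k. v \<sigma> j * poly (z j) (pos x)) = c \<sigma> + (\<Sum>i=1..0. \<sigma> i * poly (z i) (pos x)) * int M] (mod int q)"
      if x: "x \<in> S2" for x
    proof -
      obtain w where w: "pos x = \<eta> + int (p ^ b) * w"
        using S2[OF x] by (auto simp: cong_iff_dvd_diff dvd_def algebra_simps)
      have zi: "[poly (\<zeta> i) (pos x) = coeff (P (h + i)) 0] (mod int q')" if i: "i \<in> {1..l}" for i
      proof -
        have i': "1 \<le> h + i" "h + i \<le> k" using i l by (auto simp: h_def)
        obtain u where u: "\<And>t. [poly (P (h + i)) (int (p ^ b) * t) = coeff (P (h + i)) 0 + int (p ^ (b * (h + i))) * poly u t] (mod int (p ^ (k * n)))"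
          using rescaled_component_exists[OF i' b P] i' by (metis atLeastAtMost_iff)
        have "poly (\<zeta> i) (pos x) = poly (P (h + i)) (int (p ^ b) * w)"
          by (simp add: \<zeta>_def P_def poly_pcompose w)
        moreover have "int q' dvd int (p ^ (k * n))" using lb by (simp add: q'_def le_imp_power_dvd)
        ultimately have "[poly (\<zeta> i) (pos x) = coeff (P (h + i)) 0 + int (p ^ (b * (h + i))) * poly u w] (mod int q')"
          using u cong_dvd_modulus by metis
        moreover have "int q' dvd int (p ^ (b * (h + i))) * poly u w"
        proof -
          have "l * b' = (h + 1) * b" using b' by (simp add: h_def)
          also have "\<dots> \<le> (h + i) * b" using i by (intro mult_le_mono) auto
          finally have "l * b' \<le> b * (h + i)" by (simp add: mult.commute)
          then show ?thesis by (simp add: q'_def le_imp_power_dvd dvd_mult2)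
        qed
        ultimately show ?thesis by (simp add: cong_iff_dvd_diff dvd_diff_right_iff diff_diff_eq2[symmetric])
          (metis add_diff_cancel_left' add_diff_eq cong_iff_dvd_diff dvd_add_left_iff diff_diff_add)
      qed
      have "[(\<Sum>i=1..l. \<sigma> i * poly (\<zeta> i) (pos x)) = (\<Sum>i=1..l. \<sigma> i * coeff (P (h + i)) 0)] (mod int q')"
        by (intro cong_sum cong_mult cong_refl zi)
      then have "[(\<Sum>i=1..l. \<sigma> i * poly (\<zeta> i) (pos x)) * int M = c \<sigma>] (mod int q' * int M)"
        unfolding c_def by (auto simp: cong_iff_dvd_diff simp flip: left_diff_distrib)
      then show ?thesis unfolding vsum using Mq by (simp add: mult.commute flip: of_nat_mult)
    qed
    have "cmod (wave z k q f pos S2 (\<lambda>j. \<alpha> j + v \<sigma> j)) =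
        cmod (wave z 0 q' (\<lambda>x. f x * e (real_of_int (\<Sum>j=1..k. \<alpha> j * poly (z j) (pos x)) / real q)) pos S2 \<sigma>)"
      by (rule wave_shift[OF q0 ph Mq])
    then show ?thesis by (simp add: wave_def)
  qed
  define F where "F \<alpha> x = f x * e (real_of_int (\<Sum>j=1..k. \<alpha> j * poly (z j) (pos x)) / real q)" for \<alpha> x
  define X where "X J \<alpha> = avg l q' (\<lambda>\<sigma>. cmod (wave \<zeta> l q' (F \<alpha>) pos J \<sigma>) ^ (2 * tri l))" for J \<alpha>
  define w where "w \<alpha> = cmod (wave z k q f pos S2 \<alpha>) ^ r" for \<alpha>
  have X0: "0 \<le> X J \<alpha>" for J \<alpha> by (simp add: X_def avg_nonneg)
  have avgX: "avg k q (\<lambda>\<alpha>. w \<alpha> * cmod (wave z k q f pos J \<alpha>) ^ (2 * tri l)) = avg k q (\<lambda>\<alpha>. w \<alpha> * X J \<alpha>)" for J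
  proof -
    have *: "cmod (wave z k q f pos J (\<lambda>j. \<alpha> j + v \<sigma> j)) = cmod (wave \<zeta> l q' (F \<alpha>) pos J \<sigma>)" for \<alpha> \<sigma>
      unfolding F_def by (intro wave_shift[where c = 0, OF q0 _ Mq]) (simp only: vsum add_0 cong_refl)
    have "periodic k q (\<lambda>\<alpha>. w \<alpha> * cmod (wave z k q f pos J \<alpha>) ^ (2 * tri l))"
      unfolding w_def by (rule periodic_comp2[OF periodic_wave periodic_wave])
    from avg_avg_shift[OF q0 this, where l' = l and v = v]
    show ?thesis by (simp add: w_def inv * X_def avg_cmult)
  qed
  have "avg k q (\<lambda>\<alpha>. w \<alpha> * X S \<alpha>) \<le> D * (\<Sum>J\<in>part (p ^ b') pos S. root (tri l) (avg k q (\<lambda>\<alpha>. w \<alpha> * X J \<alpha>))) ^ tri l"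
  proof (rule avg_minkowski)
    show "X S \<alpha> \<le> D * (\<Sum>J\<in>part (p ^ b') pos S. root (tri l) (X J \<alpha>)) ^ tri l" for \<alpha>
      using decoupling_rescaled[OF p(1) decoupling D a l(1) fin S \<gamma>, where f = "F \<alpha>"] by (simp add: block_sum_def X_def q'_def)
  qed (use fin D X0 tri_pos[OF l(1)] in \<open>auto simp: w_def\<close>)
  then show ?thesis by (simp only: avgX[unfolded w_def] w_def)
qed

section \<open>Bilinear decoupling\<close>

text \<open>The two exponents add up to the critical \<open>2 * tri k\<close>, while the wave over
  \<open>S\<close> has the critical exponent \<open>2 * tri l\<close> of dimension \<open>l\<close>,
  the dimension in which it is decoupled with the wave over \<open>S2\<close> as a weight. That
  \<open>\<xi>\<close> and \<open>\<eta>\<close> differ modulo \<open>p\<close> is the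
  transversality condition.\<close>

definition bilinear :: "nat \<Rightarrow> nat \<Rightarrow> nat \<Rightarrow> nat \<Rightarrow> nat \<Rightarrow> nat \<Rightarrow> real \<Rightarrow> bool" where
  "bilinear p k n l a b M \<longleftrightarrow> (\<forall>z f pos S S2 \<xi> \<eta>. curve p k z \<longrightarrow> finite S \<longrightarrow> finite S2 \<longrightarrow>
     (\<forall>x\<in>S. [pos x = \<xi>] (mod int (p ^ a))) \<longrightarrow> (\<forall>x\<in>S2. [pos x = \<eta>] (mod int (p ^ b))) \<longrightarrow> \<not> int p dvd \<xi> - \<eta> \<longrightarrow>
     avg k (p ^ (k * n)) (\<lambda>\<alpha>. cmod (wave z k (p ^ (k * n)) f pos S2 \<alpha>) ^ (2 * (tri k - tri l)) *
         cmod (wave z k (p ^ (k * n)) f pos S \<alpha>) ^ (2 * tri l))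
     \<le> M * (block_sum p k n z f pos S ^ tri l * block_sum p k n z f pos S2 ^ (tri k - tri l)))"

lemma bilinearD:
  assumes "bilinear p k n l a b M" "curve p k z" "finite S" "finite S2"
    "\<And>x. x \<in> S \<Longrightarrow> [pos x = \<xi>] (mod int (p ^ a))" "\<And>x. x \<in> S2 \<Longrightarrow> [pos x = \<eta>] (mod int (p ^ b))"
    "\<not> int p dvd \<xi> - \<eta>"
  shows "avg k (p ^ (k * n)) (\<lambda>\<alpha>. cmod (wave z k (p ^ (k * n)) f pos S2 \<alpha>) ^ (2 * (tri k - tri l)) *
         cmod (wave z k (p ^ (k * n)) f pos S \<alpha>) ^ (2 * tri l))
     \<le> M * (block_sum p k n z f pos S ^ tri l * block_sum p k n z f pos S2 ^ (tri k - tri l))"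
  using assms unfolding bilinear_def by blast

lemma root_nonneg: "0 \<le> x \<Longrightarrow> 0 \<le> root n x"
  by (cases "n = 0") auto

lemma block_sum_nonneg [simp]: "0 \<le> block_sum p l n z f pos S"
  unfolding block_sum_def by (intro sum_nonneg root_nonneg avg_nonneg) auto

text \<open>Squared norms add over a partition, which lets decoupling proceed in stages without
  loss.\<close>

lemma block_sum_part:
  "finite S \<Longrightarrow> b \<le> n \<Longrightarrow> (\<Sum>I\<in>part (p ^ b) pos S. block_sum p l n z f pos I) = block_sum p l n z f pos S"
  unfolding block_sum_def by (rule sum_part_refine[symmetric]) (auto simp: le_imp_power_dvd)

lemma block_sum_part_le:
  assumes "finite S" "b \<le> n" "I \<in> part (p ^ b) pos S"
  shows "block_sum p l n z f pos I \<le> block_sum p l n z f pos S"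
  unfolding block_sum_part[OF assms(1,2), symmetric] using assms by (intro member_le_sum) auto

lemma decouplingD:
  assumes "decoupling p l n D" "curve p l z" "finite S"
  shows "avg l (p ^ (l * n)) (\<lambda>\<alpha>. cmod (wave z l (p ^ (l * n)) f pos S \<alpha>) ^ (2 * tri l))
     \<le> D * block_sum p l n z f pos S ^ tri l"
  using assms unfolding decoupling_def by blast

lemma decoupling_mono: "decoupling p l n D \<Longrightarrow> D \<le> D' \<Longrightarrow> decoupling p l n D'"
  unfolding decoupling_def by (meson block_sum_nonneg mult_right_mono order_trans zero_le_power)

lemma bilinear_mono:
  assumes "bilinear p k n l a b M" "M \<le> M'"
  shows "bilinear p k n l a b M'"
  unfolding bilinear_def
proof (intro allI impI)
  fix z and f :: "int \<Rightarrow> complex" and pos :: "int \<Rightarrow> int" and S S2 :: "int set" and \<xi> \<eta>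
  assume "curve p k z" "finite S" "finite S2" "\<forall>x\<in>S. [pos x = \<xi>] (mod int (p ^ a))"
    "\<forall>x\<in>S2. [pos x = \<eta>] (mod int (p ^ b))" "\<not> int p dvd \<xi> - \<eta>"
  then have "avg k (p ^ (k * n)) (\<lambda>\<alpha>. cmod (wave z k (p ^ (k * n)) f pos S2 \<alpha>) ^ (2 * (tri k - tri l)) *
         cmod (wave z k (p ^ (k * n)) f pos S \<alpha>) ^ (2 * tri l))
     \<le> M * (block_sum p k n z f pos S ^ tri l * block_sum p k n z f pos S2 ^ (tri k - tri l))"
    by (intro bilinearD[OF assms(1)]) auto
  also have "\<dots> \<le> M' * (block_sum p k n z f pos S ^ tri l * block_sum p k n z f pos S2 ^ (tri k - tri l))"
    using assms(2) by (intro mult_right_mono) auto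
  finally show "avg k (p ^ (k * n)) (\<lambda>\<alpha>. cmod (wave z k (p ^ (k * n)) f pos S2 \<alpha>) ^ (2 * (tri k - tri l)) *
         cmod (wave z k (p ^ (k * n)) f pos S \<alpha>) ^ (2 * tri l))
     \<le> M' * (block_sum p k n z f pos S ^ tri l * block_sum p k n z f pos S2 ^ (tri k - tri l))" .
qed

lemma decoupling_curve_rescaled:
  assumes "prime p" "k < p" "curve p k z" "decoupling p k (n - a) D" "0 \<le> D" "1 \<le> a" "a \<le> n" "1 \<le> k" "finite S"
    and "\<And>x. x \<in> S \<Longrightarrow> [pos x = \<xi>] (mod int (p ^ a))"
  shows "avg k (p ^ (k * n)) (\<lambda>\<alpha>. cmod (wave z k (p ^ (k * n)) f pos S \<alpha>) ^ (2 * tri k))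
     \<le> D * block_sum p k n z f pos S ^ tri k"
proof -
  obtain \<beta> where "\<And>i m. i \<in> {1..k} \<Longrightarrow> m \<in> {1..k} \<Longrightarrow>
      [coeff (pcompose (\<Sum>j=1..k. smult (\<beta> i j) (z j)) [:\<xi>, 1:]) m = of_bool (m = i)] (mod int (p ^ (k * n)))"
    using curve_dual[OF assms(1-3)] by metis
  then show ?thesis using assms by (intro decoupling_rescaled[of p k n a D S pos \<xi> \<beta>]) auto
qed

text \<open>The source of every gain: for \<open>l = 0\<close> only the wave over \<open>S2\<close>
  remains, and its class of level \<open>b\<close> rescales to scale \<open>n - b\<close>.\<close>

lemma bilinear_zero:
  assumes "prime p" "k < p" "decoupling p k (n - b) D" "0 \<le> D" "1 \<le> b" "b \<le> n" "1 \<le> k"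
  shows "bilinear p k n 0 a b D"
  unfolding bilinear_def
proof (intro allI impI)
  fix z and f :: "int \<Rightarrow> complex" and pos :: "int \<Rightarrow> int" and S S2 :: "int set" and \<xi> \<eta>
  assume "curve p k z" "finite S2" "\<forall>x\<in>S2. [pos x = \<eta>] (mod int (p ^ b))"
  then show "avg k (p ^ (k * n)) (\<lambda>\<alpha>. cmod (wave z k (p ^ (k * n)) f pos S2 \<alpha>) ^ (2 * (tri k - tri 0)) *
         cmod (wave z k (p ^ (k * n)) f pos S \<alpha>) ^ (2 * tri 0))
     \<le> D * (block_sum p k n z f pos S ^ tri 0 * block_sum p k n z f pos S2 ^ (tri k - tri 0))"
    using decoupling_curve_rescaled[OF assms(1,2) _ assms(3-7), of z S2 pos \<eta> f] by simp
qed

text \<open>The wave over \<open>S\<close> is decoupled in dimension \<open>l\<close> from level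
  \<open>a\<close> to level \<open>b'\<close> against the weight given by \<open>S2\<close>, and the
  bilinear bound is applied to each piece. Roots of order \<open>tri l\<close> make the right side
  linear in the \<open>block_sum\<close> of the pieces, and these add up exactly.\<close>

lemma bilinear_lower:
  assumes p: "prime p" "k < p" and l: "1 \<le> l" "l \<le> k" and b': "l * b' = (k - l + 1) * b"
    and a: "1 \<le> a" "a \<le> b'" "b' \<le> n" and b: "1 \<le> b"
    and decoupling: "decoupling p l (b' - a) D" "0 \<le> D" and bilinear: "bilinear p k n l b' b M" "0 \<le> M"
  shows "bilinear p k n l a b (D * M)"
  unfolding bilinear_def
proof (intro allI impI)
  fix z and f :: "int \<Rightarrow> complex" and pos :: "int \<Rightarrow> int" and S S2 :: "int set" and \<xi> \<eta>
  assume curve: "curve p k z" and fin: "finite S" "finite S2"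
    and S: "\<forall>x\<in>S. [pos x = \<xi>] (mod int (p ^ a))" and S2: "\<forall>x\<in>S2. [pos x = \<eta>] (mod int (p ^ b))"
    and sep: "\<not> int p dvd \<xi> - \<eta>"
  let ?q = "p ^ (k * n)" and ?r = "tri k - tri l"
  let ?N = "block_sum p k n z f pos"
  let ?A = "\<lambda>J. avg k ?q (\<lambda>\<alpha>. cmod (wave z k ?q f pos S2 \<alpha>) ^ (2 * ?r) * cmod (wave z k ?q f pos J \<alpha>) ^ (2 * tri l))"
  have s: "0 < tri l" using tri_pos[OF l(1)] by simp
  have AJ: "?A J \<le> M * (?N J ^ tri l * ?N S2 ^ ?r)" if J: "J \<in> part (p ^ b') pos S" for J
  proof -
    obtain x where x: "x \<in> J" using part_nonempty[OF J] by blast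
    then have "int (p ^ a) dvd pos x - \<xi>" using S part_subset[OF J] by (auto simp: cong_iff_dvd_diff)
    moreover have "int p dvd int (p ^ a)" using a(1) by (simp add: dvd_power)
    ultimately have "int p dvd pos x - \<xi>" by (rule dvd_trans[rotated])
    moreover have "\<xi> - \<eta> = (pos x - \<eta>) - (pos x - \<xi>)" by simp
    ultimately have "\<not> int p dvd pos x - \<eta>" using sep by (metis dvd_diff)
    then show ?thesis
      using curve fin J S2 x finite_part_elem[OF fin(1) J] part_cong_elems[OF J]
      by (intro bilinearD[OF bilinear(1), where \<xi> = "pos x" and \<eta> = \<eta>]) auto
  qed
  have "?A S \<le> D * (\<Sum>J\<in>part (p ^ b') pos S. root (tri l) (?A J)) ^ tri l"
    using S S2 by (intro decoupling_weighted[OF p curve l b' a b fin(1) _ _ sep decoupling refl]) auto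
  also have "\<dots> \<le> D * (\<Sum>J\<in>part (p ^ b') pos S. root (tri l) (M * ?N S2 ^ ?r) * ?N J) ^ tri l"
  proof (intro mult_left_mono power_mono sum_mono)
    fix J assume "J \<in> part (p ^ b') pos S"
    then have "root (tri l) (?A J) \<le> root (tri l) (M * ?N S2 ^ ?r * ?N J ^ tri l)"
      using AJ s by (intro real_root_le_mono) (auto simp: mult_ac)
    also have "\<dots> = root (tri l) (M * ?N S2 ^ ?r) * ?N J"
      using s by (simp add: real_root_mult real_root_power_cancel)
    finally show "root (tri l) (?A J) \<le> root (tri l) (M * ?N S2 ^ ?r) * ?N J" .
  qed (use decoupling(2) in \<open>auto intro!: sum_nonneg root_nonneg avg_nonneg\<close>)
  also have "\<dots> = D * (root (tri l) (M * ?N S2 ^ ?r) * ?N S) ^ tri l"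
    using fin a by (simp add: block_sum_part flip: sum_distrib_left)
  also have "\<dots> = D * M * (?N S ^ tri l * ?N S2 ^ ?r)"
    using s bilinear(2) by (simp add: power_mult_distrib mult_ac)
  finally show "?A S \<le> D * M * (?N S ^ tri l * ?N S2 ^ ?r)" .
qed

lemma avg_holder:
  assumes "m \<le> t" "0 < t" "0 < q"
    and nn: "\<And>\<alpha>. 0 \<le> U \<alpha>" "\<And>\<alpha>. 0 \<le> X \<alpha>" "\<And>\<alpha>. 0 \<le> Y \<alpha>"
    and "\<And>\<alpha>. U \<alpha> ^ t \<le> X \<alpha> ^ m * Y \<alpha> ^ (t - m)"
  shows "avg k q U ^ t \<le> avg k q X ^ m * avg k q Y ^ (t - m)"
proof -
  have "sum U (resbox k q) ^ t \<le> sum X (resbox k q) ^ m * sum Y (resbox k q) ^ (t - m)"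
    using assms by (intro sum_power_holder) auto
  moreover have "(real q ^ k) ^ t = (real q ^ k) ^ m * (real q ^ k) ^ (t - m)"
    using assms(1) by (simp flip: power_add)
  ultimately show ?thesis using assms(3)
    by (simp add: avg_def power_divide divide_right_mono)
qed

text \<open>Bookkeeping for the Hoelder step: the exponent pair for \<open>l\<close> is the mean,
  with weights 1 / t and (t - 1) / t, of the exchanged pair for \<open>k - l\<close> and the pair
  for \<open>l - 1\<close>. Doubling and passing to \<open>int\<close> avoids \<open>div 2\<close>
  and truncated subtraction.\<close>

lemma tri_exponents:
  assumes l: "1 \<le> l" "l < k"
  defines "t \<equiv> k - l + 1"
  shows "t * tri l = (tri k - tri (k - l)) + (t - 1) * tri (l - 1)"
    and "t * (tri k - tri l) = tri (k - l) + (t - 1) * (tri k - tri (l - 1))"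
proof -
  obtain m where k: "k = l + Suc m" using l less_imp_Suc_add by auto
  obtain r where l': "l = Suc r" using l by (cases l) auto
  have t: "t = Suc (Suc m)" by (simp add: t_def k)
  have le: "tri (k - l) \<le> tri k" "tri l \<le> tri k" "tri (l - 1) \<le> tri k" using l by (auto intro!: tri_mono)
  have dbl: "2 * int (tri j) = int j * (int j + 1)" for j
    using two_tri[of j] by (metis of_nat_1 of_nat_add of_nat_mult of_nat_numeral)
  have h: "2 * int (tri k) = (int r + int m + 2) * (int r + int m + 3)"
    "2 * int (tri l) = (int r + 1) * (int r + 2)" "2 * int (tri (l - 1)) = int r * (int r + 1)"
    "2 * int (tri (k - l)) = (int m + 1) * (int m + 2)"
    unfolding dbl by (simp_all add: k l' algebra_simps)
  have cancel: "a = b" if "2 * int a = 2 * int b" for a b :: nat using that by simp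
  have "2 * int (t * tri l) = 2 * int ((tri k - tri (k - l)) + (t - 1) * tri (l - 1))"
    using h le unfolding t by (simp add: of_nat_diff algebra_simps)
  then show "t * tri l = (tri k - tri (k - l)) + (t - 1) * tri (l - 1)" by (rule cancel)
  obtain d1 d2 where d: "tri k = tri l + d1" "tri k = tri (l - 1) + d2" using le le_Suc_ex by metis
  then have d': "tri k - tri l = d1" "tri k - tri (l - 1) = d2" by simp_all
  have e1: "2 * int d1 = (int r + int m + 2) * (int r + int m + 3) - (int r + 1) * (int r + 2)"
    and e2: "2 * int d2 = (int r + int m + 2) * (int r + int m + 3) - int r * (int r + 1)"
    using d h by simp_all
  have "2 * int (t * d1) = int t * (2 * int d1)" by simp
  also have "\<dots> = 2 * int (tri (k - l)) + int (t - 1) * (2 * int d2)"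
    unfolding e1 e2 h(4) t by (simp add: algebra_simps)
  also have "\<dots> = 2 * int (tri (k - l) + (t - 1) * d2)" by (simp add: distrib_left)
  finally have "2 * int (t * d1) = 2 * int (tri (k - l) + (t - 1) * d2)" .
  then show "t * (tri k - tri l) = tri (k - l) + (t - 1) * (tri k - tri (l - 1))" unfolding d' by (rule cancel)
qed

text \<open>Hoelder with the exponents of \<open>tri_exponents\<close>. In the bound with
  \<open>M1\<close> the classes have exchanged roles: \<open>S\<close>, which has just been refined
  when this is applied, serves as the weight, and \<open>S2\<close> is the next to be
  decoupled.\<close>

lemma bilinear_holder:
  assumes p: "0 < p" and l: "1 \<le> l" "l < k"
    and M1: "bilinear p k n (k - l) b a M1" "0 \<le> M1" and M2: "bilinear p k n (l - 1) a b M2" "0 \<le> M2"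
    and M: "M1 * M2 ^ (k - l) \<le> M ^ (k - l + 1)" "0 \<le> M"
  shows "bilinear p k n l a b M"
  unfolding bilinear_def
proof (intro allI impI)
  fix z and f :: "int \<Rightarrow> complex" and pos :: "int \<Rightarrow> int" and S S2 :: "int set" and \<xi> \<eta>
  assume curve: "curve p k z" and fin: "finite S" "finite S2"
    and S: "\<forall>x\<in>S. [pos x = \<xi>] (mod int (p ^ a))" and S2: "\<forall>x\<in>S2. [pos x = \<eta>] (mod int (p ^ b))"
    and sep: "\<not> int p dvd \<xi> - \<eta>"
  let ?q = "p ^ (k * n)"
  let ?N = "block_sum p k n z f pos"
  let ?F = "\<lambda>\<alpha>. cmod (wave z k ?q f pos S \<alpha>)" and ?G = "\<lambda>\<alpha>. cmod (wave z k ?q f pos S2 \<alpha>)"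
  define t where "t = k - l + 1"
  have le: "tri (k - l) \<le> tri k" using l by (auto intro!: tri_mono)
  note ex = tri_exponents[OF l, folded t_def]
  have comb: "(x ^ (tri k - tri (k - l)) * y ^ tri (k - l)) * (x ^ tri (l - 1) * y ^ (tri k - tri (l - 1))) ^ (t - 1)
      = (x ^ tri l * y ^ (tri k - tri l)) ^ t" for x y :: real
  proof -
    have "(x ^ tri l * y ^ (tri k - tri l)) ^ t = x ^ (t * tri l) * y ^ (t * (tri k - tri l))"
      by (simp add: power_mult_distrib mult.commute flip: power_mult)
    also have "\<dots> = (x ^ (tri k - tri (k - l)) * y ^ tri (k - l)) * (x ^ ((t - 1) * tri (l - 1)) * y ^ ((t - 1) * (tri k - tri (l - 1))))"
      unfolding ex by (simp only: power_add mult_ac)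
    also have "x ^ ((t - 1) * tri (l - 1)) * y ^ ((t - 1) * (tri k - tri (l - 1)))
        = (x ^ tri (l - 1) * y ^ (tri k - tri (l - 1))) ^ (t - 1)"
      by (simp add: power_mult_distrib mult.commute flip: power_mult)
    finally show ?thesis by simp
  qed
  let ?U = "\<lambda>\<alpha>. ?G \<alpha> ^ (2 * (tri k - tri l)) * ?F \<alpha> ^ (2 * tri l)"
  let ?X = "\<lambda>\<alpha>. ?F \<alpha> ^ (2 * (tri k - tri (k - l))) * ?G \<alpha> ^ (2 * tri (k - l))"
  let ?Y = "\<lambda>\<alpha>. ?G \<alpha> ^ (2 * (tri k - tri (l - 1))) * ?F \<alpha> ^ (2 * tri (l - 1))"
  have X: "avg k ?q ?X \<le> M1 * (?N S ^ (tri k - tri (k - l)) * ?N S2 ^ tri (k - l))"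
  proof -
    have "\<not> int p dvd \<eta> - \<xi>" using sep by (simp add: dvd_diff_commute)
    from bilinearD[OF M1(1) curve fin(2,1) _ _ this, of pos f] S S2 show ?thesis by (auto simp: mult_ac)
  qed
  have Y: "avg k ?q ?Y \<le> M2 * (?N S ^ tri (l - 1) * ?N S2 ^ (tri k - tri (l - 1)))"
    using bilinearD[OF M2(1) curve fin _ _ sep, of pos f] S S2 by auto
  have "avg k ?q ?U ^ t \<le> avg k ?q ?X ^ 1 * avg k ?q ?Y ^ (t - 1)"
  proof (rule avg_holder)
    fix \<alpha>
    have "?U \<alpha> ^ t = ?X \<alpha> * ?Y \<alpha> ^ (t - 1)"
      using comb[of "?F \<alpha> ^ 2" "?G \<alpha> ^ 2"] by (simp add: mult.commute flip: power_mult)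
    then show "?U \<alpha> ^ t \<le> ?X \<alpha> ^ 1 * ?Y \<alpha> ^ (t - 1)" by simp
  qed (use p in \<open>auto simp: t_def\<close>)
  also have "\<dots> \<le> (M1 * (?N S ^ (tri k - tri (k - l)) * ?N S2 ^ tri (k - l)))
      * (M2 * (?N S ^ tri (l - 1) * ?N S2 ^ (tri k - tri (l - 1)))) ^ (t - 1)"
    unfolding power_one_right using M1(2) M2(2) by (intro mult_mono power_mono X Y) (auto intro!: avg_nonneg mult_nonneg_nonneg zero_le_power)
  also have "\<dots> = M1 * M2 ^ (t - 1) * (?N S ^ tri l * ?N S2 ^ (tri k - tri l)) ^ t"
    unfolding comb[symmetric] by (simp only: power_mult_distrib mult_ac)
  also have "\<dots> \<le> M ^ t * (?N S ^ tri l * ?N S2 ^ (tri k - tri l)) ^ t"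
    using M(1) by (intro mult_right_mono) (auto simp: t_def)
  finally have "avg k ?q ?U ^ t \<le> (M * (?N S ^ tri l * ?N S2 ^ (tri k - tri l))) ^ t"
    by (simp add: power_mult_distrib)
  then show "avg k ?q ?U \<le> M * (?N S ^ tri l * ?N S2 ^ (tri k - tri l))"
    by (subst (asm) power_mono_iff) (use M(2) in \<open>auto simp: t_def intro!: avg_nonneg mult_nonneg_nonneg\<close>)
qed

lemma bilinear_trivial:
  assumes p: "0 < p" and k: "1 \<le> k" and l: "l \<le> k" and decoupling: "decoupling p k n D" "0 \<le> D"
  shows "bilinear p k n l a b D"
  unfolding bilinear_def
proof (intro allI impI)
  fix z and f :: "int \<Rightarrow> complex" and pos :: "int \<Rightarrow> int" and S S2 :: "int set" and \<xi> \<eta>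
  assume curve: "curve p k z" and fin: "finite S" "finite S2"
  let ?q = "p ^ (k * n)"
  let ?N = "block_sum p k n z f pos"
  let ?W = "\<lambda>J \<alpha>. cmod (wave z k ?q f pos J \<alpha>)"
  let ?U = "\<lambda>\<alpha>. ?W S2 \<alpha> ^ (2 * (tri k - tri l)) * ?W S \<alpha> ^ (2 * tri l)"
  have le: "tri l \<le> tri k" and s: "0 < tri k" using l tri_mono tri_pos[OF k] by auto
  have "avg k ?q ?U ^ tri k \<le> avg k ?q (\<lambda>\<alpha>. ?W S \<alpha> ^ (2 * tri k)) ^ tri l * avg k ?q (\<lambda>\<alpha>. ?W S2 \<alpha> ^ (2 * tri k)) ^ (tri k - tri l)"
    by (rule avg_holder) (use le s p in \<open>auto simp: power_mult_distrib mult_ac simp flip: power_mult\<close>)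
  also have "\<dots> \<le> (D * ?N S ^ tri k) ^ tri l * (D * ?N S2 ^ tri k) ^ (tri k - tri l)"
    using decoupling(2) by (intro mult_mono power_mono decouplingD[OF decoupling(1) curve] fin) (auto intro!: avg_nonneg zero_le_power)
  also have "\<dots> = (D ^ tri l * D ^ (tri k - tri l)) * (?N S ^ tri l * ?N S2 ^ (tri k - tri l)) ^ tri k"
    by (simp add: power_mult_distrib mult_ac flip: power_mult)
  also have "D ^ tri l * D ^ (tri k - tri l) = D ^ tri k" using le by (simp flip: power_add)
  finally have "avg k ?q ?U ^ tri k \<le> (D * (?N S ^ tri l * ?N S2 ^ (tri k - tri l))) ^ tri k"
    by (simp add: power_mult_distrib)
  then show "avg k ?q ?U \<le> D * (?N S ^ tri l * ?N S2 ^ (tri k - tri l))"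
    by (subst (asm) power_mono_iff) (use s decoupling(2) in \<open>auto intro!: avg_nonneg mult_nonneg_nonneg\<close>)
qed

section \<open>Base cases of decoupling, and the return from bilinear to linear estimates\<close>

lemma diff_dvd_poly_diff: "x - y dvd poly P x - poly P y" for x y :: "'a :: comm_ring_1"
proof (induction P)
  case (pCons a P)
  have "poly (pCons a P) x - poly (pCons a P) y = x * (poly P x - poly P y) + (x - y) * poly P y"
    by (simp add: algebra_simps)
  then show ?case using pCons.IH by simp
qed simp

text \<open>Differences of values of \<open>z\<close> are \<open>x - y\<close> times
  \<open>1 + int p * u\<close>, a unit modulo every power of \<open>p\<close>.\<close>

lemma curve_one_cong_iff:
  assumes "[:int p:] dvd z - monom 1 1"
  shows "[poly z x = poly z y] (mod int (p ^ n)) \<longleftrightarrow> [x = y] (mod int (p ^ n))"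
proof -
  obtain r where "z - monom 1 1 = [:int p:] * r" using assms by (auto simp: dvd_def)
  then have "z = monom 1 1 + smult (int p) r" by (simp add: algebra_simps)
  then have "poly z x - poly z y = (x - y) + int p * (poly r x - poly r y)"
    by (simp add: poly_monom algebra_simps)
  moreover obtain u where "poly r x - poly r y = (x - y) * u"
    using diff_dvd_poly_diff[of x y r] by (auto simp: dvd_def)
  ultimately have eq: "poly z x - poly z y = (x - y) * (1 + int p * u)" by (simp add: algebra_simps)
  have "coprime (int p) (1 + int p * u)"
    by (metis coprime_1_right gcd_add_mult coprime_iff_gcd_eq_1 mult.commute add.commute)
  then have "coprime (int (p ^ n)) (1 + int p * u)" by simp
  then show ?thesis unfolding cong_iff_dvd_diff eq by (simp add: coprime_dvd_mult_left_iff)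
qed

text \<open>In dimension one the exponent is 2, and different classes have different frequencies
  modulo \<open>p ^ n\<close>, so this is orthogonality.\<close>

lemma decoupling_one:
  assumes p: "0 < p"
  shows "decoupling p 1 n 1"
  unfolding decoupling_def
proof (intro allI impI)
  fix z and f :: "int \<Rightarrow> complex" and pos :: "int \<Rightarrow> int" and S :: "int set"
  assume curve: "curve p 1 z" and fin: "finite S"
  let ?q = "p ^ (1 * n)"
  have z: "[:int p:] dvd z 1 - monom 1 1" using curve by (simp add: curve_def)
  define A where "A T = avg 1 ?q (\<lambda>\<alpha>. (cmod (wave z 1 ?q f pos T \<alpha>))\<^sup>2)" for T
  define g where "g x y = (if [pos x = pos y] (mod int ?q) then f x * cnj (f y) else 0)" for x y
  have A: "complex_of_real (A T) = (\<Sum>x\<in>T. \<Sum>y\<in>T. g x y)" if "finite T" for T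
    using avg_parseval[of ?q T 1 f "\<lambda>x j. poly (z j) (pos x)"] p that curve_one_cong_iff[OF z]
    unfolding A_def wave_def g_def by simp
  have "(\<Sum>x\<in>S. \<Sum>y\<in>S. g x y) = (\<Sum>J\<in>part (p ^ n) pos S. \<Sum>x\<in>J. \<Sum>y\<in>S. g x y)"
    by (rule sum_part[OF fin, symmetric])
  also have "\<dots> = (\<Sum>J\<in>part (p ^ n) pos S. \<Sum>x\<in>J. \<Sum>y\<in>J. g x y)"
  proof (rule sum.cong[OF refl], rule sum.cong[OF refl])
    fix J x assume J: "J \<in> part (p ^ n) pos S" "x \<in> J"
    show "(\<Sum>y\<in>S. g x y) = (\<Sum>y\<in>J. g x y)"
    proof (rule sum.mono_neutral_right[OF fin part_subset[OF J(1)]], intro ballI)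
      fix y assume "y \<in> S - J"
      then have "\<not> [pos y = pos x] (mod int (p ^ n))" using part_eqI[OF J] by auto
      then show "g x y = 0" by (auto simp: g_def cong_sym_eq)
    qed
  qed
  also have "\<dots> = (\<Sum>J\<in>part (p ^ n) pos S. complex_of_real (A J))"
    using finite_part_elem[OF fin] by (intro sum.cong refl) (simp add: A)
  finally have "complex_of_real (A S) = complex_of_real (\<Sum>J\<in>part (p ^ n) pos S. A J)"
    using A[OF fin] by simp
  then have "A S = (\<Sum>J\<in>part (p ^ n) pos S. A J)" by (simp only: of_real_eq_iff)
  then show "avg 1 ?q (\<lambda>\<alpha>. cmod (wave z 1 ?q f pos S \<alpha>) ^ (2 * tri 1)) \<le> 1 * block_sum p 1 n z f pos S ^ tri 1"
    by (simp add: A_def block_sum_def)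
qed

lemma decoupling_zero:
  assumes k: "1 \<le> k"
  shows "decoupling p k 0 1"
  unfolding decoupling_def
proof (intro allI impI)
  fix z and f :: "int \<Rightarrow> complex" and pos :: "int \<Rightarrow> int" and S :: "int set"
  have s: "0 < tri k" using tri_pos[OF k] by simp
  show "avg k (p ^ (k * 0)) (\<lambda>\<alpha>. cmod (wave z k (p ^ (k * 0)) f pos S \<alpha>) ^ (2 * tri k)) \<le> 1 * block_sum p k 0 z f pos S ^ tri k"
  proof (cases "S = {}")
    case True
    then show ?thesis using s by (simp add: wave_def avg_def block_sum_def part_def zero_power)
  next
    case False
    then have "part (p ^ 0) pos S = {S}" by (intro part_self) auto
    then show ?thesis using s by (simp add: block_sum_def avg_nonneg)
  qed
qed

text \<open>Triangle inequality over at most \<open>p ^ n\<close> classes. Its exponent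
  \<open>2 * tri k\<close> is where the descent in \<open>decoupling_epsilon\<close> starts.\<close>

lemma decoupling_crude:
  assumes p: "0 < p" and k: "1 \<le> k"
  shows "decoupling p k n (real p powr (real (2 * tri k) * real n))"
  unfolding decoupling_def
proof (intro allI impI)
  fix z and f :: "int \<Rightarrow> complex" and pos :: "int \<Rightarrow> int" and S :: "int set"
  assume fin: "finite S"
  let ?q = "p ^ (k * n)" and ?s = "tri k"
  let ?W = "\<lambda>J \<alpha>. cmod (wave z k ?q f pos J \<alpha>)"
  have s: "0 < ?s" using tri_pos[OF k] by simp
  define D where "D = real (p ^ n) ^ (2 * ?s)"
  have "avg k ?q (\<lambda>\<alpha>. 1 * ?W S \<alpha> ^ (2 * ?s))
      \<le> D * (\<Sum>J\<in>part (p ^ n) pos S. root ?s (avg k ?q (\<lambda>\<alpha>. 1 * ?W J \<alpha> ^ (2 * ?s)))) ^ ?s"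
  proof (rule avg_minkowski)
    fix \<alpha>
    have "?W S \<alpha> \<le> (\<Sum>J\<in>part (p ^ n) pos S. ?W J \<alpha>)"
      unfolding wave_part[OF fin, of z k ?q f pos \<alpha> "p ^ n"] by (rule norm_sum)
    then have "?W S \<alpha> ^ 2 \<le> (\<Sum>J\<in>part (p ^ n) pos S. ?W J \<alpha>) ^ 2" by (intro power_mono) auto
    also have "\<dots> \<le> real (p ^ n) ^ 2 * (\<Sum>J\<in>part (p ^ n) pos S. ?W J \<alpha> ^ 2)"
      using power_sum_le_card_power[of "part (p ^ n) pos S" "p ^ n" 2 "\<lambda>J. ?W J \<alpha>"] fin p card_part_le[of "p ^ n" pos S]
      by auto
    also have "(\<Sum>J\<in>part (p ^ n) pos S. ?W J \<alpha> ^ 2) = (\<Sum>J\<in>part (p ^ n) pos S. root ?s (?W J \<alpha> ^ (2 * ?s)))"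
      using s by (simp add: power_mult real_root_power_cancel)
    finally have "(?W S \<alpha> ^ 2) ^ ?s \<le> (real (p ^ n) ^ 2 * (\<Sum>J\<in>part (p ^ n) pos S. root ?s (?W J \<alpha> ^ (2 * ?s)))) ^ ?s"
      by (intro power_mono) auto
    then show "?W S \<alpha> ^ (2 * ?s) \<le> D * (\<Sum>J\<in>part (p ^ n) pos S. root ?s (?W J \<alpha> ^ (2 * ?s))) ^ ?s"
      by (simp only: power_mult power_mult_distrib D_def)
  qed (use fin s in \<open>auto simp: D_def\<close>)
  moreover have "D = real p powr (real (2 * tri k) * real n)"
    using p by (simp add: D_def powr_realpow mult.commute flip: of_nat_mult power_mult)
  ultimately show "avg k ?q (\<lambda>\<alpha>. ?W S \<alpha> ^ (2 * ?s)) \<le> real p powr (real (2 * tri k) * real n) * block_sum p k n z f pos S ^ ?s"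
    by (simp add: block_sum_def)
qed

text \<open>The way back to level 1 by brute force: \<open>S2\<close> is cut into its classes of
  level \<open>b\<close>. The cost is exponential in \<open>b\<close>, just like the gain, so the
  gain must have the larger rate.\<close>

lemma bilinear_split:
  assumes p: "0 < p" and l: "l < k" and b: "1 \<le> b" "b \<le> n" and bilinear: "bilinear p k n l a b M" "0 \<le> M"
  shows "bilinear p k n l a 1 (real p ^ (2 * b * tri k) * M)"
  unfolding bilinear_def
proof (intro allI impI)
  fix z and f :: "int \<Rightarrow> complex" and pos :: "int \<Rightarrow> int" and S S2 :: "int set" and \<xi> \<eta>
  assume curve: "curve p k z" and fin: "finite S" "finite S2"
    and S: "\<forall>x\<in>S. [pos x = \<xi>] (mod int (p ^ a))" and S2: "\<forall>x\<in>S2. [pos x = \<eta>] (mod int (p ^ 1))"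
    and sep: "\<not> int p dvd \<xi> - \<eta>"
  let ?q = "p ^ (k * n)" and ?r = "tri k - tri l"
  let ?N = "block_sum p k n z f pos"
  let ?W = "\<lambda>J \<alpha>. cmod (wave z k ?q f pos J \<alpha>)"
  let ?P = "part (p ^ b) pos S2"
  have r: "0 < ?r" using tri_strict_mono[OF l] by simp
  define C where "C = real p ^ (2 * b * tri k)"
  have pw: "?W S2 \<alpha> ^ (2 * ?r) \<le> C * (\<Sum>J\<in>?P. ?W J \<alpha> ^ (2 * ?r))" for \<alpha>
  proof -
    have "?W S2 \<alpha> \<le> (\<Sum>J\<in>?P. ?W J \<alpha>)"
      unfolding wave_part[OF fin(2), of z k ?q f pos \<alpha> "p ^ b"] by (rule norm_sum)
    then have "?W S2 \<alpha> ^ (2 * ?r) \<le> (\<Sum>J\<in>?P. ?W J \<alpha>) ^ (2 * ?r)" by (intro power_mono) auto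
    also have "\<dots> \<le> real (p ^ b) ^ (2 * ?r) * (\<Sum>J\<in>?P. ?W J \<alpha> ^ (2 * ?r))"
      using power_sum_le_card_power[of ?P "p ^ b" "2 * ?r" "\<lambda>J. ?W J \<alpha>"] fin p card_part_le[of "p ^ b" pos S2] r
      by (auto simp: zero_power)
    also have "\<dots> \<le> C * (\<Sum>J\<in>?P. ?W J \<alpha> ^ (2 * ?r))"
    proof (intro mult_right_mono sum_nonneg)
      have "b * (2 * ?r) \<le> 2 * b * tri k" by simp
      then have "real p ^ (b * (2 * ?r)) \<le> C" unfolding C_def using p by (intro power_increasing) auto
      then show "real (p ^ b) ^ (2 * ?r) \<le> C" by (simp add: power_mult)
    qed auto
    finally show ?thesis .
  qed
  have C0: "0 \<le> C" by (simp add: C_def)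
  have "avg k ?q (\<lambda>\<alpha>. ?W S2 \<alpha> ^ (2 * ?r) * ?W S \<alpha> ^ (2 * tri l))
     \<le> avg k ?q (\<lambda>\<alpha>. C * (\<Sum>J\<in>?P. ?W J \<alpha> ^ (2 * ?r) * ?W S \<alpha> ^ (2 * tri l)))"
  proof (rule avg_mono)
    fix \<alpha>
    show "?W S2 \<alpha> ^ (2 * ?r) * ?W S \<alpha> ^ (2 * tri l) \<le> C * (\<Sum>J\<in>?P. ?W J \<alpha> ^ (2 * ?r) * ?W S \<alpha> ^ (2 * tri l))"
      using mult_right_mono[OF pw, of "?W S \<alpha> ^ (2 * tri l)"] by (simp add: sum_distrib_right mult.assoc)
  qed
  also have "\<dots> = C * (\<Sum>J\<in>?P. avg k ?q (\<lambda>\<alpha>. ?W J \<alpha> ^ (2 * ?r) * ?W S \<alpha> ^ (2 * tri l)))"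
    by (simp add: avg_cmult avg_sum)
  also have "\<dots> \<le> C * (\<Sum>J\<in>?P. M * ?N S ^ tri l * ?N J ^ ?r)"
  proof (intro mult_left_mono sum_mono C0)
    fix J assume J: "J \<in> ?P"
    then obtain y where y: "y \<in> J" using part_nonempty by blast
    then have "int p dvd pos y - \<eta>" using S2 part_subset[OF J] by (auto simp: cong_iff_dvd_diff)
    moreover have "\<xi> - \<eta> = (\<xi> - pos y) + (pos y - \<eta>)" by simp
    ultimately have "\<not> int p dvd \<xi> - pos y" using sep by (metis dvd_add)
    then have "avg k ?q (\<lambda>\<alpha>. ?W J \<alpha> ^ (2 * ?r) * ?W S \<alpha> ^ (2 * tri l)) \<le> M * (?N S ^ tri l * ?N J ^ ?r)"
      using S fin finite_part_elem[OF fin(2) J] part_cong_elems[OF J _ y]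
      by (intro bilinearD[OF bilinear(1) curve, where \<xi> = \<xi> and \<eta> = "pos y"]) auto
    then show "avg k ?q (\<lambda>\<alpha>. ?W J \<alpha> ^ (2 * ?r) * ?W S \<alpha> ^ (2 * tri l)) \<le> M * ?N S ^ tri l * ?N J ^ ?r"
      by (simp add: mult.assoc)
  qed
  also have "\<dots> = C * (M * ?N S ^ tri l * (\<Sum>J\<in>?P. ?N J ^ ?r))" by (simp add: sum_distrib_left)
  also have "\<dots> \<le> C * (M * ?N S ^ tri l * (\<Sum>J\<in>?P. ?N J) ^ ?r)"
    using r fin bilinear(2) C0 by (intro mult_left_mono sum_power_le_power_sum) auto
  also have "\<dots> = C * M * (?N S ^ tri l * ?N S2 ^ ?r)"
    using fin b by (simp add: block_sum_part)
  finally show "avg k ?q (\<lambda>\<alpha>. ?W S2 \<alpha> ^ (2 * ?r) * ?W S \<alpha> ^ (2 * tri l)) \<le> real p ^ (2 * b * tri k) * M * (?N S ^ tri l * ?N S2 ^ ?r)"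
    by (simp add: C_def)
qed

text \<open>\<open>S\<close> is split modulo \<open>p\<close>. Single classes rescale by one level
  and reproduce the bound for \<open>n - 1\<close>, with a factor \<open>\<rho>\<close>; products of
  two different classes are transversal and fall to the bilinear estimate.\<close>

lemma decoupling_from_Bil:
  assumes p: "prime p" "k < p" and k: "1 \<le> k" and l: "l \<le> k" and \<rho>: "1 < \<rho>"
  obtains C where "0 \<le> C"
    "\<And>n D M. 1 \<le> n \<Longrightarrow> decoupling p k (n - 1) D \<Longrightarrow> 0 \<le> D \<Longrightarrow> bilinear p k n l 1 1 M \<Longrightarrow> 0 \<le> M \<Longrightarrow> decoupling p k n (\<rho> * D + C * M)"
proof -
  have p0: "0 < p" using p by (simp add: prime_gt_0_nat)
  let ?s = "tri k"
  have s: "0 < ?s" using tri_pos[OF k] by simp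
  have ls: "tri l \<le> ?s" using tri_mono[OF l] .
  obtain C where C: "C \<ge> 0"
    "\<And>(J :: int set set) u. finite J \<Longrightarrow> card J \<le> p \<Longrightarrow> (\<And>j. j \<in> J \<Longrightarrow> (0::real) \<le> u j) \<Longrightarrow>
      (\<Sum>j\<in>J. u j) ^ (2 * ?s) \<le> \<rho> * (\<Sum>j\<in>J. u j ^ (2 * ?s)) + C * (\<Sum>j\<in>J. \<Sum>i\<in>J - {j}. u j ^ ?s * u i ^ ?s)"
    using broad_narrow[OF \<rho> s, where P = p and 'a = "int set"] by blast
  define C' where "C' = C * (real p * real p)"
  show ?thesis
  proof (rule that[of C'])
    show "0 \<le> C'" using C(1) by (simp add: C'_def)
    fix n D M assume n: "1 \<le> n" and D: "decoupling p k (n - 1) D" "0 \<le> D" and M: "bilinear p k n l 1 1 M" "0 \<le> M"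
    show "decoupling p k n (\<rho> * D + C' * M)"
      unfolding decoupling_def
    proof (intro allI impI)
      fix z and f :: "int \<Rightarrow> complex" and pos :: "int \<Rightarrow> int" and S :: "int set"
      assume curve: "curve p k z" and fin: "finite S"
      let ?q = "p ^ (k * n)"
      let ?N = "block_sum p k n z f pos"
      let ?W = "\<lambda>J \<alpha>. cmod (wave z k ?q f pos J \<alpha>)"
      let ?P = "part (p ^ 1) pos S"
      have finJ: "finite J" if "J \<in> ?P" for J using finite_part_elem[OF fin that] .
      have cardP: "card ?P \<le> p" using card_part_le[of "p ^ 1" pos S] p0 by simp
      have pw: "?W S \<alpha> ^ (2 * ?s) \<le> \<rho> * (\<Sum>J\<in>?P. ?W J \<alpha> ^ (2 * ?s)) + C * (\<Sum>J\<in>?P. \<Sum>I\<in>?P - {J}. ?W J \<alpha> ^ ?s * ?W I \<alpha> ^ ?s)" for \<alpha>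
      proof -
        have "?W S \<alpha> \<le> (\<Sum>J\<in>?P. ?W J \<alpha>)"
          unfolding wave_part[OF fin, of z k ?q f pos \<alpha> "p ^ 1"] by (rule norm_sum)
        then have "?W S \<alpha> ^ (2 * ?s) \<le> (\<Sum>J\<in>?P. ?W J \<alpha>) ^ (2 * ?s)" by (intro power_mono) auto
        also have "\<dots> \<le> \<rho> * (\<Sum>J\<in>?P. ?W J \<alpha> ^ (2 * ?s)) + C * (\<Sum>J\<in>?P. \<Sum>I\<in>?P - {J}. ?W J \<alpha> ^ ?s * ?W I \<alpha> ^ ?s)"
          using fin cardP by (intro C(2)) auto
        finally show ?thesis .
      qed
      have narrow: "(\<Sum>J\<in>?P. avg k ?q (\<lambda>\<alpha>. ?W J \<alpha> ^ (2 * ?s))) \<le> D * ?N S ^ ?s"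
      proof -
        have "(\<Sum>J\<in>?P. avg k ?q (\<lambda>\<alpha>. ?W J \<alpha> ^ (2 * ?s))) \<le> (\<Sum>J\<in>?P. D * ?N J ^ ?s)"
        proof (rule sum_mono)
          fix J assume J: "J \<in> ?P"
          then obtain x where x: "x \<in> J" using part_nonempty by blast
          show "avg k ?q (\<lambda>\<alpha>. ?W J \<alpha> ^ (2 * ?s)) \<le> D * ?N J ^ ?s"
            using part_cong_elems[OF J _ x] by (intro decoupling_curve_rescaled[OF p curve D _ n k finJ[OF J], of pos "pos x"]) auto
        qed
        also have "\<dots> = D * (\<Sum>J\<in>?P. ?N J ^ ?s)" by (simp add: sum_distrib_left)
        also have "\<dots> \<le> D * (\<Sum>J\<in>?P. ?N J) ^ ?s"
          using D(2) fin s by (intro mult_left_mono sum_power_le_power_sum) auto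
        finally show ?thesis using fin n by (simp only: block_sum_part)
      qed
      have broad: "avg k ?q (\<lambda>\<alpha>. ?W J \<alpha> ^ ?s * ?W I \<alpha> ^ ?s) \<le> M * ?N S ^ ?s"
        if J: "J \<in> ?P" and I: "I \<in> ?P" and ne: "J \<noteq> I" for I J
      proof -
        obtain x y where xy: "x \<in> J" "y \<in> I" using part_nonempty[OF J] part_nonempty[OF I] by blast
        have sep: "\<not> int p dvd pos x - pos y" "\<not> int p dvd pos y - pos x"
          using part_separated[OF J I ne xy] by (auto simp: cong_iff_dvd_diff dvd_diff_commute)
        have NJ: "?N J \<le> ?N S" and NI: "?N I \<le> ?N S" using block_sum_part_le[OF fin n] J I by auto
        \<comment> \<open>The symmetric product is the geometric mean of a bilinear integrand and
          its exchanged version, so Cauchy-Schwarz reduces it to two bilinear bounds.\<close>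
        let ?X = "\<lambda>\<alpha>. ?W I \<alpha> ^ (2 * (?s - tri l)) * ?W J \<alpha> ^ (2 * tri l)"
        let ?Y = "\<lambda>\<alpha>. ?W J \<alpha> ^ (2 * (?s - tri l)) * ?W I \<alpha> ^ (2 * tri l)"
        have top: "?N S ^ tri l * ?N S ^ (?s - tri l) = ?N S ^ ?s" using ls by (simp flip: power_add)
        have X: "avg k ?q ?X \<le> M * ?N S ^ ?s"
        proof -
          have "avg k ?q ?X \<le> M * (?N J ^ tri l * ?N I ^ (?s - tri l))"
            using finJ J I xy part_cong_elems[OF J] part_cong_elems[OF I] sep
            by (intro bilinearD[OF M(1) curve, where \<xi> = "pos x" and \<eta> = "pos y"]) auto
          also have "\<dots> \<le> M * (?N S ^ tri l * ?N S ^ (?s - tri l))"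
            using M(2) NJ NI by (intro mult_left_mono mult_mono power_mono) auto
          finally show ?thesis unfolding top .
        qed
        have Y: "avg k ?q ?Y \<le> M * ?N S ^ ?s"
        proof -
          have "avg k ?q ?Y \<le> M * (?N I ^ tri l * ?N J ^ (?s - tri l))"
            using finJ J I xy part_cong_elems[OF J] part_cong_elems[OF I] sep
            by (intro bilinearD[OF M(1) curve, where \<xi> = "pos y" and \<eta> = "pos x"]) auto
          also have "\<dots> \<le> M * (?N S ^ tri l * ?N S ^ (?s - tri l))"
            using M(2) NJ NI by (intro mult_left_mono mult_mono power_mono) auto
          finally show ?thesis unfolding top .
        qed
        have ex: "2 * (?s - tri l) + 2 * tri l = 2 * ?s" using ls by simp
        have "avg k ?q (\<lambda>\<alpha>. ?W J \<alpha> ^ ?s * ?W I \<alpha> ^ ?s) ^ 2 \<le> avg k ?q ?X ^ 1 * avg k ?q ?Y ^ (2 - 1)"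
        proof (rule avg_holder)
          fix \<alpha>
          have "?X \<alpha> * ?Y \<alpha> = ?W J \<alpha> ^ (2 * (?s - tri l) + 2 * tri l) * ?W I \<alpha> ^ (2 * (?s - tri l) + 2 * tri l)"
            by (simp only: power_add mult_ac)
          also have "\<dots> = (?W J \<alpha> ^ ?s * ?W I \<alpha> ^ ?s) ^ 2"
            unfolding ex by (simp add: power_mult_distrib mult.commute flip: power_mult)
          finally show "(?W J \<alpha> ^ ?s * ?W I \<alpha> ^ ?s) ^ 2 \<le> ?X \<alpha> ^ 1 * ?Y \<alpha> ^ (2 - 1)" by simp
        qed (use p0 in auto)
        also have "\<dots> = avg k ?q ?X * avg k ?q ?Y" by simp
        also have "\<dots> \<le> (M * ?N S ^ ?s) * (M * ?N S ^ ?s)"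
          using M(2) by (intro mult_mono X Y) (auto intro!: avg_nonneg)
        finally have "avg k ?q (\<lambda>\<alpha>. ?W J \<alpha> ^ ?s * ?W I \<alpha> ^ ?s) ^ 2 \<le> (M * ?N S ^ ?s) ^ 2"
          by (simp add: power2_eq_square)
        then show ?thesis using M(2) by (auto intro: power2_le_imp_le)
      qed
      have "avg k ?q (\<lambda>\<alpha>. ?W S \<alpha> ^ (2 * ?s))
         \<le> avg k ?q (\<lambda>\<alpha>. \<rho> * (\<Sum>J\<in>?P. ?W J \<alpha> ^ (2 * ?s)) + C * (\<Sum>J\<in>?P. \<Sum>I\<in>?P - {J}. ?W J \<alpha> ^ ?s * ?W I \<alpha> ^ ?s))"
        by (intro avg_mono pw)
      also have "\<dots> = \<rho> * (\<Sum>J\<in>?P. avg k ?q (\<lambda>\<alpha>. ?W J \<alpha> ^ (2 * ?s)))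
           + C * (\<Sum>J\<in>?P. \<Sum>I\<in>?P - {J}. avg k ?q (\<lambda>\<alpha>. ?W J \<alpha> ^ ?s * ?W I \<alpha> ^ ?s))"
        by (simp only: avg_add avg_cmult avg_sum)
      also have "\<dots> \<le> \<rho> * (D * ?N S ^ ?s) + C * (\<Sum>J\<in>?P. \<Sum>I\<in>?P - {J}. M * ?N S ^ ?s)"
        using C(1) \<rho> by (intro add_mono mult_left_mono narrow sum_mono broad) auto
      also have "\<dots> \<le> \<rho> * (D * ?N S ^ ?s) + C * ((real p * real p) * (M * ?N S ^ ?s))"
      proof (intro add_left_mono mult_left_mono C(1))
        have "(\<Sum>J\<in>?P. \<Sum>I\<in>?P - {J}. M * ?N S ^ ?s) \<le> (\<Sum>J\<in>?P. \<Sum>I\<in>?P. M * ?N S ^ ?s)"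
          using fin M(2) by (intro sum_mono sum_mono2) auto
        also have "\<dots> = (real (card ?P) * real (card ?P)) * (M * ?N S ^ ?s)" by simp
        also have "\<dots> \<le> (real p * real p) * (M * ?N S ^ ?s)"
          using cardP M(2) by (intro mult_right_mono mult_mono) auto
        finally show "(\<Sum>J\<in>?P. \<Sum>I\<in>?P - {J}. M * ?N S ^ ?s) \<le> (real p * real p) * (M * ?N S ^ ?s)" .
      qed
      finally show "avg k ?q (\<lambda>\<alpha>. ?W S \<alpha> ^ (2 * ?s)) \<le> (\<rho> * D + C' * M) * ?N S ^ ?s"
        by (simp add: C'_def algebra_simps)
    qed
  qed
qed

section \<open>Iterating the bilinear estimate\<close>

text \<open>After \<open>r\<close> rounds the bilinear constant is about p ^ (\<eta> n - \<eta> g b)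
  with g = \<open>gain k r l\<close>. The coefficient 1 / l is the Hoelder weight 1 / (k - l + 1)
  times the ratio b' / b = (k - l + 1) / l.\<close>

fun gain :: "nat \<Rightarrow> nat \<Rightarrow> nat \<Rightarrow> real" where
  "gain k 0 l = of_bool (l = 0)"
| "gain k (Suc r) l = (if l = 0 then 1
     else gain k r (k - l) / real l + real (k - l) / real (k - l + 1) * gain k r (l - 1))"

lemma gain_0 [simp]: "gain k r 0 = 1"
  by (cases r) auto

text \<open>Summing the recursion over \<open>l\<close>, each old value \<open>gain k r l\<close> with \<open>l \<ge> 1\<close> receives total
  weight \<open>1 / (k - l) + (k - l - 1) / (k - l) = 1\<close>, so every step adds exactly the contribution
  \<open>(k - 1) / k\<close> of \<open>l = 0\<close>.\<close>

lemma sum_gain: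
  assumes k: "2 \<le> k"
  shows "(\<Sum>l=1..k-1. gain k r l) = real r * (real (k - 1) / real k)"
proof (induction r)
  case 0
  have "sum (gain k 0) {1..k-1} = 0" by (intro sum.neutral) auto
  then show ?case by simp
next
  case (Suc r)
  let ?g = "gain k r"
  have "(\<Sum>l=1..k-1. gain k (Suc r) l)
      = (\<Sum>l=1..k-1. ?g (k - l) / real l) + (\<Sum>l=1..k-1. real (k - l) / real (k - l + 1) * ?g (l - 1))"
    by (simp add: sum.distrib)
  also have "(\<Sum>l=1..k-1. ?g (k - l) / real l) = (\<Sum>m=1..k-1. ?g m / real (k - m))"
    by (rule sum.reindex_bij_witness[of _ "\<lambda>m. k - m" "\<lambda>m. k - m"]) auto
  also have "(\<Sum>l=1..k-1. real (k - l) / real (k - l + 1) * ?g (l - 1))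
      = (\<Sum>m\<in>{0..k-2}. real (k - m - 1) / real (k - m) * ?g m)"
    using k by (intro sum.reindex_bij_witness[of _ Suc "\<lambda>l. l - 1"]) (auto simp: Suc_diff_Suc)
  also have "\<dots> = (\<Sum>m\<in>{0..k-1}. real (k - m - 1) / real (k - m) * ?g m)"
    using k by (intro sum.mono_neutral_left) auto
  also have "\<dots> = real (k - 1) / real k + (\<Sum>m=1..k-1. real (k - m - 1) / real (k - m) * ?g m)"
    using k by (subst sum.atLeast_Suc_atMost) auto
  also have "(\<Sum>m=1..k-1. ?g m / real (k - m)) + (real (k - 1) / real k + (\<Sum>m=1..k-1. real (k - m - 1) / real (k - m) * ?g m))
      = real (k - 1) / real k + (\<Sum>m=1..k-1. ?g m / real (k - m) + real (k - m - 1) / real (k - m) * ?g m)"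
    by (simp add: sum.distrib)
  also have "(\<Sum>m=1..k-1. ?g m / real (k - m) + real (k - m - 1) / real (k - m) * ?g m) = (\<Sum>m=1..k-1. ?g m)"
  proof (rule sum.cong[OF refl])
    fix m assume "m \<in> {1..k-1}"
    then have pos: "real (k - m) > 0" and eq: "real (k - m - 1) = real (k - m) - 1" using k by (auto simp: of_nat_diff)
    have "?g m / x + (x - 1) / x * ?g m = ?g m" if "x > 0" for x :: real using that by (simp add: field_simps)
    then show "?g m / real (k - m) + real (k - m - 1) / real (k - m) * ?g m = ?g m"
      unfolding eq using pos by blast
  qed
  finally show ?case by (simp only: Suc of_nat_Suc distrib_right mult_1)
qed

text \<open>One round: decouple the first factor in dimension \<open>l\<close> down to scale \<open>b' = (k - l + 1) b / l\<close>,
  then interpolate between the exchanged pair in dimension \<open>k - l\<close> and the pair in dimension \<open>l - 1\<close>.\<close>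

lemma bilinear_stage:
  assumes p: "prime p" "k < p" and k: "2 \<le> k" and \<eta>: "0 \<le> \<eta>"
    and D: "\<And>n. decoupling p k n (C0 * real p powr (\<eta> * real n))" "0 \<le> C0"
    and IH: "\<And>l \<epsilon>. 1 \<le> l \<Longrightarrow> l < k \<Longrightarrow> 0 < \<epsilon> \<Longrightarrow> \<exists>C\<ge>0. \<forall>n. decoupling p l n (C * real p powr (\<epsilon> * real n))"
    and \<epsilon>: "0 < \<epsilon>"
  shows "\<exists>C\<ge>0. \<forall>n a b l. 1 \<le> a \<longrightarrow> 1 \<le> b \<longrightarrow> l < k \<longrightarrow> fact k ^ r dvd b \<longrightarrow> l * a \<le> (k - l + 1) * b \<longrightarrow> k ^ r * b \<le> n \<longrightarrow>
    bilinear p k n l a b (C * real p powr (\<eta> * real n - \<eta> * gain k r l * real b + \<epsilon> * real n))"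
  using \<epsilon>
proof (induction r arbitrary: \<epsilon>)
  case 0
  have p1: "1 < p" using prime_gt_1_nat[OF p(1)] by simp
  show ?case
  proof (intro exI[of _ C0] conjI D(2) allI impI)
    fix n a b l :: nat assume h: "1 \<le> b" "l < k" "k ^ 0 * b \<le> n"
    show "bilinear p k n l a b (C0 * real p powr (\<eta> * real n - \<eta> * gain k 0 l * real b + \<epsilon> * real n))"
    proof (cases "l = 0")
      case True
      have "bilinear p k n 0 a b (C0 * real p powr (\<eta> * real (n - b)))"
        by (rule bilinear_zero[OF p D(1)]) (use h k D(2) in auto)
      then show ?thesis unfolding True
        by (rule bilinear_mono) (use h 0 p1 D(2) in \<open>auto intro!: mult_left_mono simp: of_nat_diff algebra_simps\<close>)
    next
      case False
      have "bilinear p k n l a b (C0 * real p powr (\<eta> * real n))"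
        by (rule bilinear_trivial[OF _ _ _ D(1)]) (use p1 h k D(2) in auto)
      then show ?thesis
        by (rule bilinear_mono) (use False h 0 p1 D(2) in \<open>auto intro!: mult_left_mono\<close>)
    qed
  qed
next
  case (Suc r)
  have p1: "1 < p" using prime_gt_1_nat[OF p(1)] by simp
  have e2: "0 < \<epsilon> / 2" using Suc.prems by simp
  obtain C1 where C1: "C1 \<ge> 0" and st: "\<And>n a b l. 1 \<le> a \<Longrightarrow> 1 \<le> b \<Longrightarrow> l < k \<Longrightarrow> fact k ^ r dvd b \<Longrightarrow> l * a \<le> (k - l + 1) * b \<Longrightarrow> k ^ r * b \<le> n \<Longrightarrow>
    bilinear p k n l a b (C1 * real p powr (\<eta> * real n - \<eta> * gain k r l * real b + \<epsilon> / 2 * real n))"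
    using Suc.IH[OF e2] by blast
  have "\<forall>l\<in>{1..<k}. \<exists>C. C \<ge> 0 \<and> (\<forall>n. decoupling p l n (C * real p powr (\<epsilon> / 2 * real n)))"
  proof
    fix l assume "l \<in> {1..<k}"
    then have "1 \<le> l" "l < k" by auto
    from IH[OF this e2] show "\<exists>C. C \<ge> 0 \<and> (\<forall>n. decoupling p l n (C * real p powr (\<epsilon> / 2 * real n)))" by blast
  qed
  then obtain Cd where Cd: "\<And>l. l \<in> {1..<k} \<Longrightarrow> Cd l \<ge> 0"
    "\<And>l n. l \<in> {1..<k} \<Longrightarrow> decoupling p l n (Cd l * real p powr (\<epsilon> / 2 * real n))" by metis
  define Cm where "Cm = sum Cd {1..<k}"
  have Cm0: "0 \<le> Cm" unfolding Cm_def using Cd(1) by (intro sum_nonneg) auto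
  show ?case
  proof (intro exI[of _ "Cm * C1 + C0"] conjI allI impI)
    show "0 \<le> Cm * C1 + C0" using Cm0 C1 D(2) by simp
    fix n a b l :: nat
    assume h: "1 \<le> a" "1 \<le> b" "l < k" "fact k ^ Suc r dvd b" "l * a \<le> (k - l + 1) * b" "k ^ Suc r * b \<le> n"
    have kr: "1 \<le> k ^ r" "1 \<le> k ^ Suc r" using k by auto
    have bn: "b \<le> n" using order_trans[OF mult_le_mono1[OF kr(2), of b] h(6)] by simp
    show "bilinear p k n l a b ((Cm * C1 + C0) * real p powr (\<eta> * real n - \<eta> * gain k (Suc r) l * real b + \<epsilon> * real n))"
    proof (cases "l = 0")
      case True
      have "bilinear p k n 0 a b (C0 * real p powr (\<eta> * real (n - b)))"
        by (rule bilinear_zero[OF p D(1)]) (use h k D(2) bn in auto)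
      then show ?thesis unfolding True
      proof (rule bilinear_mono)
        have "C0 * real p powr (\<eta> * real (n - b)) \<le> (Cm * C1 + C0) * real p powr (\<eta> * real n - \<eta> * gain k (Suc r) 0 * real b + \<epsilon> * real n)"
          using bn p1 Cm0 C1 D(2) Suc.prems by (intro mult_mono) (auto simp: of_nat_diff algebra_simps)
        then show "C0 * real p powr (\<eta> * real (n - b)) \<le> (Cm * C1 + C0) * real p powr (\<eta> * real n - \<eta> * gain k (Suc r) 0 * real b + \<epsilon> * real n)" .
      qed
    next
      case False
      then have l: "1 \<le> l" "l < k" using h by auto
      define t where "t = k - l + 1"
      have t: "1 \<le> t" "t \<le> k" using l by (auto simp: t_def)
      \<comment> \<open>Each round spends one factor \<open>fact k\<close>, so that b' = (k - l + 1)
        b / l is an integer still divisible by \<open>fact k ^ r\<close>. Likewise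
        \<open>b' \<le> k * b\<close> spends one factor \<open>k\<close> of the room in
        \<open>k ^ Suc r * b \<le> n\<close>.\<close>
      obtain c where c: "b = fact k ^ Suc r * c" using h(4) by (auto simp: dvd_def)
      obtain d where d: "fact k = l * d" using dvd_fact[of l k] l by (auto simp: dvd_def)
      define g where "g = fact k ^ r * (d * c)"
      have bg: "b = l * g" by (simp add: c d g_def mult_ac)
      have g1: "1 \<le> g" using h(2) bg by (cases g) auto
      define b' where "b' = t * g"
      have lb': "l * b' = t * b" by (simp add: b'_def bg mult_ac)
      have b'1: "1 \<le> b'" using t g1 by (simp add: b'_def Suc_le_eq)
      have dvds: "fact k ^ r dvd b'" "fact k ^ r dvd b" by (auto simp: b'_def g_def bg)
      have b'b: "b' \<le> k * b"
        using t l unfolding b'_def bg by (intro mult_le_mono) auto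
      have kb': "k ^ r * b' \<le> n"
      proof -
        have "k ^ r * b' \<le> k ^ r * (k * b)" using b'b by (rule mult_le_mono2)
        also have "\<dots> = k ^ Suc r * b" by (simp add: mult_ac)
        also note h(6)
        finally show ?thesis .
      qed
      have kb: "k ^ r * b \<le> n"
      proof -
        have "k ^ r * b \<le> k ^ r * (k * b)" using k by (intro mult_le_mono2) auto
        also have "\<dots> = k ^ Suc r * b" by (simp add: mult_ac)
        also note h(6)
        finally show ?thesis .
      qed
      have b'n: "b' \<le> n" using order_trans[OF mult_le_mono1[OF kr(1), of b'] kb'] by simp
      \<comment> \<open>The side condition on \<open>a\<close> says exactly that level
        \<open>b'\<close> is not coarser than level \<open>a\<close>.\<close>
      have "l * a \<le> l * b'" using h(5) lb' by (simp add: t_def)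
      then have ab': "a \<le> b'" using l by simp
      define E1 where "E1 = \<eta> * real n - \<eta> * gain k r (k - l) * real b' + \<epsilon> / 2 * real n"
      define E2 where "E2 = \<eta> * real n - \<eta> * gain k r (l - 1) * real b + \<epsilon> / 2 * real n"
      define E where "E = \<eta> * real n - \<eta> * gain k (Suc r) l * real b + \<epsilon> / 2 * real n"
      have B1: "bilinear p k n (k - l) b b' (C1 * real p powr E1)"
        unfolding E1_def
      proof (rule st)
        have "(k - l) * l \<le> (l + 1) * t" using l unfolding t_def
          by (subst mult.commute, intro mult_le_mono) auto
        then have "(k - l) * l * g \<le> (l + 1) * t * g" by (rule mult_le_mono1)
        then show "(k - l) * b \<le> (k - (k - l) + 1) * b'" using l by (simp add: bg b'_def mult_ac)
      qed (use h l b'1 dvds kb' in auto)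
      have B2: "bilinear p k n (l - 1) b' b (C1 * real p powr E2)"
        unfolding E2_def
      proof (rule st)
        have "(l - 1) * t \<le> (k - (l - 1) + 1) * l" using l unfolding t_def
          by (subst mult.commute, intro mult_le_mono) auto
        then have "(l - 1) * t * g \<le> (k - (l - 1) + 1) * l * g" by (rule mult_le_mono1)
        then show "(l - 1) * b' \<le> (k - (l - 1) + 1) * b" unfolding b'_def bg by (simp only: mult_ac)
      qed (use h l b'1 dvds kb in auto)
      \<comment> \<open>\<open>E\<close> is the weighted mean of \<open>E1\<close> and
        \<open>E2\<close> coming from Hoelder; after inserting b' = t b / l this is the recursion
        for \<open>gain\<close> multiplied by \<open>t\<close>.\<close>
      have tE: "real t * E = E1 + real (t - 1) * E2"
      proof -
        have gs: "gain k (Suc r) l = gain k r (k - l) / real l + real (t - 1) / real t * gain k r (l - 1)"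
          using l by (simp add: t_def)
        have aux: "T * (X / L + T1 / T * Y) * (L * G) = X * (T * G) + T1 * Y * (L * G)"
          if "T > 0" "L > 0" for T L G X Y T1 :: real using that by (simp add: field_simps)
        have gb: "real t * gain k (Suc r) l * real b = gain k r (k - l) * real b' + real (t - 1) * gain k r (l - 1) * real b"
          unfolding gs bg b'_def of_nat_mult using l t by (intro aux) auto
        have "real t * E = real t * (\<eta> * real n + \<epsilon> / 2 * real n) - \<eta> * (real t * gain k (Suc r) l * real b)"
          by (simp add: E_def algebra_simps)
        also have "\<dots> = (1 + real (t - 1)) * (\<eta> * real n + \<epsilon> / 2 * real n)
            - \<eta> * (gain k r (k - l) * real b' + real (t - 1) * gain k r (l - 1) * real b)"
          unfolding gb using t by (simp add: of_nat_diff)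
        also have "\<dots> = E1 + real (t - 1) * E2"
          by (simp only: E1_def E2_def distrib_left distrib_right right_diff_distrib left_diff_distrib mult_1 mult_ac)
        finally show ?thesis .
      qed
      have B: "bilinear p k n l b' b (C1 * real p powr E)"
      proof (rule bilinear_holder[OF _ l B1 _ B2])
        have "(C1 * real p powr E1) * (C1 * real p powr E2) ^ (k - l) = C1 ^ t * real p powr (E1 + real (t - 1) * E2)"
          using p1 by (simp add: t_def power_mult_distrib powr_add powr_power mult_ac)
        also have "\<dots> = (C1 * real p powr E) ^ (k - l + 1)"
          unfolding tE[symmetric] using p1
          by (simp add: t_def power_mult_distrib powr_power distrib_left powr_add mult_ac)
        finally show "(C1 * real p powr E1) * (C1 * real p powr E2) ^ (k - l) \<le> (C1 * real p powr E) ^ (k - l + 1)" by (rule eq_refl)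
      qed (use p1 C1 in auto)
      have DL: "decoupling p l (b' - a) (Cm * real p powr (\<epsilon> / 2 * real n))"
      proof (rule decoupling_mono[OF Cd(2)])
        show "l \<in> {1..<k}" using l by auto
        have "Cd l \<le> Cm" unfolding Cm_def using l Cd(1) by (intro member_le_sum) auto
        moreover have "real p powr (\<epsilon> / 2 * real (b' - a)) \<le> real p powr (\<epsilon> / 2 * real n)"
          using p1 b'n Suc.prems by (intro powr_mono mult_left_mono) auto
        ultimately show "Cd l * real p powr (\<epsilon> / 2 * real (b' - a)) \<le> Cm * real p powr (\<epsilon> / 2 * real n)"
          using Cm0 by (intro mult_mono) auto
      qed
      have "bilinear p k n l a b ((Cm * real p powr (\<epsilon> / 2 * real n)) * (C1 * real p powr E))"
        using l lb' Cm0 C1 h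
        by (intro bilinear_lower[OF p _ _ _ h(1) ab' b'n h(2) DL _ B]) (auto simp: t_def)
      then show ?thesis
      proof (rule bilinear_mono)
        have "(Cm * real p powr (\<epsilon> / 2 * real n)) * (C1 * real p powr E) = (Cm * C1) * real p powr (\<epsilon> / 2 * real n + E)"
          by (simp add: powr_add mult_ac)
        also have "\<epsilon> / 2 * real n + E = \<eta> * real n - \<eta> * gain k (Suc r) l * real b + \<epsilon> * real n"
          by (simp add: E_def)
        also have "(Cm * C1) * real p powr (\<eta> * real n - \<eta> * gain k (Suc r) l * real b + \<epsilon> * real n)
          \<le> (Cm * C1 + C0) * real p powr (\<eta> * real n - \<eta> * gain k (Suc r) l * real b + \<epsilon> * real n)"
          using D(2) by (intro mult_right_mono) auto
        finally show "(Cm * real p powr (\<epsilon> / 2 * real n)) * (C1 * real p powr E)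
          \<le> (Cm * C1 + C0) * real p powr (\<eta> * real n - \<eta> * gain k (Suc r) l * real b + \<epsilon> * real n)" .
      qed
    qed
  qed
qed

section \<open>Bootstrapping the decoupling exponent\<close>

definition decoupling_exponent :: "nat \<Rightarrow> nat \<Rightarrow> real \<Rightarrow> bool" where
  "decoupling_exponent p k \<eta> \<longleftrightarrow> (\<exists>C\<ge>0. \<forall>n. decoupling p k n (C * real p powr (\<eta> * real n)))"

lemma decoupling_exponent_mono:
  assumes "0 < p" "decoupling_exponent p k \<eta>" "\<eta> \<le> \<eta>'"
  shows "decoupling_exponent p k \<eta>'"
proof -
  obtain C where C: "C \<ge> 0" "\<And>n. decoupling p k n (C * real p powr (\<eta> * real n))"
    using assms(2) by (auto simp: decoupling_exponent_def)
  have "decoupling p k n (C * real p powr (\<eta>' * real n))" for n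
    by (rule decoupling_mono[OF C(2)]) (use assms C in \<open>auto intro!: mult_left_mono powr_mono mult_right_mono\<close>)
  then show ?thesis using C(1) by (auto simp: decoupling_exponent_def)
qed

text \<open>\<open>\<delta>\<close> depends on \<open>\<eta>0\<close> but not on the current
  exponent \<open>\<eta>\<close>; otherwise the improvements could shrink and the descent stall. The
  number \<open>r\<close> of rounds is so large that the gain outweighs the loss in
  \<open>bilinear_split\<close>, and \<open>b\<close> is taken proportional to
  \<open>n\<close>.\<close>

lemma decoupling_exponent_improve:
  assumes p: "prime p" "k < p" and k: "2 \<le> k" and \<eta>0: "0 < \<eta>0"
    and IH: "\<And>l \<epsilon>. 1 \<le> l \<Longrightarrow> l < k \<Longrightarrow> 0 < \<epsilon> \<Longrightarrow> decoupling_exponent p l \<epsilon>"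
  obtains \<delta> where "0 < \<delta>" "\<And>\<eta>. \<eta>0 \<le> \<eta> \<Longrightarrow> decoupling_exponent p k \<eta> \<Longrightarrow> decoupling_exponent p k (\<eta> - \<delta>)"
proof -
  have p1: "1 < p" using prime_gt_1_nat[OF p(1)] by simp
  \<comment> \<open>The rate of loss in \<open>bilinear_split\<close>, plus one to leave a net
    saving of a factor \<open>p ^ b\<close>.\<close>
  define K where "K = real (2 * tri k) + 1"
  define r where "r = Suc (nat \<lceil>real k * K / \<eta>0\<rceil>)"
  have r1: "1 \<le> r" by (simp add: r_def)
  have rK: "K \<le> \<eta>0 * (real r / real k)"
  proof -
    have "real k * K / \<eta>0 \<le> real r" unfolding r_def by linarith
    then show ?thesis using \<eta>0 k by (simp add: field_simps)
  qed
  \<comment> \<open>By \<open>sum_gain\<close> the average of \<open>gain k r l\<close> over these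
    \<open>k - 1\<close> values of \<open>l\<close> is exactly r / k.\<close>
  have "\<exists>l\<in>{1..k-1}. real r / real k \<le> gain k r l"
  proof (rule ccontr)
    assume "\<not> ?thesis"
    then have lt: "gain k r l < real r / real k" if "l \<in> {1..k-1}" for l using that by force
    have "(\<Sum>l=1..k-1. gain k r l) < (\<Sum>l=1..k-1. real r / real k)"
      using k by (intro sum_strict_mono lt) auto
    also have "\<dots> = real r * (real (k - 1) / real k)" by simp
    finally show False using sum_gain[OF k, of r] by simp
  qed
  then obtain l where l: "1 \<le> l" "l < k" and gl: "real r / real k \<le> gain k r l"
    using k by force
  define T where "T = fact k ^ r * k ^ r"
  have T1: "1 \<le> T" using k by (simp add: T_def Suc_le_eq)
  \<comment> \<open>Once \<open>T \<le> n\<close>, a multiple \<open>b\<close> of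
    \<open>fact k ^ r\<close> with \<open>k ^ r * b \<le> n\<close> can be chosen with
    \<open>b \<ge> \<beta> * n\<close>. Half of the resulting saving pays for the error term of
    \<open>bilinear_stage\<close>, hence \<open>\<beta> / 2\<close> in
    \<open>\<delta>\<close>.\<close>
  define \<beta> where "\<beta> = 1 / (2 * real T)"
  have \<beta>: "0 < \<beta>" using T1 by (simp add: \<beta>_def)
  define \<delta> where "\<delta> = min (\<beta> / 2) (\<eta>0 / 2)"
  have \<delta>: "0 < \<delta>" "\<delta> \<le> \<beta> / 2" "\<delta> \<le> \<eta>0 / 2" using \<beta> \<eta>0 by (auto simp: \<delta>_def)
  show ?thesis
  proof (rule that[OF \<delta>(1)])
    fix \<eta> assume \<eta>: "\<eta>0 \<le> \<eta>" and P: "decoupling_exponent p k \<eta>"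
    obtain C0 where C0: "C0 \<ge> 0" "\<And>n. decoupling p k n (C0 * real p powr (\<eta> * real n))"
      using P by (auto simp: decoupling_exponent_def)
    have IH': "\<exists>C\<ge>0. \<forall>n. decoupling p l n (C * real p powr (\<epsilon> * real n))" if "1 \<le> l" "l < k" "0 < \<epsilon>" for l \<epsilon>
      using IH[OF that] by (simp add: decoupling_exponent_def)
    have e: "0 < \<beta> / 2" and \<eta>_nn: "0 \<le> \<eta>" using \<beta> \<eta> \<eta>0 by auto
    obtain C1 where C1: "C1 \<ge> 0" and st: "\<And>n a b l. 1 \<le> a \<Longrightarrow> 1 \<le> b \<Longrightarrow> l < k \<Longrightarrow> fact k ^ r dvd b \<Longrightarrow> l * a \<le> (k - l + 1) * b \<Longrightarrow> k ^ r * b \<le> n \<Longrightarrow>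
      bilinear p k n l a b (C1 * real p powr (\<eta> * real n - \<eta> * gain k r l * real b + \<beta> / 2 * real n))"
      using bilinear_stage[OF p k \<eta>_nn C0(2,1) IH' e, of r] by blast
    define C2 where "C2 = C1 + C0 * real p powr (\<delta> * real T)"
    have C2: "0 \<le> C2" using C1 C0 by (simp add: C2_def)
    have bilinear: "bilinear p k n l 1 1 (C2 * real p powr ((\<eta> - \<delta>) * real n))" for n
    proof (cases "T \<le> n")
      case False
      have "bilinear p k n l 1 1 (C0 * real p powr (\<eta> * real n))"
        by (rule bilinear_trivial[OF _ _ _ C0(2)]) (use p1 k l C0(1) in auto)
      then show ?thesis
      proof (rule bilinear_mono)
        have "\<eta> * real n \<le> \<delta> * real T + (\<eta> - \<delta>) * real n" using False \<delta> by (simp add: algebra_simps mult_left_mono)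
        then have "C0 * real p powr (\<eta> * real n) \<le> C0 * real p powr (\<delta> * real T + (\<eta> - \<delta>) * real n)"
          using p1 C0 by (intro mult_left_mono powr_mono) auto
        also have "\<dots> = C0 * real p powr (\<delta> * real T) * real p powr ((\<eta> - \<delta>) * real n)" by (simp add: powr_add)
        also have "\<dots> \<le> C2 * real p powr ((\<eta> - \<delta>) * real n)" using C1 by (intro mult_right_mono) (auto simp: C2_def)
        finally show "C0 * real p powr (\<eta> * real n) \<le> C2 * real p powr ((\<eta> - \<delta>) * real n)" .
      qed
    next
      case True
      define m where "m = n div T"
      define b where "b = fact k ^ r * m"
      have m1: "1 \<le> m" using True T1 by (simp add: m_def div_greater_zero_iff Suc_le_eq)
      have f1: "1 \<le> (fact k ^ r :: nat)" by (simp add: Suc_le_eq)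
      have mb: "m \<le> b" using mult_le_mono1[OF f1, of m] by (simp add: b_def)
      have b1: "1 \<le> b" using mb m1 by linarith
      have bn: "k ^ r * b \<le> n"
      proof -
        have "k ^ r * b = T * m" by (simp add: T_def b_def mult_ac)
        also have "\<dots> \<le> n" by (simp add: m_def)
        finally show ?thesis .
      qed
      have b_n: "b \<le> n"
      proof -
        have "1 \<le> k ^ r" using k by simp
        from order_trans[OF mult_le_mono1[OF this] bn] show ?thesis by simp
      qed
      have b\<beta>: "\<beta> * real n \<le> real b"
      proof -
        have "n < T * m + T" using mult_div_mod_eq[of T n] mod_less_divisor[of T n] T1 unfolding m_def by linarith
        also have "\<dots> \<le> 2 * T * m" using m1 T1 by (cases m) auto
        finally have "real n \<le> real (2 * T * m)" by (simp only: of_nat_le_iff less_imp_le)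
        then have "\<beta> * real n \<le> real m" using T1 by (simp add: \<beta>_def field_simps)
        then show ?thesis using mb by linarith
      qed
      have kb: "l * 1 \<le> (k - l + 1) * b"
      proof -
        have "k \<le> fact k" by (rule fact_ge_self)
        also have "(fact k :: nat) \<le> fact k ^ r" using r1 by (intro self_le_power) auto
        also have "\<dots> \<le> b" using m1 by (simp add: b_def)
        finally have "l \<le> b" using l by simp
        then show ?thesis by (simp add: trans_le_add2)
      qed
      have "bilinear p k n l 1 b (C1 * real p powr (\<eta> * real n - \<eta> * gain k r l * real b + \<beta> / 2 * real n))"
        by (rule st) (use b1 l kb bn in \<open>auto simp: b_def\<close>)
      then have "bilinear p k n l 1 1 (real p ^ (2 * b * tri k) * (C1 * real p powr (\<eta> * real n - \<eta> * gain k r l * real b + \<beta> / 2 * real n)))"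
        by (intro bilinear_split) (use p1 l b1 b_n C1 in auto)
      then show ?thesis
      proof (rule bilinear_mono)
        have "K \<le> \<eta> * gain k r l"
          using rK gl \<eta> \<eta>0 by (meson mult_mono order_trans divide_nonneg_nonneg of_nat_0_le_iff less_imp_le)
        then have "K * real b \<le> \<eta> * gain k r l * real b" by (rule mult_right_mono) simp
        moreover have "\<delta> * real n \<le> \<beta> / 2 * real n" using \<delta> by (intro mult_right_mono) auto
        ultimately have ex: "real (2 * b * tri k) + (\<eta> * real n - \<eta> * gain k r l * real b + \<beta> / 2 * real n) \<le> (\<eta> - \<delta>) * real n"
          using b\<beta> by (simp add: K_def algebra_simps)
        have "real p ^ (2 * b * tri k) * (C1 * real p powr (\<eta> * real n - \<eta> * gain k r l * real b + \<beta> / 2 * real n))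
          = C1 * real p powr (real (2 * b * tri k) + (\<eta> * real n - \<eta> * gain k r l * real b + \<beta> / 2 * real n))"
          using p1 by (simp only: powr_add powr_realpow mult_ac of_nat_0_less_iff zero_less_one order.strict_trans[OF zero_less_one])
        also have "\<dots> \<le> C2 * real p powr ((\<eta> - \<delta>) * real n)"
          using ex p1 C1 C0 by (intro mult_mono powr_mono) (auto simp: C2_def)
        finally show "real p ^ (2 * b * tri k) * (C1 * real p powr (\<eta> * real n - \<eta> * gain k r l * real b + \<beta> / 2 * real n))
          \<le> C2 * real p powr ((\<eta> - \<delta>) * real n)" .
      qed
    qed
    \<comment> \<open>As \<open>\<eta> - \<delta> \<ge> \<eta>0 / 2\<close>, one level is worth a
      factor of at least p ^ (\<eta>0 / 2). Giving half of this exponent to \<open>\<rho>\<close>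
      leaves a contraction by \<open>\<kappa>\<close> in the induction on \<open>n\<close>, and
      \<open>C3\<close> is chosen so that \<open>C3 * \<kappa> + Cb * C2 \<le> C3\<close>.\<close>
    define \<rho> where "\<rho> = real p powr (\<eta>0 / 4)"
    define \<kappa> where "\<kappa> = real p powr (- \<eta>0 / 4)"
    have \<rho>: "1 < \<rho>" using p1 \<eta>0 by (simp add: \<rho>_def)
    moreover have "\<kappa> = 1 / \<rho>" by (simp add: \<kappa>_def \<rho>_def powr_minus_divide)
    ultimately have \<kappa>: "0 < \<kappa>" "\<kappa> < 1" by auto
    obtain Cb where Cb: "0 \<le> Cb"
      "\<And>n D M. 1 \<le> n \<Longrightarrow> decoupling p k (n - 1) D \<Longrightarrow> 0 \<le> D \<Longrightarrow> bilinear p k n l 1 1 M \<Longrightarrow> 0 \<le> M \<Longrightarrow> decoupling p k n (\<rho> * D + Cb * M)"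
      using decoupling_from_Bil[OF p _ _ \<rho>, of l] k l by auto
    define C3 where "C3 = 1 + Cb * C2 / (1 - \<kappa>)"
    have C3: "1 \<le> C3" using Cb C2 \<kappa> by (simp add: C3_def)
    have "decoupling p k n (C3 * real p powr ((\<eta> - \<delta>) * real n))" for n
    proof (induction n)
      case 0
      show ?case by (rule decoupling_mono[OF decoupling_zero]) (use k C3 p1 in auto)
    next
      case (Suc n)
      let ?E = "real p powr ((\<eta> - \<delta>) * real n)" and ?E' = "real p powr ((\<eta> - \<delta>) * real (Suc n))"
      have "decoupling p k (Suc n) (\<rho> * (C3 * ?E) + Cb * (C2 * ?E'))"
        using Suc C3 C2 by (intro Cb(2) bilinear) auto
      then show ?case
      proof (rule decoupling_mono)
        have "\<rho> * ?E \<le> \<kappa> * ?E'"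
        proof -
          have "\<rho> * ?E = real p powr (\<eta>0 / 4 + (\<eta> - \<delta>) * real n)" by (simp add: \<rho>_def powr_add)
          also have "\<dots> \<le> real p powr (- \<eta>0 / 4 + (\<eta> - \<delta>) * real (Suc n))"
            using p1 \<eta> \<delta>(3) by (intro powr_mono) (auto simp: algebra_simps)
          also have "\<dots> = \<kappa> * ?E'" by (simp only: \<kappa>_def powr_add)
          finally show ?thesis .
        qed
        then have "\<rho> * (C3 * ?E) \<le> C3 * (\<kappa> * ?E')"
          using C3 by (metis mult.left_commute mult_left_mono order_trans zero_le_one)
        moreover have "C3 * \<kappa> + Cb * C2 \<le> C3"
        proof -
          have "C3 * (1 - \<kappa>) = (1 - \<kappa>) + Cb * C2 / (1 - \<kappa>) * (1 - \<kappa>)"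
            unfolding C3_def by (simp only: distrib_right mult_1)
          also have "\<dots> = (1 - \<kappa>) + Cb * C2" using \<kappa> by simp
          finally show ?thesis using \<kappa> by (simp add: right_diff_distrib)
        qed
        then have "(C3 * \<kappa> + Cb * C2) * ?E' \<le> C3 * ?E'" by (rule mult_right_mono) simp
        ultimately show "\<rho> * (C3 * ?E) + Cb * (C2 * ?E') \<le> C3 * ?E'" by (simp add: algebra_simps)
      qed
    qed
    then show "decoupling_exponent p k (\<eta> - \<delta>)" unfolding decoupling_exponent_def using C3 by (intro exI[of _ C3]) auto
  qed
qed

text \<open>Induction on the dimension with \<open>p\<close> fixed, so that lower dimensions inherit
  \<open>l < p\<close>. Steps of fixed size \<open>\<delta>\<close> lead from the crude exponent
  down to \<open>\<epsilon>\<close>; the maximum with \<open>\<epsilon>\<close> keeps each exponent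
  in the range where an improvement is available.\<close>

theorem decoupling_epsilon:
  assumes p: "prime p" and "1 \<le> k" "k < p" "0 < \<epsilon>"
  shows "decoupling_exponent p k \<epsilon>"
  using assms(2-)
proof (induction k arbitrary: \<epsilon> rule: less_induct)
  case (less k)
  have p1: "1 < p" using prime_gt_1_nat[OF p] by simp
  show ?case
  proof (cases "k = 1")
    case True
    have "decoupling p 1 n (1 * real p powr (\<epsilon> * real n))" for n
      by (rule decoupling_mono[OF decoupling_one]) (use p1 less.prems in \<open>auto intro!: ge_one_powr_ge_zero\<close>)
    then show ?thesis unfolding True decoupling_exponent_def by (intro exI[of _ 1]) auto
  next
    case False
    then have k: "2 \<le> k" using less.prems by simp
    obtain \<delta> where \<delta>: "0 < \<delta>" "\<And>\<eta>. \<epsilon> \<le> \<eta> \<Longrightarrow> decoupling_exponent p k \<eta> \<Longrightarrow> decoupling_exponent p k (\<eta> - \<delta>)"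
    proof (rule decoupling_exponent_improve[OF p less.prems(2) k less.prems(3)])
      show "decoupling_exponent p l \<epsilon>'" if "1 \<le> l" "l < k" "0 < \<epsilon>'" for l \<epsilon>'
        using less.IH[OF that(2,1) _ that(3)] that less.prems(2) by simp
    qed blast
    define H where "H = real (2 * tri k)"
    have "decoupling_exponent p k (max \<epsilon> (H - real j * \<delta>))" for j
    proof (induction j)
      case 0
      have "decoupling p k n (1 * real p powr (H * real n))" for n
        unfolding H_def mult_1 by (rule decoupling_crude) (use p1 k in auto)
      then have "decoupling_exponent p k H"
        unfolding decoupling_exponent_def by (intro exI[of _ 1] conjI allI) (rule zero_le_one)
      then show ?case by (rule decoupling_exponent_mono[rotated]) (use p1 in auto)
    next
      case (Suc j)
      have "decoupling_exponent p k (max \<epsilon> (H - real j * \<delta>) - \<delta>)" by (rule \<delta>(2)[OF _ Suc]) simp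
      then show ?case
        by (rule decoupling_exponent_mono[rotated]) (use p1 \<delta>(1) in \<open>auto simp: algebra_simps max_def\<close>)
    qed
    moreover obtain j :: nat where "H / \<delta> < real j" using reals_Archimedean2 by blast
    then have "max \<epsilon> (H - real j * \<delta>) = \<epsilon>" using \<delta>(1) less.prems(3) by (simp add: field_simps)
    ultimately show ?thesis by metis
  qed
qed

section \<open>Counting consequences of decoupling\<close>

text \<open>Cauchy-Schwarz over the fibres of \<open>g\<close>; the double sum is the sum of the
  squares of their sizes.\<close>

lemma card_square_le_collisions:
  assumes "finite T"
  shows "(real (card T))\<^sup>2 \<le> real (card (g ` T)) * real (\<Sum>t\<in>T. \<Sum>t'\<in>T. of_bool (g t = g t'))"
proof -
  have coll: "real (\<Sum>t\<in>T. \<Sum>t'\<in>T. of_bool (g t = g t')) = (\<Sum>v\<in>g ` T. (real (card {t\<in>T. g t = v}))\<^sup>2)"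
  proof -
    have "(\<Sum>t\<in>T. \<Sum>t'\<in>T. of_bool (g t = g t') :: nat) = (\<Sum>t\<in>T. card {t'\<in>T. g t' = g t})"
      using assms by (intro sum.cong refl) (simp add: eq_commute Int_def)
    also have "\<dots> = (\<Sum>v\<in>g ` T. \<Sum>t\<in>{t\<in>T. g t = v}. card {t'\<in>T. g t' = g t})"
      using assms by (rule sum.image_gen)
    also have "\<dots> = (\<Sum>v\<in>g ` T. (card {t\<in>T. g t = v})\<^sup>2)"
      by (intro sum.cong refl) (simp add: power2_eq_square)
    finally show ?thesis by simp
  qed
  have "card T = (\<Sum>v\<in>g ` T. card {t\<in>T. g t = v})"
    using sum.image_gen[OF assms, of "\<lambda>_. 1::nat" g] by simp
  then have "(real (card T))\<^sup>2 = (\<Sum>v\<in>g ` T. real (card {t\<in>T. g t = v}))\<^sup>2" by simp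
  also have "\<dots> \<le> (\<Sum>v\<in>g ` T. (real (card {t\<in>T. g t = v}))\<^sup>2) * real (card (g ` T))"
    by (rule sum_squared_le_sum_of_squares)
  finally show ?thesis unfolding coll by (simp add: mult.commute)
qed

lemma power_sum_PiE:
  fixes g :: "'a \<Rightarrow> 'b :: comm_semiring_1"
  assumes "finite S"
  shows "(\<Sum>x\<in>S. g x) ^ s = (\<Sum>t\<in>{..<s} \<rightarrow>\<^sub>E S. \<Prod>i<s. g (t i))"
  using prod_sum_PiE[of "{..<s}" "\<lambda>_. S" "\<lambda>_. g"] assms by simp

text \<open>The moment of order \<open>2 * tri k\<close> of the wave over \<open>A\<close> counts
  pairs of tuples with power sums congruent modulo \<open>q\<close>, which dominates the number of
  pairs with equal power sums. Decoupling bounds the moment, and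
  \<open>card_square_le_collisions\<close> brings in the number of distinct power sum
  vectors.\<close>

lemma mean_value_tuples:
  assumes k: "1 \<le> k" and \<epsilon>: "0 < \<epsilon>"
  obtains C where "0 \<le> C" "\<And>X A. 1 \<le> X \<Longrightarrow> A \<subseteq> {1..int X} \<Longrightarrow>
    real (card A) ^ (2 * tri k) \<le> real (card ((\<lambda>t. \<lambda>j\<in>{1..k}. \<Sum>i<tri k. t i ^ j) ` ({..<tri k} \<rightarrow>\<^sub>E A))) * (C * real X powr \<epsilon> * real (card A) ^ tri k)"
proof -
  obtain p where p: "prime p" "k < p" using bigger_prime by blast
  have p1: "1 < p" using prime_gt_1_nat[OF p(1)] by simp
  obtain C where C: "C \<ge> 0" "\<And>n. decoupling p k n (C * real p powr (\<epsilon> * real n))"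
    using decoupling_epsilon[OF p(1) k p(2) \<epsilon>] by (auto simp: decoupling_exponent_def)
  define s where "s = tri k"
  have s: "0 < s" using tri_pos[OF k] by (simp add: s_def)
  show ?thesis
  proof (rule that[of "C * real p powr \<epsilon>"])
    show "0 \<le> C * real p powr \<epsilon>" using C(1) by simp
    fix X :: nat and A :: "int set" assume X: "1 \<le> X" and A: "A \<subseteq> {1..int X}"
    have finA: "finite A" using A finite_subset by blast
    obtain m where m: "p ^ m \<le> X" "X < p ^ (m + 1)" using ex_power_ivl1[of p X] p1 X by auto
    \<comment> \<open>The least level with \<open>X < p ^ n\<close>: distinct elements of
      \<open>A\<close> lie in distinct classes, so \<open>block_sum\<close> is at most
      \<open>card A\<close>, while \<open>p ^ n \<le> p * X\<close> turns the loss into a power of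
      \<open>X\<close>.\<close>
    define n where "n = m + 1"
    have pn: "real p powr (\<epsilon> * real n) \<le> real p powr \<epsilon> * real X powr \<epsilon>"
    proof -
      have "real p powr (\<epsilon> * real n) = (real p ^ n) powr \<epsilon>" using p1 by (simp add: powr_powr mult.commute flip: powr_realpow)
      also have "real p ^ m \<le> real X" using m(1) by (metis of_nat_le_iff of_nat_power)
      then have "real p ^ n \<le> real p * real X" by (simp add: n_def mult_left_mono)
      then have "(real p ^ n) powr \<epsilon> \<le> (real p * real X) powr \<epsilon>" using \<epsilon> by (intro powr_mono2) auto
      also have "\<dots> = real p powr \<epsilon> * real X powr \<epsilon>" by (simp add: powr_mult)
      finally show ?thesis .
    qed
    define z where "z j = monom (1::int) j" for j
    define q where "q = p ^ (k * n)"
    have q0: "0 < q" using p1 by (simp add: q_def)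
    define W where "W J \<alpha> = wave z k q (\<lambda>_. 1) id J \<alpha>" for J \<alpha>
    have curve: "curve p k z" by (simp add: curve_def z_def)
    have block_sum: "block_sum p k n z (\<lambda>_. 1) id A \<le> real (card A)"
    proof -
      have "root (tri k) (avg k q (\<lambda>\<alpha>. cmod (W J \<alpha>) ^ (2 * tri k))) \<le> 1" if J: "J \<in> part (p ^ n) id A" for J
      proof -
        obtain x where x: "x \<in> J" using part_nonempty[OF J] by blast
        have "y = x" if y: "y \<in> J" for y
        proof -
          have eq: "y mod int (p ^ n) = x mod int (p ^ n)"
            using part_cong_elems[OF J y x] unfolding cong_def id_apply .
          have xy: "y \<in> {1..int X}" "x \<in> {1..int X}" using part_subset[OF J] A x y by auto
          have "X < p ^ n" using m(2) by (simp only: n_def)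
          then have lt: "int X < int (p ^ n)" by (simp only: of_nat_less_iff)
          have "y mod int (p ^ n) = y" by (rule mod_pos_pos_trivial) (use xy in simp, rule order_le_less_trans[OF _ lt], use xy in simp)
          moreover have "x mod int (p ^ n) = x" by (rule mod_pos_pos_trivial) (use xy in simp, rule order_le_less_trans[OF _ lt], use xy in simp)
          ultimately show ?thesis using eq by metis
        qed
        then have "J = {x}" using x by blast
        then have "cmod (W J \<alpha>) = 1" for \<alpha> by (simp add: W_def wave_def)
        then show ?thesis using q0 s by (simp add: avg_const s_def)
      qed
      then have "block_sum p k n z (\<lambda>_. 1) id A \<le> real (card (part (p ^ n) id A))"
        unfolding block_sum_def q_def[symmetric] W_def[symmetric] using sum_mono[of "part (p ^ n) id A" _ "\<lambda>_. 1::real"] by simp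
      also have "\<dots> \<le> real (card A)" unfolding part_def using finA by (simp add: card_image_le)
      finally show ?thesis .
    qed
    define T where "T = {..<s} \<rightarrow>\<^sub>E A"
    define v where "v t j = (\<Sum>i<s. t i ^ j)" for t :: "nat \<Rightarrow> int" and j
    define g where "g t = (\<lambda>j\<in>{1..k}. v t j)" for t
    have finT: "finite T" using finA by (simp add: T_def finite_PiE)
    have Ws: "W A \<alpha> ^ s = (\<Sum>t\<in>T. 1 * e (real_of_int (\<Sum>j=1..k. \<alpha> j * v t j) / real q))" for \<alpha>
    proof -
      have "W A \<alpha> ^ s = (\<Sum>t\<in>T. \<Prod>i<s. e (real_of_int (\<Sum>j=1..k. \<alpha> j * t i ^ j) / real q))"
        unfolding W_def wave_def T_def by (subst power_sum_PiE[OF finA]) (simp add: z_def poly_monom)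
      also have "\<dots> = (\<Sum>t\<in>T. 1 * e (real_of_int (\<Sum>j=1..k. \<alpha> j * v t j) / real q))"
      proof (rule sum.cong[OF refl])
        fix t
        have "(\<Sum>i<s. \<Sum>j=1..k. \<alpha> j * t i ^ j) = (\<Sum>j=1..k. \<alpha> j * v t j)"
          by (subst sum.swap) (simp add: v_def sum_distrib_left)
        then show "(\<Prod>i<s. e (real_of_int (\<Sum>j=1..k. \<alpha> j * t i ^ j) / real q)) = 1 * e (real_of_int (\<Sum>j=1..k. \<alpha> j * v t j) / real q)"
          by (simp flip: e_sum sum_divide_distrib of_int_sum)
      qed
      finally show ?thesis .
    qed
    have "complex_of_real (avg k q (\<lambda>\<alpha>. cmod (W A \<alpha>) ^ (2 * s)))
        = complex_of_real (avg k q (\<lambda>\<alpha>. (cmod (\<Sum>t\<in>T. 1 * e (real_of_int (\<Sum>j=1..k. \<alpha> j * v t j) / real q)))\<^sup>2))"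
      unfolding Ws[symmetric] by (simp add: norm_power mult.commute flip: power_mult)
    also have "\<dots> = (\<Sum>t\<in>T. \<Sum>t'\<in>T. if \<forall>j\<in>{1..k}. [v t j = v t' j] (mod int q) then 1 * cnj 1 else 0)"
      by (rule avg_parseval[OF q0 finT])
    also have "\<dots> = complex_of_real (\<Sum>t\<in>T. \<Sum>t'\<in>T. of_bool (\<forall>j\<in>{1..k}. [v t j = v t' j] (mod int q)))"
      unfolding of_real_sum by (intro sum.cong refl) auto
    finally have avgW: "avg k q (\<lambda>\<alpha>. cmod (W A \<alpha>) ^ (2 * s)) = (\<Sum>t\<in>T. \<Sum>t'\<in>T. of_bool (\<forall>j\<in>{1..k}. [v t j = v t' j] (mod int q)))"
      by (simp only: of_real_eq_iff)
    have "real (\<Sum>t\<in>T. \<Sum>t'\<in>T. of_bool (g t = g t')) \<le> avg k q (\<lambda>\<alpha>. cmod (W A \<alpha>) ^ (2 * s))"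
      unfolding avgW of_nat_sum of_nat_of_bool
    proof (intro sum_mono)
      fix t t'
      have "v t j = v t' j" if "g t = g t'" "j \<in> {1..k}" for j
        using fun_cong[OF that(1), of j] that(2) by (simp add: g_def)
      then show "(of_bool (g t = g t') :: real) \<le> of_bool (\<forall>j\<in>{1..k}. [v t j = v t' j] (mod int q))" by auto
    qed
    also have "\<dots> \<le> C * real p powr (\<epsilon> * real n) * block_sum p k n z (\<lambda>_. 1) id A ^ s"
      using decouplingD[OF C(2) curve finA, of n "\<lambda>_. 1" id] by (simp add: W_def q_def s_def)
    also have "\<dots> \<le> C * (real p powr \<epsilon> * real X powr \<epsilon>) * real (card A) ^ s"
      using C(1) pn block_sum by (intro mult_mono power_mono) auto
    finally have J: "real (\<Sum>t\<in>T. \<Sum>t'\<in>T. of_bool (g t = g t')) \<le> C * (real p powr \<epsilon> * real X powr \<epsilon>) * real (card A) ^ s" .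
    have "real (card A) ^ (2 * s) = (real (card T))\<^sup>2"
      by (simp add: T_def card_PiE mult.commute flip: power_mult)
    also have "\<dots> \<le> real (card (g ` T)) * real (\<Sum>t\<in>T. \<Sum>t'\<in>T. of_bool (g t = g t'))"
      by (rule card_square_le_collisions[OF finT])
    also have "\<dots> \<le> real (card (g ` T)) * (C * (real p powr \<epsilon> * real X powr \<epsilon>) * real (card A) ^ s)"
      using J by (intro mult_left_mono) auto
    finally show "real (card A) ^ (2 * tri k) \<le> real (card ((\<lambda>t. \<lambda>j\<in>{1..k}. \<Sum>i<tri k. t i ^ j) ` ({..<tri k} \<rightarrow>\<^sub>E A)))
        * (C * real p powr \<epsilon> * real X powr \<epsilon> * real (card A) ^ tri k)"
      by (simp add: g_def[abs_def] v_def[abs_def] T_def s_def mult.assoc)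
  qed
qed

text \<open>Within a block of \<open>r\<close> consecutive multiples of \<open>\<beta>\<close>, the integer \<open>r b - u c\<close> is confined to an
  interval of length \<open>r \<eta> + 2\<close> and determines the position \<open>c\<close> modulo \<open>r\<close>.\<close>

lemma card_small_fractional_part:
  fixes \<beta> \<eta> :: real and u r :: int
  assumes r: "0 < r" "coprime u r" and app: "\<bar>real_of_int r * \<beta> - real_of_int u\<bar> \<le> 1 / real_of_int r" and \<eta>: "0 \<le> \<eta>"
  shows "real (card {m \<in> {1..int Y}. \<exists>b::int. 0 \<le> b - \<beta> * m \<and> b - \<beta> * m < \<eta>})
     \<le> (real Y / r + 1) * (r * \<eta> + 3)"
proof -
  define B where "B = {m \<in> {1..int Y}. \<exists>b::int. 0 \<le> b - \<beta> * m \<and> b - \<beta> * m < \<eta>}"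
  define blk where "blk i = {m \<in> B. m div r = i}" for i
  have finB: "finite B" unfolding B_def by (rule finite_subset[of _ "{1..int Y}"]) auto
  have card_blk: "real (card (blk i)) \<le> r * \<eta> + 3" for i
  proof -
    have "\<forall>m\<in>B. \<exists>b::int. 0 \<le> b - \<beta> * m \<and> b - \<beta> * m < \<eta>" by (auto simp: B_def)
    then obtain b :: "int \<Rightarrow> int" where b: "\<And>m. m \<in> B \<Longrightarrow> 0 \<le> b m - \<beta> * m" "\<And>m. m \<in> B \<Longrightarrow> b m - \<beta> * m < \<eta>" by metis
    define w where "w m = r * b m - u * (m mod r)" for m
    define L where "L = real_of_int r * (\<beta> * (r * i)) - 1"
    have w: "L \<le> w m" "w m \<le> L + (r * \<eta> + 2)" if m: "m \<in> blk i" for m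
    proof -
      have mB: "m \<in> B" and mi: "m = r * i + m mod r" using m mult_div_mod_eq[of r m] by (auto simp: blk_def)
      define c where "c = m mod r"
      have c: "0 \<le> c" "c < r" using r by (auto simp: c_def)
      have "real_of_int (w m) = r * (b m - \<beta> * m) + r * (\<beta> * (r * i)) + (r * \<beta> - u) * c"
        using mi unfolding w_def c_def[symmetric] by (simp add: algebra_simps)
      moreover have "\<bar>(r * \<beta> - u) * c\<bar> \<le> 1"
      proof -
        have "\<bar>(r * \<beta> - u) * c\<bar> \<le> 1 / real_of_int r * real_of_int r"
          unfolding abs_mult using app c r by (intro mult_mono) auto
        then show ?thesis using r by simp
      qed
      moreover have "0 \<le> r * (b m - \<beta> * m)" "r * (b m - \<beta> * m) \<le> r * \<eta>"
        using b[OF mB] r by auto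
      ultimately show "L \<le> w m" "w m \<le> L + (r * \<eta> + 2)" unfolding L_def by linarith+
    qed
    have inj: "inj_on w (blk i)"
    proof (rule inj_onI)
      fix m m' assume mm: "m \<in> blk i" "m' \<in> blk i" "w m = w m'"
      then have "u * (m mod r - m' mod r) = r * (b m - b m')" by (simp add: w_def algebra_simps)
      then have "r dvd u * (m mod r - m' mod r)" by simp
      then have "r dvd m mod r - m' mod r" using r(2) by (simp add: coprime_commute coprime_dvd_mult_right_iff)
      then have "m mod r = m' mod r" by (metis mod_eq_dvd_iff mod_mod_trivial)
      moreover have "m div r = m' div r" using mm by (simp add: blk_def)
      ultimately show "m = m'" by (metis mult_div_mod_eq)
    qed
    have "w ` blk i \<subseteq> {\<lceil>L\<rceil>..\<lfloor>L + (r * \<eta> + 2)\<rfloor>}"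
      using w by (auto simp: ceiling_le_iff le_floor_iff)
    then have "card (blk i) \<le> card {\<lceil>L\<rceil>..\<lfloor>L + (r * \<eta> + 2)\<rfloor>}"
      using card_image[OF inj] card_mono[of "{\<lceil>L\<rceil>..\<lfloor>L + (r * \<eta> + 2)\<rfloor>}" "w ` blk i"] by simp
    moreover have "0 \<le> r * \<eta>" using r \<eta> by simp
    ultimately show ?thesis by simp linarith
  qed
  have "B = (\<Union>i\<in>{0..int Y div r}. blk i)"
    using r by (auto simp: blk_def B_def pos_imp_zdiv_nonneg_iff zdiv_mono1)
  then have "real (card B) \<le> (\<Sum>i\<in>{0..int Y div r}. real (card (blk i)))"
    using card_UN_le[of "{0..int Y div r}" blk] by (simp flip: of_nat_sum)
  also have "\<dots> \<le> (\<Sum>i\<in>{0..int Y div r}. r * \<eta> + 3)" by (intro sum_mono card_blk)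
  also have "\<dots> = (real_of_int (int Y div r) + 1) * (r * \<eta> + 3)"
    using r by (simp add: pos_imp_zdiv_nonneg_iff)
  also have "\<dots> \<le> (real Y / r + 1) * (r * \<eta> + 3)"
    using r \<eta> real_of_int_div4[of "int Y" r] by (intro mult_right_mono add_right_mono) auto
  finally show ?thesis by (simp add: B_def)
qed

text \<open>The window is one-sided to match \<open>frac\<close> in the large sieve. Coprimality of
  \<open>b\<close> and \<open>x\<close> is kept because it controls the count when
  \<open>\<beta>\<close> is close to a fraction of small denominator.\<close>

definition near :: "nat \<Rightarrow> real \<Rightarrow> real \<Rightarrow> nat \<Rightarrow> int set" where
  "near k \<beta> \<delta> X = {x \<in> {1..int X}. \<exists>b::int. coprime b x \<and>
     0 \<le> real_of_int b - \<beta> * real_of_int x ^ k \<and> real_of_int b - \<beta> * real_of_int x ^ k < \<delta>}"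

lemma near_subset: "near k \<beta> \<delta> X \<subseteq> {1..int X}"
  by (auto simp: near_def)

lemma finite_near [simp]: "finite (near k \<beta> \<delta> X)"
  by (rule finite_subset[OF near_subset]) simp

text \<open>If \<open>\<beta>\<close> is too close to a fraction \<open>u / r\<close> of small denominator, then coprimality forces
  \<open>x ^ k = r\<close>.\<close>

lemma card_near_le_1:
  assumes k: "1 \<le> k" and r: "0 < r" "coprime u r" and app: "\<bar>real_of_int r * \<beta> - real_of_int u\<bar> * real X ^ k \<le> 1 / 2"
    and small: "real_of_int r * \<delta> < 1 / 2"
  shows "card (near k \<beta> \<delta> X) \<le> 1"
proof -
  have pw: "x ^ k = r" if x: "x \<in> near k \<beta> \<delta> X" for x
  proof -
    obtain b :: int where b: "coprime b x" "0 \<le> b - \<beta> * x ^ k" "b - \<beta> * x ^ k < \<delta>" and x1: "1 \<le> x" "x \<le> int X"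
      using x by (auto simp: near_def)
    have "real_of_int (b * r - u * x ^ k) = r * (b - \<beta> * x ^ k) + (r * \<beta> - u) * x ^ k"
      by (simp add: algebra_simps)
    moreover have "\<bar>(r * \<beta> - u) * x ^ k\<bar> \<le> 1 / 2"
    proof -
      have "real_of_int (x ^ k) \<le> real X ^ k" using x1 by (simp add: power_mono)
      then have "\<bar>(r * \<beta> - u) * x ^ k\<bar> \<le> \<bar>r * \<beta> - u\<bar> * real X ^ k"
        using x1 unfolding abs_mult by (intro mult_left_mono) auto
      then show ?thesis using app by linarith
    qed
    moreover have "0 \<le> r * (b - \<beta> * x ^ k)" using b r by simp
    moreover have "r * (b - \<beta> * x ^ k) < r * \<delta>"
      using r by (intro mult_strict_left_mono b(3)) simp
    moreover note small
    ultimately have "\<bar>real_of_int (b * r - u * x ^ k)\<bar> < 1" by linarith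
    then have eq: "b * r = u * x ^ k" by linarith
    have "x ^ k dvd b * r" by (simp add: eq)
    then have "x ^ k dvd r" using b(1) by (simp add: coprime_dvd_mult_right_iff coprime_commute)
    moreover have "r dvd u * x ^ k" by (simp flip: eq)
    then have "r dvd x ^ k" using r(2) by (simp add: coprime_dvd_mult_right_iff coprime_commute)
    ultimately show ?thesis using r(1) x1 by (intro zdvd_antisym_nonneg) auto
  qed
  have "x = y" if "x \<in> near k \<beta> \<delta> X" "y \<in> near k \<beta> \<delta> X" for x y
  proof -
    have "x ^ k = y ^ k" using pw that by simp
    moreover have "0 \<le> x" "0 \<le> y" using that by (auto simp: near_def)
    ultimately show ?thesis using k by (simp add: power_eq_iff_eq_base)
  qed
  then show ?thesis by (simp add: card_le_Suc0_iff_eq)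
qed

text \<open>Power sums of degree below \<open>k\<close> are only given their trivial range. The sum
  of degree \<open>k\<close> inherits the approximation property of its terms, with
  \<open>s * \<delta>\<close> in place of \<open>\<delta>\<close>, so it lies in the sparse set
  \<open>B\<close>; this is where the factor \<delta> comes from.\<close>

lemma card_near_bound:
  assumes k: "1 \<le> k" and \<epsilon>: "0 < \<epsilon>"
  obtains C where "1 \<le> C" "\<And>X \<beta> \<delta>. 1 \<le> X \<Longrightarrow> 0 < \<delta> \<Longrightarrow> \<delta> \<le> 1 \<Longrightarrow> 1 \<le> \<delta> * real X ^ k \<Longrightarrow>
     real (card (near k \<beta> \<delta> X)) \<le> C * real X powr (1 + \<epsilon>) * \<delta> powr (1 / (real k * (real k + 1)))"
proof -
  define s where "s = tri k"
  have s1: "1 \<le> s" using tri_pos[OF k] by (simp add: s_def)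
  have s2: "2 * real s = real k * (real k + 1)"
  proof -
    have "real (2 * tri k) = real (k * (k + 1))" by (simp only: two_tri)
    then show ?thesis by (simp add: s_def algebra_simps)
  qed
  obtain C where C: "0 \<le> C" "\<And>X A. 1 \<le> X \<Longrightarrow> A \<subseteq> {1..int X} \<Longrightarrow>
    real (card A) ^ (2 * tri k) \<le> real (card ((\<lambda>t. \<lambda>j\<in>{1..k}. \<Sum>i<tri k. t i ^ j) ` ({..<tri k} \<rightarrow>\<^sub>E A))) * (C * real X powr \<epsilon> * real (card A) ^ tri k)"
    using mean_value_tuples[OF k \<epsilon>] by metis
  define Cs where "Cs = real s ^ (k - 1) * (real s ^ 2 + 8 * real s + 3) * C + 1"
  have Cs: "1 \<le> Cs" using C(1) by (simp add: Cs_def)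
  show ?thesis
  proof (rule that[OF Cs])
    fix X :: nat and \<beta> \<delta> :: real
    assume X: "1 \<le> X" and \<delta>: "0 < \<delta>" "\<delta> \<le> 1" and dX: "1 \<le> \<delta> * real X ^ k"
    define A where "A = near k \<beta> \<delta> X"
    have finA: "finite A" and subA: "A \<subseteq> {1..int X}" using near_subset by (auto simp: A_def)
    \<comment> \<open>Makes the claim trivial for sets with at most one element.\<close>
    have rhs1: "1 \<le> real X powr (1 + \<epsilon>) * \<delta> powr (1 / (real k * (real k + 1)))"
    proof -
      let ?c = "1 / (real k * (real k + 1))"
      have "real k * ?c = 1 / (real k + 1)" using k by simp
      then have c: "0 \<le> ?c" "real k * ?c \<le> 1" by auto
      have "1 \<le> (\<delta> * real X ^ k) powr ?c" using dX c by (intro ge_one_powr_ge_zero) auto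
      also have "\<dots> = real X powr (real k * ?c) * \<delta> powr ?c"
        using X \<delta> by (simp add: powr_mult powr_powr mult.commute flip: powr_realpow)
      also have "\<dots> \<le> real X powr (1 + \<epsilon>) * \<delta> powr ?c"
        using c X \<epsilon> by (intro mult_right_mono powr_mono) auto
      finally show ?thesis .
    qed
    show "real (card (near k \<beta> \<delta> X)) \<le> Cs * real X powr (1 + \<epsilon>) * \<delta> powr (1 / (real k * (real k + 1)))"
    proof (cases "card A \<le> 1")
      case True
      have "real (card A) \<le> 1" using True by simp
      also have "\<dots> \<le> Cs * (real X powr (1 + \<epsilon>) * \<delta> powr (1 / (real k * (real k + 1))))"
        using mult_mono[OF Cs rhs1] Cs by simp
      finally show ?thesis by (simp add: A_def mult.assoc)
    next
      case False
      \<comment> \<open>Denominators up to \<open>2 * X ^ k\<close> make the error small enough for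
        \<open>card_near_le_1\<close>, which then forces \<open>r * \<delta> \<ge> 1 / 2\<close> as
        soon as there are two elements.\<close>
      obtain u r :: int where ur: "coprime u r" "0 < r" "r \<le> int (2 * X ^ k)" "\<bar>of_int r * \<beta> - of_int u\<bar> < 1 / real (2 * X ^ k)"
        using Dirichlet_approx_coprime[of "2 * X ^ k" \<beta>] X by auto
      have Xk: "0 < real X ^ k" using X by simp
      have "\<bar>real_of_int r * \<beta> - real_of_int u\<bar> * real X ^ k \<le> 1 / real (2 * X ^ k) * real X ^ k"
        using ur(4) Xk by (intro mult_right_mono) auto
      also have "\<dots> = 1 / 2" using Xk by simp
      finally have app: "\<bar>real_of_int r * \<beta> - real_of_int u\<bar> * real X ^ k \<le> 1 / 2" .
      have r\<delta>: "1 / 2 \<le> real_of_int r * \<delta>"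
        using card_near_le_1[OF k ur(2,1) app, of \<delta>] False by (force simp: A_def)
      define Y where "Y = s * X ^ k"
      define B where "B = {m \<in> {1..int Y}. \<exists>b::int. 0 \<le> b - \<beta> * m \<and> b - \<beta> * m < real s * \<delta>}"
      have finB: "finite B" unfolding B_def by (rule finite_subset[of _ "{1..int Y}"]) auto
      \<comment> \<open>By 1 / 2 \<le> r \<delta>, r \<le> 2 X ^ k and 1 \<le> \<delta> X ^ k, the
        four terms of the expanded product are at most s^2, 6 s, 2 s and 3 times \<delta> X ^
        k.\<close>
      have cardB: "real (card B) \<le> (real s ^ 2 + 8 * real s + 3) * (\<delta> * real X ^ k)"
      proof -
        have "real_of_int r \<le> real_of_int (int (2 * X ^ k))" using ur(3) by (simp only: of_int_le_iff)
        then have rX: "real_of_int r \<le> 2 * real X ^ k" by simp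
        have "\<bar>real_of_int r * \<beta> - real_of_int u\<bar> \<le> 1 / real_of_int r"
        proof -
          have "1 / real (2 * X ^ k) \<le> 1 / real_of_int r" using rX ur(2) X by (intro divide_left_mono) auto
          then show ?thesis using ur(4) by linarith
        qed
        then have "real (card B) \<le> (real Y / r + 1) * (r * (real s * \<delta>) + 3)"
          unfolding B_def using \<delta> ur by (intro card_small_fractional_part) auto
        also have "\<dots> = real Y * (real s * \<delta>) + 3 * (real Y / r) + real s * (r * \<delta>) + 3"
          using ur(2) by (simp add: field_simps)
        also have "\<dots> \<le> real Y * (real s * \<delta>) + 3 * (2 * real Y * \<delta>) + real s * (2 * real X ^ k * \<delta>) + 3 * (\<delta> * real X ^ k)"
        proof (intro add_mono mult_left_mono)
          have "real Y * 1 \<le> real Y * (2 * (real_of_int r * \<delta>))" using r\<delta> by (intro mult_left_mono) auto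
          then show "real Y / real_of_int r \<le> 2 * real Y * \<delta>" using ur(2) by (simp add: field_simps)
          show "real_of_int r * \<delta> \<le> 2 * real X ^ k * \<delta>" using rX \<delta> by (intro mult_right_mono) auto
        qed (use dX in auto)
        also have "\<dots> = (real s ^ 2 + 8 * real s + 3) * (\<delta> * real X ^ k)"
          by (simp add: Y_def algebra_simps power2_eq_square)
        finally show ?thesis .
      qed
      define G where "G j = (if j = k then B else {1..int (s * X ^ j)})" for j
      have img: "(\<lambda>t. \<lambda>j\<in>{1..k}. \<Sum>i<s. t i ^ j) ` ({..<s} \<rightarrow>\<^sub>E A) \<subseteq> (PiE {1..k} G)"
      proof (intro image_subsetI PiE_I)
        fix t j assume t: "t \<in> {..<s} \<rightarrow>\<^sub>E A" and j: "j \<in> {1..k}"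
        have tA: "t i \<in> A" if "i < s" for i using t that by auto
        have t1: "1 \<le> t i" "t i \<le> int X" if "i < s" for i using tA[OF that] subA by auto
        have lo: "1 \<le> (\<Sum>i<s. t i ^ j)"
        proof -
          have "(\<Sum>i<s. 1) \<le> (\<Sum>i<s. t i ^ j)" using t1 by (intro sum_mono one_le_power) auto
          then show ?thesis using s1 by simp
        qed
        have hi: "(\<Sum>i<s. t i ^ j) \<le> int (s * X ^ j)"
        proof -
          have "(\<Sum>i<s. t i ^ j) \<le> (\<Sum>i<s. int X ^ j)" using t1 by (intro sum_mono power_mono) force+
          then show ?thesis by simp
        qed
        have "(\<Sum>i<s. t i ^ j) \<in> G j"
        proof (cases "j = k")
          case True
          have "\<forall>i\<in>{..<s}. \<exists>b::int. 0 \<le> b - \<beta> * t i ^ k \<and> b - \<beta> * t i ^ k < \<delta>"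
            using tA by (auto simp: A_def near_def)
          then obtain b :: "nat \<Rightarrow> int" where b: "\<And>i. i < s \<Longrightarrow> 0 \<le> b i - \<beta> * t i ^ k \<and> b i - \<beta> * t i ^ k < \<delta>"
            by (metis lessThan_iff)
          \<comment> \<open>Summing the \<open>s\<close> approximations: \<open>\<beta>\<close>
            times the sum of k-th powers lies below the integer \<open>sum b {..<s}\<close> by less
            than \<open>s * \<delta>\<close>.\<close>
          have eq: "real_of_int (sum b {..<s}) - \<beta> * real_of_int (\<Sum>i<s. t i ^ k) = (\<Sum>i<s. b i - \<beta> * t i ^ k)"
            by (simp add: sum_subtractf sum_distrib_left)
          have "0 \<le> (\<Sum>i<s. b i - \<beta> * t i ^ k)" using b by (intro sum_nonneg) auto
          moreover have "(\<Sum>i<s. b i - \<beta> * t i ^ k) < (\<Sum>i<s. \<delta>)"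
            using b s1 by (intro sum_strict_mono) (auto simp: lessThan_empty_iff)
          ultimately have "\<exists>c::int. 0 \<le> c - \<beta> * real_of_int (\<Sum>i<s. t i ^ k) \<and> c - \<beta> * real_of_int (\<Sum>i<s. t i ^ k) < real s * \<delta>"
            unfolding eq[symmetric] by (intro exI[of _ "sum b {..<s}"]) simp
          then show ?thesis using lo hi True by (simp add: G_def B_def Y_def)
        next
          case False
          then show ?thesis using lo hi by (simp add: G_def)
        qed
        then show "(\<lambda>j\<in>{1..k}. \<Sum>i<s. t i ^ j) j \<in> G j" using j by simp
      qed auto
      have finG: "finite (PiE {1..k} G)" using finB by (intro finite_PiE) (auto simp: G_def)
      have "card (PiE {1..k} G) = (\<Prod>j=1..k. card (G j))" by (simp add: card_PiE)
      also have "\<dots> = card (G k) * (\<Prod>j\<in>{1..k} - {k}. card (G j))" by (rule prod.remove) (use k in auto)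
      also have "(\<Prod>j\<in>{1..k} - {k}. card (G j)) = (\<Prod>j\<in>{1..k} - {k}. s * X ^ j)"
          by (intro prod.cong) (auto simp: G_def nat_mult_distrib nat_power_eq)
      also have "\<dots> = s ^ (k - 1) * X ^ (\<Sum>j\<in>{1..k} - {k}. j)"
        using k by (simp add: prod.distrib power_sum)
      also have "G k = B" by (simp add: G_def)
      finally have cG: "card (PiE {1..k} G) = card B * (s ^ (k - 1) * X ^ (\<Sum>j\<in>{1..k} - {k}. j))" .
      have gauss: "k + (\<Sum>j\<in>{1..k} - {k}. j) = s"
      proof -
        have "k + (\<Sum>j\<in>{1..k} - {k}. j) = (\<Sum>j\<in>{1..k}. j)" by (rule sum.remove[symmetric]) (use k in auto)
        also have "\<dots> = s" using gauss_sum_from_Suc_0[of k, where 'a = nat] by (simp add: s_def tri_def)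
        finally show ?thesis .
      qed
      have V: "real (card ((\<lambda>t. \<lambda>j\<in>{1..k}. \<Sum>i<s. t i ^ j) ` ({..<s} \<rightarrow>\<^sub>E A)))
          \<le> real s ^ (k - 1) * (real s ^ 2 + 8 * real s + 3) * (\<delta> * real X ^ s)"
      proof -
        have "real (card ((\<lambda>t. \<lambda>j\<in>{1..k}. \<Sum>i<s. t i ^ j) ` ({..<s} \<rightarrow>\<^sub>E A))) \<le> real (card (PiE {1..k} G))"
          using card_mono[OF finG img] by simp
        also have "\<dots> = real (card B) * (real s ^ (k - 1) * real X ^ (\<Sum>j\<in>{1..k} - {k}. j))"
          by (simp only: cG of_nat_mult of_nat_power)
        also have "\<dots> \<le> ((real s ^ 2 + 8 * real s + 3) * (\<delta> * real X ^ k)) * (real s ^ (k - 1) * real X ^ (\<Sum>j\<in>{1..k} - {k}. j))"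
          by (intro mult_right_mono cardB) auto
        also have "\<dots> = real s ^ (k - 1) * (real s ^ 2 + 8 * real s + 3) * (\<delta> * real X ^ (k + (\<Sum>j\<in>{1..k} - {k}. j)))"
          by (simp only: power_add mult_ac)
        finally show ?thesis unfolding gauss .
      qed
      let ?a = "real (card A)"
      have a0: "0 < ?a" using False by simp
      have "?a ^ s * ?a ^ s = ?a ^ (2 * s)" by (simp add: mult_2 power_add)
      also have "\<dots> \<le> real (card ((\<lambda>t. \<lambda>j\<in>{1..k}. \<Sum>i<s. t i ^ j) ` ({..<s} \<rightarrow>\<^sub>E A))) * (C * real X powr \<epsilon> * ?a ^ s)"
        unfolding s_def by (rule C(2)[OF X subA])
      also have "\<dots> \<le> (real s ^ (k - 1) * (real s ^ 2 + 8 * real s + 3) * (\<delta> * real X ^ s)) * (C * real X powr \<epsilon> * ?a ^ s)"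
        using C(1) by (intro mult_right_mono V) auto
      also have "\<dots> = (real s ^ (k - 1) * (real s ^ 2 + 8 * real s + 3) * C) * (\<delta> * (real X ^ s * real X powr \<epsilon>)) * ?a ^ s"
        by (simp only: mult_ac)
      also have "\<dots> \<le> Cs * (\<delta> * (real X ^ s * real X powr \<epsilon>)) * ?a ^ s"
        using \<delta> by (intro mult_right_mono) (auto simp: Cs_def)
      finally have "?a ^ s \<le> Cs * (\<delta> * (real X ^ s * real X powr \<epsilon>))" using a0 by simp
      also have "real X ^ s * real X powr \<epsilon> = real X powr (real s + \<epsilon>)" using X by (simp add: powr_add powr_realpow)
      finally have as: "?a ^ s \<le> Cs * (\<delta> * real X powr (real s + \<epsilon>))" .
      have "?a = (?a ^ s) powr (1 / real s)" using a0 s1 by (simp add: powr_powr flip: powr_realpow)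
      also have "\<dots> \<le> (Cs * (\<delta> * real X powr (real s + \<epsilon>))) powr (1 / real s)"
        using as by (intro powr_mono2) auto
      also have "\<dots> = Cs powr (1 / real s) * (\<delta> powr (1 / real s) * real X powr ((real s + \<epsilon>) * (1 / real s)))"
        by (simp only: powr_mult powr_powr)
      also have "\<dots> \<le> Cs * (\<delta> powr (1 / (real k * (real k + 1))) * real X powr (1 + \<epsilon>))"
      proof (intro mult_mono)
        have "1 / real s \<le> 1" using s1 by simp
        then show "Cs powr (1 / real s) \<le> Cs" using powr_mono[of "1 / real s" 1 Cs] Cs by simp
        \<comment> \<open>The argument gives the exponent 1 / s, twice the one claimed; as
          \<open>\<delta> \<le> 1\<close> it may be lowered.\<close>
        have "1 / (real k * (real k + 1)) \<le> 1 / real s" unfolding s2[symmetric] using s1 by (intro divide_left_mono) auto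
        then show "\<delta> powr (1 / real s) \<le> \<delta> powr (1 / (real k * (real k + 1)))" using \<delta> by (intro powr_mono') auto
        have "(real s + \<epsilon>) * (1 / real s) \<le> 1 + \<epsilon>" using s1 \<epsilon> by (simp add: field_simps)
        then show "real X powr ((real s + \<epsilon>) * (1 / real s)) \<le> real X powr (1 + \<epsilon>)" using X by (intro powr_mono) auto
      qed (use Cs in auto)
      finally show ?thesis by (simp add: A_def mult_ac)
    qed
  qed
qed

section \<open>A local large sieve\<close>

lemma sin_pi_ge:
  assumes "0 \<le> t" "t \<le> 1 / 2"
  shows "2 * t \<le> sin (pi * t)"
proof -
  have "concave_on {0..1/2} (\<lambda>x. sin (pi * x))"
  proof (rule f''_le0_imp_concave)
    show "((\<lambda>x. sin (pi * x)) has_real_derivative pi * cos (pi * x)) (at x)" for x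
      by (auto intro!: derivative_eq_intros)
    show "((\<lambda>x. pi * cos (pi * x)) has_real_derivative - (pi * pi * sin (pi * x))) (at x)" for x
      by (auto intro!: derivative_eq_intros)
    show "- (pi * pi * sin (pi * x)) \<le> 0" if "x \<in> {0..1/2}" for x
      using that by (auto intro!: mult_nonneg_nonneg sin_ge_zero mult_left_le simp: mult_le_cancel_left1)
  qed auto
  from concave_onD[OF this, of "2 * t" 0 "1 / 2"] assms show ?thesis by simp
qed

lemma cmod_e_diff_ge:
  assumes "0 \<le> t" "t \<le> 1"
  shows "4 * min t (1 - t) \<le> cmod (e t - 1)"
proof -
  have "e t = cis (2 * (pi * t))" by (simp add: e_def cis_conv_exp mult_ac)
  then have "(cmod (e t - 1))\<^sup>2 = (cos (2 * (pi * t)) - 1)\<^sup>2 + (sin (2 * (pi * t)))\<^sup>2"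
    by (simp add: cmod_power2)
  also have "\<dots> = 2 - 2 * cos (2 * (pi * t))"
    using sin_cos_squared_add[of "2 * (pi * t)"] by (simp add: power2_diff)
  also have "\<dots> = (2 * \<bar>sin (pi * t)\<bar>)\<^sup>2"
    by (simp add: cos_double_sin power_mult_distrib)
  finally have "cmod (e t - 1) = 2 * \<bar>sin (pi * t)\<bar>"
    by (rule power2_eq_imp_eq) auto
  moreover have "2 * min t (1 - t) \<le> sin (pi * t)"
  proof (cases "t \<le> 1 / 2")
    case True
    then show ?thesis using sin_pi_ge[of t] assms by auto
  next
    case False
    have "sin (pi * (1 - t)) = sin (pi * t)" by (simp add: right_diff_distrib)
    then show ?thesis using sin_pi_ge[of "1 - t"] assms False by auto
  qed
  ultimately show ?thesis by linarith
qed

definition dirichlet_kernel :: "nat \<Rightarrow> real \<Rightarrow> complex" where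
  "dirichlet_kernel L t = (\<Sum>h<L. e (real h * t))"

lemma cmod_dirichlet_kernel_le: "cmod (dirichlet_kernel L t) \<le> real L"
  unfolding dirichlet_kernel_def using norm_sum[of "\<lambda>h. e (real h * t)" "{..<L}"] by simp

lemma dirichlet_kernel_frac: "dirichlet_kernel L (frac t) = dirichlet_kernel L t"
proof -
  have "e (real h * t) = e (real h * frac t)" for h
  proof -
    have "real h * t = real h * frac t + real_of_int (int h * \<lfloor>t\<rfloor>)" by (simp add: frac_def algebra_simps)
    then show ?thesis by (simp only: e_add e_of_int mult_1_right)
  qed
  then show ?thesis by (simp add: dirichlet_kernel_def)
qed

lemma cmod_dirichlet_kernel_mult_le: 
  assumes "0 \<le> t" "t \<le> 1"
  shows "cmod (dirichlet_kernel L t) * (2 * min t (1 - t)) \<le> 1"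
proof -
  have "dirichlet_kernel L t * (e t - 1) = e (real L * t) - 1"
    unfolding dirichlet_kernel_def
    by (induction L) (auto simp: algebra_simps simp flip: e_add)
  then have "cmod (dirichlet_kernel L t) * cmod (e t - 1) = cmod (e (real L * t) - 1)"
    by (metis norm_mult)
  also have "\<dots> \<le> 2" using norm_triangle_ineq4[of "e (real L * t)" 1] by simp
  finally have "cmod (dirichlet_kernel L t) * (4 * min t (1 - t)) \<le> 2"
    using mult_left_mono[OF cmod_e_diff_ge[OF assms], of "cmod (dirichlet_kernel L t)"] by simp
  then show ?thesis by simp
qed

lemma sum_inverse_squares_le: "(\<Sum>u<N. 1 / (real u + 1)\<^sup>2) \<le> 2"
proof -
  have "(\<Sum>u<Suc N. 1 / (real u + 1)\<^sup>2) \<le> 2 - 1 / (real N + 1)" for N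
  proof (induction N)
    case (Suc N)
    define x where "x = real N + 1"
    have x: "x > 0" by (simp add: x_def)
    have "1 / (x + 1)\<^sup>2 \<le> 1 / (x * (x + 1))"
      unfolding power2_eq_square using x by (intro divide_left_mono mult_right_mono) auto
    also have "\<dots> = 1 / x - 1 / (x + 1)" using x by (simp add: field_simps)
    finally show ?case using Suc by (simp add: x_def add.commute)
  qed simp
  moreover have "(\<Sum>u<N. 1 / (real u + 1)\<^sup>2) \<le> (\<Sum>u<Suc N. 1 / (real u + 1)\<^sup>2)" by simp
  ultimately show ?thesis by (meson diff_le_eq order_trans le_add_same_cancel1 divide_nonneg_nonneg add_nonneg_nonneg of_nat_0_le_iff zero_le_one)
qed

text \<open>The points are sorted into \<open>N\<close> windows of length \<open>1 / N\<close>, each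
  holding at most \<open>K\<close> of them. In the u-th window, counted from the nearer end of the
  unit interval, the kernel is O(N / (u + 1)), and the squares of these bounds are summable.\<close>

lemma sum_dirichlet_kernel_square_le:
  fixes x :: "'i \<Rightarrow> real"
  assumes N: "1 \<le> N" and fin: "finite I"
    and K: "\<And>\<beta>. real (card {i \<in> I. frac (x i - \<beta>) < 1 / real N}) \<le> K"
  shows "(\<Sum>i\<in>I. (cmod (dirichlet_kernel (2 * N) (x i - \<beta>)))\<^sup>2) \<le> 16 * K * (real N)\<^sup>2"
proof -
  define t where "t i = frac (x i - \<beta>)" for i
  define bin where "bin i = nat \<lfloor>real N * t i\<rfloor>" for i
  have t: "0 \<le> t i" "t i < 1" for i by (auto simp: t_def frac_lt_1)
  have N0: "0 < real N" using N by simp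
  have bin: "real (bin i) \<le> real N * t i" "real N * t i < real (bin i) + 1" "bin i < N" for i
  proof -
    have "0 \<le> real N * t i" using t(1) by simp
    then show "real (bin i) \<le> real N * t i" "real N * t i < real (bin i) + 1" unfolding bin_def by linarith+
    moreover have "real N * t i < real N * 1" using N0 t(2) by (intro mult_strict_left_mono)
    ultimately show "bin i < N" by simp
  qed
  \<comment> \<open>Adding the bounds from both ends of the unit interval avoids a case distinction
    in the sum. Each end contributes at most 2, whence the constant 16 = 4 (2 + 2).\<close>
  define w where "w u = 4 * (real N)\<^sup>2 * (1 / (real u + 1)\<^sup>2 + 1 / (real (N - Suc u) + 1)\<^sup>2)" for u
  have w: "(cmod (dirichlet_kernel (2 * N) (x i - \<beta>)))\<^sup>2 \<le> w (bin i)" for i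
  proof -
    let ?d = "cmod (dirichlet_kernel (2 * N) (t i))" and ?u = "bin i"
    have d: "cmod (dirichlet_kernel (2 * N) (x i - \<beta>)) = ?d" by (simp add: t_def dirichlet_kernel_frac)
    have edge: "?d\<^sup>2 \<le> 4 * (real N)\<^sup>2" using power_mono[OF cmod_dirichlet_kernel_le[of "2 * N" "t i"], of 2] by (simp add: power_mult_distrib)
    have main: "?d\<^sup>2 \<le> 4 * (real N)\<^sup>2 * (1 / (real v + 1)\<^sup>2)"
      if v: "real v \<le> real N * min (t i) (1 - t i)" for v :: nat
    proof (cases "v = 0")
      case True
      then show ?thesis using edge by simp
    next
      case False
      have "?d * (2 * real v) \<le> ?d * (real N * (2 * min (t i) (1 - t i)))"
        using v by (intro mult_left_mono) auto
      also have "\<dots> = real N * (?d * (2 * min (t i) (1 - t i)))" by (simp add: mult_ac)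
      also have "\<dots> \<le> real N * 1" using t by (intro mult_left_mono cmod_dirichlet_kernel_mult_le) (auto simp: less_imp_le)
      finally have "?d * (2 * real v) \<le> real N" by simp
      moreover have "?d * (real v + 1) \<le> ?d * (2 * real v)" using False by (intro mult_left_mono) auto
      ultimately have "?d * (real v + 1) \<le> real N" by linarith
      then have "?d \<le> real N / (real v + 1)" by (simp add: field_simps)
      then have "?d\<^sup>2 \<le> (real N / (real v + 1))\<^sup>2" by (intro power_mono) auto
      also have "\<dots> = 1 * (real N)\<^sup>2 * (1 / (real v + 1)\<^sup>2)" by (simp add: power_divide)
      also have "\<dots> \<le> 4 * (real N)\<^sup>2 * (1 / (real v + 1)\<^sup>2)" by (intro mult_right_mono) auto
      finally show ?thesis .
    qed
    have "?d\<^sup>2 \<le> w ?u"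
    proof (cases "t i \<le> 1 - t i")
      case True
      then have "?d\<^sup>2 \<le> 4 * (real N)\<^sup>2 * (1 / (real ?u + 1)\<^sup>2)" using bin(1)[of i] by (intro main) (simp add: min_def)
      also have "\<dots> \<le> w ?u" unfolding w_def by (intro mult_left_mono) auto
      finally show ?thesis .
    next
      case False
      have "real (N - Suc ?u) = real N - real ?u - 1" using bin(3)[of i] by (simp add: of_nat_diff)
      also have "\<dots> \<le> real N * (1 - t i)" using bin(2)[of i] by (simp add: algebra_simps)
      finally have "?d\<^sup>2 \<le> 4 * (real N)\<^sup>2 * (1 / (real (N - Suc ?u) + 1)\<^sup>2)" using False by (intro main) (simp add: min_def)
      also have "\<dots> \<le> w ?u" unfolding w_def by (intro mult_left_mono) auto
      finally show ?thesis .
    qed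
    then show ?thesis by (simp only: d)
  qed
  have w0: "0 \<le> w u" for u by (simp add: w_def)
  have cardbin: "real (card {i \<in> I. bin i = u}) \<le> K" for u
  proof -
    have "{i \<in> I. bin i = u} \<subseteq> {i \<in> I. frac (x i - (\<beta> + real u / real N)) < 1 / real N}"
    proof safe
      fix i
      assume "u = bin i"
      have lo: "real (bin i) / real N \<le> t i" and hi: "t i < real (bin i) / real N + 1 / real N"
        using bin(1,2)[of i] N0 by (auto simp: field_simps)
      have "x i - (\<beta> + real (bin i) / real N) - (t i - real (bin i) / real N) = real_of_int \<lfloor>x i - \<beta>\<rfloor>"
        by (simp add: t_def frac_def)
      moreover have "t i - real (bin i) / real N < 1"
        using t(2)[of i] divide_nonneg_nonneg[of "real (bin i)" "real N"] by linarith
      ultimately have "frac (x i - (\<beta> + real (bin i) / real N)) = t i - real (bin i) / real N"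
        unfolding frac_unique_iff using lo by (metis Ints_of_int diff_ge_0_iff_ge)
      then show "frac (x i - (\<beta> + real (bin i) / real N)) < 1 / real N" using hi by simp
    qed
    then have "card {i \<in> I. bin i = u} \<le> card {i \<in> I. frac (x i - (\<beta> + real u / real N)) < 1 / real N}"
      using fin by (intro card_mono) auto
    then show ?thesis using K[of "\<beta> + real u / real N"] by linarith
  qed
  have K0: "0 \<le> K" using cardbin[of 0] by linarith
  have "(\<Sum>i\<in>I. (cmod (dirichlet_kernel (2 * N) (x i - \<beta>)))\<^sup>2) \<le> (\<Sum>i\<in>I. w (bin i))"
    by (intro sum_mono w)
  also have "\<dots> = (\<Sum>u<N. \<Sum>i\<in>{i \<in> I. bin i = u}. w (bin i))"
    using fin bin(3) by (intro sum.group[symmetric]) auto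
  also have "\<dots> = (\<Sum>u<N. real (card {i \<in> I. bin i = u}) * w u)"
    by (intro sum.cong refl) simp
  also have "\<dots> \<le> (\<Sum>u<N. K * w u)"
    using cardbin w0 by (intro sum_mono mult_right_mono) auto
  also have "\<dots> = K * (4 * (real N)\<^sup>2 * ((\<Sum>u<N. 1 / (real u + 1)\<^sup>2) + (\<Sum>u<N. 1 / (real (N - Suc u) + 1)\<^sup>2)))"
    unfolding w_def by (simp only: sum_distrib_left[symmetric] sum.distrib)
  also have "(\<Sum>u<N. 1 / (real (N - Suc u) + 1)\<^sup>2) = (\<Sum>u<N. 1 / (real u + 1)\<^sup>2)"
    by (rule sum.nat_diff_reindex)
  also have "K * (4 * (real N)\<^sup>2 * ((\<Sum>u<N. 1 / (real u + 1)\<^sup>2) + (\<Sum>u<N. 1 / (real u + 1)\<^sup>2))) \<le> K * (4 * (real N)\<^sup>2 * (2 + 2))"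
    using K0 sum_inverse_squares_le[of N] by (intro mult_left_mono add_mono) auto
  finally show ?thesis by (simp add: mult_ac)
qed

text \<open>The dual sum over \<open>{M+1..M+N}\<close> is dominated by a Fejer-weighted sum: each \<open>n = M + d\<close>,
  \<open>1 \<le> d \<le> N\<close>, is represented at least \<open>N\<close> times as \<open>M + h - h'\<close> with \<open>h, h' < 2 N\<close>.\<close>

lemma dual_large_sieve:
  fixes x :: "'i \<Rightarrow> real" and c :: "'i \<Rightarrow> complex"
  assumes N: "1 \<le> N" and fin: "finite I"
    and K: "\<And>\<beta>. real (card {i \<in> I. frac (x i - \<beta>) < 1 / real N}) \<le> K"
  shows "(\<Sum>n=M+1..M+N. (cmod (\<Sum>i\<in>I. c i * e (x i * real n)))\<^sup>2) \<le> 16 * K * real N * (\<Sum>i\<in>I. (cmod (c i))\<^sup>2)"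
proof -
  define B where "B y = (\<Sum>i\<in>I. c i * e (x i * y))" for y
  define E where "E i h h' = c i * e (x i * (real M + real h - real h'))" for i and h h' :: nat
  have N0: "0 < real N" using N by simp
  have one: "(\<Sum>n=M+1..M+N. (cmod (B (real n)))\<^sup>2) \<le> (\<Sum>h<2*N. (cmod (B (real M + real h - real h')))\<^sup>2)" if "h' < N" for h'
  proof -
    have "(\<Sum>n=M+1..M+N. (cmod (B (real n)))\<^sup>2) = (\<Sum>h\<in>{h'+1..h'+N}. (cmod (B (real M + real h - real h')))\<^sup>2)"
      by (rule sum.reindex_bij_witness[of _ "\<lambda>h. h + M - h'" "\<lambda>n. n + h' - M"]) (auto simp: of_nat_diff)
    also have "\<dots> \<le> (\<Sum>h<2*N. (cmod (B (real M + real h - real h')))\<^sup>2)"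
      using that by (intro sum_mono2) auto
    finally show ?thesis .
  qed
  have "real N * (\<Sum>n=M+1..M+N. (cmod (B (real n)))\<^sup>2) = (\<Sum>h'<N. \<Sum>n=M+1..M+N. (cmod (B (real n)))\<^sup>2)"
    by simp
  also have "\<dots> \<le> (\<Sum>h'<N. \<Sum>h<2*N. (cmod (B (real M + real h - real h')))\<^sup>2)"
    by (intro sum_mono one) simp
  also have "\<dots> \<le> (\<Sum>h'<2*N. \<Sum>h<2*N. (cmod (B (real M + real h - real h')))\<^sup>2)"
    by (intro sum_mono2) (auto intro!: sum_nonneg)
  finally have lower: "real N * (\<Sum>n=M+1..M+N. (cmod (B (real n)))\<^sup>2)
      \<le> (\<Sum>h'<2*N. \<Sum>h<2*N. (cmod (B (real M + real h - real h')))\<^sup>2)" .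
  let ?D = "\<lambda>i j. dirichlet_kernel (2 * N) (x i - x j)"
  have EE: "E i h h' * cnj (E j h h') = (c i * cnj (c j) * e ((x i - x j) * real M)) * (e (real h * (x i - x j)) * cnj (e (real h' * (x i - x j))))"
    for i j h h'
    unfolding E_def complex_cnj_mult cnj_e
    by (simp add: algebra_simps flip: e_add)
  have "complex_of_real (\<Sum>h'<2*N. \<Sum>h<2*N. (cmod (B (real M + real h - real h')))\<^sup>2)
      = (\<Sum>h'<2*N. \<Sum>h<2*N. \<Sum>i\<in>I. \<Sum>j\<in>I. E i h h' * cnj (E j h h'))"
    unfolding of_real_sum complex_norm_square B_def E_def cnj_sum sum_product ..
  also have "\<dots> = (\<Sum>i\<in>I. \<Sum>j\<in>I. \<Sum>h'<2*N. \<Sum>h<2*N. E i h h' * cnj (E j h h'))"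
  proof -
    have "(\<Sum>h'<2*N. \<Sum>h<2*N. \<Sum>i\<in>I. \<Sum>j\<in>I. E i h h' * cnj (E j h h'))
        = (\<Sum>h'<2*N. \<Sum>i\<in>I. \<Sum>h<2*N. \<Sum>j\<in>I. E i h h' * cnj (E j h h'))"
      by (rule sum.cong[OF refl], rule sum.swap)
    also have "\<dots> = (\<Sum>i\<in>I. \<Sum>h'<2*N. \<Sum>h<2*N. \<Sum>j\<in>I. E i h h' * cnj (E j h h'))" by (rule sum.swap)
    also have "\<dots> = (\<Sum>i\<in>I. \<Sum>h'<2*N. \<Sum>j\<in>I. \<Sum>h<2*N. E i h h' * cnj (E j h h'))"
      by (rule sum.cong[OF refl], rule sum.cong[OF refl], rule sum.swap)
    also have "\<dots> = (\<Sum>i\<in>I. \<Sum>j\<in>I. \<Sum>h'<2*N. \<Sum>h<2*N. E i h h' * cnj (E j h h'))"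
      by (rule sum.cong[OF refl], rule sum.swap)
    finally show ?thesis .
  qed
  also have "\<dots> = (\<Sum>i\<in>I. \<Sum>j\<in>I. (c i * cnj (c j) * e ((x i - x j) * real M)) * (?D i j * cnj (?D i j)))"
  proof -
    have "(\<Sum>h'<L. \<Sum>h<L. C * (A h * cnj (A h'))) = C * ((\<Sum>h<L. A h) * cnj (\<Sum>h<L. A h))"
      for C and A :: "nat \<Rightarrow> complex" and L
      unfolding cnj_sum unfolding sum_product unfolding sum_distrib_left by (rule sum.swap)
    then show ?thesis unfolding EE dirichlet_kernel_def by (simp only:)
  qed
  finally have id: "complex_of_real (\<Sum>h'<2*N. \<Sum>h<2*N. (cmod (B (real M + real h - real h')))\<^sup>2)
      = (\<Sum>i\<in>I. \<Sum>j\<in>I. (c i * cnj (c j) * e ((x i - x j) * real M)) * (?D i j * cnj (?D i j)))" .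
  have "(\<Sum>h'<2*N. \<Sum>h<2*N. (cmod (B (real M + real h - real h')))\<^sup>2)
      = cmod (complex_of_real (\<Sum>h'<2*N. \<Sum>h<2*N. (cmod (B (real M + real h - real h')))\<^sup>2))"
    unfolding norm_of_real by (rule abs_of_nonneg[symmetric]) (auto intro!: sum_nonneg)
  also have "\<dots> \<le> (\<Sum>i\<in>I. \<Sum>j\<in>I. cmod (c i) * cmod (c j) * (cmod (?D i j))\<^sup>2)"
    unfolding id
    by (intro order_trans[OF norm_sum] sum_mono) (simp add: norm_mult power2_eq_square)
  \<comment> \<open>Schur's test: the arithmetic-geometric inequality reduces the form to row and
    column sums of the squared kernel.\<close>
  also have "\<dots> \<le> (\<Sum>i\<in>I. \<Sum>j\<in>I. ((cmod (c i))\<^sup>2 / 2 + (cmod (c j))\<^sup>2 / 2) * (cmod (?D i j))\<^sup>2)"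
  proof (intro sum_mono mult_right_mono)
    fix i j
    show "cmod (c i) * cmod (c j) \<le> (cmod (c i))\<^sup>2 / 2 + (cmod (c j))\<^sup>2 / 2"
      using sum_squares_bound[of "cmod (c i)" "cmod (c j)"] by simp
  qed simp
  also have "\<dots> = (\<Sum>i\<in>I. (cmod (c i))\<^sup>2 / 2 * (\<Sum>j\<in>I. (cmod (?D i j))\<^sup>2)) + (\<Sum>j\<in>I. (cmod (c j))\<^sup>2 / 2 * (\<Sum>i\<in>I. (cmod (?D i j))\<^sup>2))"
    unfolding distrib_right sum.distrib sum_distrib_left by (intro arg_cong2[where f = "(+)"] refl sum.swap)
  also have "\<dots> \<le> (\<Sum>i\<in>I. (cmod (c i))\<^sup>2 / 2 * (16 * K * (real N)\<^sup>2)) + (\<Sum>j\<in>I. (cmod (c j))\<^sup>2 / 2 * (16 * K * (real N)\<^sup>2))"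
  proof (intro add_mono sum_mono mult_left_mono)
    fix j
    show D: "(\<Sum>i\<in>I. (cmod (?D i j))\<^sup>2) \<le> 16 * K * (real N)\<^sup>2" by (rule sum_dirichlet_kernel_square_le[OF N fin K])
    have "cmod (?D i j) = cmod (?D j i)" for i
    proof -
      have "?D i j = cnj (?D j i)" by (simp add: dirichlet_kernel_def cnj_e right_diff_distrib)
      then show ?thesis by simp
    qed
    with D show "(\<Sum>i\<in>I. (cmod (?D j i))\<^sup>2) \<le> 16 * K * (real N)\<^sup>2" by simp
  qed auto
  also have "\<dots> = 16 * K * (real N)\<^sup>2 * (\<Sum>i\<in>I. (cmod (c i))\<^sup>2)"
    by (simp add: sum_distrib_left mult_ac flip: sum.distrib)
  finally have "real N * (\<Sum>n=M+1..M+N. (cmod (B (real n)))\<^sup>2) \<le> real N * (16 * K * real N * (\<Sum>i\<in>I. (cmod (c i))\<^sup>2))"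
    using lower by (simp add: power2_eq_square mult_ac)
  then show ?thesis using N0 by (simp add: B_def)
qed

text \<open>Duality by hand: with the conjugated sums as coefficients in
  \<open>dual_large_sieve\<close>, Cauchy-Schwarz bounds \<open>Z * Z\<close> by \<open>Z\<close>
  times the right-hand side, and \<open>Z\<close> cancels.\<close>

lemma large_sieve_local:
  fixes x :: "'i \<Rightarrow> real" and a :: "nat \<Rightarrow> complex"
  assumes N: "1 \<le> N" and fin: "finite I"
    and K: "\<And>\<beta>. real (card {i \<in> I. frac (x i - \<beta>) < 1 / real N}) \<le> K"
  shows "(\<Sum>i\<in>I. (cmod (\<Sum>n=M+1..M+N. a n * e (x i * real n)))\<^sup>2) \<le> 16 * K * real N * (\<Sum>n=M+1..M+N. (cmod (a n))\<^sup>2)"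
proof -
  define S where "S i = (\<Sum>n=M+1..M+N. a n * e (x i * real n))" for i
  define Z where "Z = (\<Sum>i\<in>I. (cmod (S i))\<^sup>2)"
  define b where "b n = (\<Sum>i\<in>I. cnj (S i) * e (x i * real n))" for n
  have K0: "0 \<le> K" using K[of 0] by linarith
  have Z0: "0 \<le> Z" by (simp add: Z_def sum_nonneg)
  have "complex_of_real Z = (\<Sum>i\<in>I. S i * cnj (S i))" by (simp add: Z_def complex_norm_square del: of_real_power)
  also have "\<dots> = (\<Sum>i\<in>I. \<Sum>n=M+1..M+N. a n * (cnj (S i) * e (x i * real n)))"
  proof (rule sum.cong[OF refl])
    fix i
    have "S i * c = (\<Sum>n=M+1..M+N. a n * (c * e (x i * real n)))" for c
      unfolding S_def sum_distrib_right by (simp only: mult_ac)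
    then show "S i * cnj (S i) = (\<Sum>n=M+1..M+N. a n * (cnj (S i) * e (x i * real n)))" .
  qed
  also have "\<dots> = (\<Sum>n=M+1..M+N. a n * b n)"
    unfolding b_def sum_distrib_left by (rule sum.swap)
  finally have "Z = cmod (\<Sum>n=M+1..M+N. a n * b n)" using Z0 by (metis norm_of_real abs_of_nonneg)
  also have "\<dots> \<le> (\<Sum>n=M+1..M+N. cmod (a n) * cmod (b n))"
    by (intro order_trans[OF norm_sum]) (simp add: norm_mult)
  finally have "Z\<^sup>2 \<le> (\<Sum>n=M+1..M+N. cmod (a n) * cmod (b n))\<^sup>2" using Z0 by (intro power_mono)
  also have "\<dots> \<le> (\<Sum>n=M+1..M+N. (cmod (a n))\<^sup>2) * (\<Sum>n=M+1..M+N. (cmod (b n))\<^sup>2)"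
    by (rule Cauchy_Schwarz_ineq_sum)
  also have "\<dots> \<le> (\<Sum>n=M+1..M+N. (cmod (a n))\<^sup>2) * (16 * K * real N * Z)"
    using dual_large_sieve[OF N fin K, of "\<lambda>i. cnj (S i)" M] by (intro mult_left_mono) (auto simp: b_def Z_def intro!: sum_nonneg)
  finally have "Z * Z \<le> (16 * K * real N * (\<Sum>n=M+1..M+N. (cmod (a n))\<^sup>2)) * Z"
    by (simp add: power2_eq_square mult_ac)
  then have "Z \<le> 16 * K * real N * (\<Sum>n=M+1..M+N. (cmod (a n))\<^sup>2)"
    using Z0 K0 by (cases "Z = 0") (auto intro!: mult_nonneg_nonneg sum_nonneg)
  then show ?thesis by (simp add: Z_def S_def)
qed

text \<open>Since \<open>q ^ k \<le> N\<close>, a window of length \<open>1 / N\<close> contains at most one fraction \<open>b / q ^ k\<close> for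
  each \<open>q\<close>.\<close>

lemma card_fractions_le_near:
  fixes Q \<beta> :: real
  assumes k: "1 \<le> k" and N: "1 \<le> N" and Q: "1 \<le> Q" "Q ^ k \<le> real N" and X: "Q \<le> real X"
  defines "I \<equiv> (SIGMA q:{q::nat. 1 \<le> q \<and> real q \<le> Q}. {b::nat. 1 \<le> b \<and> b \<le> q ^ k \<and> coprime b q})"
  shows "card {i \<in> I. frac (real (snd i) / real (fst i ^ k) - \<beta>) < 1 / real N} \<le> card (near k \<beta> (Q ^ k / real N) X)"
proof (rule card_inj_on_le[where f = "int \<circ> fst"])
  let ?W = "{i \<in> I. frac (real (snd i) / real (fst i ^ k) - \<beta>) < 1 / real N}"
  have N0: "0 < real N" using N by simp
  have qk: "0 < real (q ^ k)" "real (q ^ k) \<le> Q ^ k" "real (q ^ k) \<le> real N" if "1 \<le> q" "real q \<le> Q" for q :: nat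
  proof -
    show "0 < real (q ^ k)" using that by simp
    show "real (q ^ k) \<le> Q ^ k" using that by (simp add: power_mono)
    then show "real (q ^ k) \<le> real N" using Q by linarith
  qed
  show "inj_on (int \<circ> fst) ?W"
  proof (rule inj_onI)
    fix i j assume ij: "i \<in> ?W" "j \<in> ?W" "(int \<circ> fst) i = (int \<circ> fst) j"
    obtain q b where i: "i = (q, b)" by (cases i)
    obtain b' where j: "j = (q, b')" using ij(3) i by (cases j) auto
    have q: "1 \<le> q" "real q \<le> Q" "1 \<le> b" "b \<le> q ^ k" "1 \<le> b'" "b' \<le> q ^ k"
      using ij i j by (auto simp: I_def)
    define q' where "q' = real (q ^ k)"
    have q': "0 < q'" "q' \<le> real N" using qk[OF q(1,2)] by (auto simp: q'_def)
    let ?n = "\<lfloor>real b / q' - \<beta>\<rfloor>" and ?n' = "\<lfloor>real b' / q' - \<beta>\<rfloor>"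
    have f: "0 \<le> frac (real b / q' - \<beta>)" "frac (real b / q' - \<beta>) < 1 / real N"
      "0 \<le> frac (real b' / q' - \<beta>)" "frac (real b' / q' - \<beta>) < 1 / real N"
      using ij i j by (auto simp: q'_def)
    have "1 / real N \<le> 1 / q'" using q' by (intro divide_left_mono) auto
    then have "\<bar>frac (real b / q' - \<beta>) - frac (real b' / q' - \<beta>)\<bar> < 1 / q'" using f by linarith
    moreover have "frac (real b / q' - \<beta>) - frac (real b' / q' - \<beta>) = (real b - real b' - (?n - ?n') * q') / q'"
      using q' by (simp add: frac_def field_simps)
    ultimately have "\<bar>real b - real b' - (?n - ?n') * q'\<bar> < 1" using q' by (simp add: abs_divide divide_less_cancel)
    then have "\<bar>real_of_int (int b - int b' - (?n - ?n') * int (q ^ k))\<bar> < 1" by (simp add: q'_def)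
    then have "int b - int b' = (?n - ?n') * int (q ^ k)" by linarith
    moreover have "\<bar>int b - int b'\<bar> < int (q ^ k)" using q by linarith
    ultimately have "int b = int b'"
      using zdvd_not_zless dvd_imp_le_int[of "int b - int b'" "int (q ^ k)"] by (cases "int b - int b' = 0") auto
    then show "i = j" using i j by simp
  qed
  show "(int \<circ> fst) ` ?W \<subseteq> near k \<beta> (Q ^ k / real N) X"
  proof
    fix y assume "y \<in> (int \<circ> fst) ` ?W"
    then obtain q b where y: "y = int q" and qb: "(q, b) \<in> I" and f: "frac (real b / real (q ^ k) - \<beta>) < 1 / real N" by auto
    have q: "1 \<le> q" "real q \<le> Q" "coprime b q" using qb by (auto simp: I_def)
    note qq = qk[OF q(1,2)]
    define m where "m = \<lfloor>real b / real (q ^ k) - \<beta>\<rfloor>"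
    \<comment> \<open>Moving the fraction by the integer \<open>m\<close> changes its numerator by a
      multiple of \<open>q ^ k\<close>, so coprimality to \<open>q\<close> survives; multiplying by
      \<open>q ^ k \<le> Q ^ k\<close> widens the window from \<open>1 / N\<close> to at most
      \<open>Q ^ k / N\<close>.\<close>
    define c where "c = int b - m * int (q ^ k)"
    have eq: "real_of_int c - \<beta> * real_of_int (int q) ^ k = real (q ^ k) * frac (real b / real (q ^ k) - \<beta>)"
      using qq(1) by (simp add: c_def m_def frac_def field_simps)
    have "0 \<le> real_of_int c - \<beta> * real_of_int (int q) ^ k" unfolding eq using qq by simp
    moreover have "real_of_int c - \<beta> * real_of_int (int q) ^ k < Q ^ k / real N"
    proof -
      have "real (q ^ k) * frac (real b / real (q ^ k) - \<beta>) < real (q ^ k) * (1 / real N)"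
        using qq(1) f by (intro mult_strict_left_mono)
      also have "\<dots> \<le> Q ^ k * (1 / real N)" using qq(2) N0 by (intro mult_right_mono) auto
      finally show ?thesis unfolding eq by simp
    qed
    moreover have "coprime c (int q)"
    proof -
      obtain k' where k': "k = Suc k'" using k by (cases k) auto
      have "gcd c (int q) = gcd (int b) (int q)"
        unfolding c_def k' using gcd_add_mult[of "int q" "- m * int (q ^ k')" "int b"]
        by (simp add: gcd.commute algebra_simps)
      then show ?thesis using q(3) by (simp add: coprime_iff_gcd_eq_1)
    qed
    moreover have "int q \<in> {1..int X}" using q X by simp
    ultimately show "y \<in> near k \<beta> (Q ^ k / real N) X" unfolding y near_def by blast
  qed
qed simp

theorem theorem1p2:
  fixes k :: nat and \<epsilon> :: real
  assumes "k \<ge> 1" and "\<epsilon> > 0"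
  shows "\<exists>C::real. C > 0 \<and>
    (\<forall>(M::nat) (N::nat) (Q::real) (a :: nat \<Rightarrow> complex).
      M \<ge> 1 \<longrightarrow> N \<ge> 1 \<longrightarrow> Q \<ge> 1 \<longrightarrow>
      real N powr (1 / (2 * real k)) \<le> Q \<longrightarrow> Q \<le> real N powr (1 / real k) \<longrightarrow>
      (\<Sum>q \<in> {q::nat. 1 \<le> q \<and> real q \<le> Q}.
         \<Sum>b \<in> {b::nat. 1 \<le> b \<and> b \<le> q ^ k \<and> coprime b q}.
           (cmod (\<Sum>n = M + 1..M + N. a n * e (real b / real (q ^ k) * real n)))\<^sup>2)
      \<le> C * (Q * real N) powr \<epsilon> * Q powr (1 + 1 / (real k + 1))
          * real N powr (1 - 1 / (real k * (real k + 1)))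
          * (\<Sum>n = M + 1..M + N. (cmod (a n))\<^sup>2))"
proof -
  obtain C where C: "1 \<le> C" "\<And>X \<beta> \<delta>. 1 \<le> X \<Longrightarrow> 0 < \<delta> \<Longrightarrow> \<delta> \<le> 1 \<Longrightarrow> 1 \<le> \<delta> * real X ^ k \<Longrightarrow>
     real (card (near k \<beta> \<delta> X)) \<le> C * real X powr (1 + \<epsilon>) * \<delta> powr (1 / (real k * (real k + 1)))"
    using card_near_bound[OF assms] by metis
  define C' where "C' = 16 * (C * 2 powr (1 + \<epsilon>))"
  have C': "0 < C'" using C(1) by (simp add: C'_def)
  show ?thesis
  proof (intro exI[of _ C'] conjI C' allI impI)
    fix M N :: nat and Q :: real and a :: "nat \<Rightarrow> complex"
    assume N: "1 \<le> N" and Q: "1 \<le> Q" and lo: "real N powr (1 / (2 * real k)) \<le> Q" and hi: "Q \<le> real N powr (1 / real k)"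
    have N0: "0 < real N" and k0: "0 < real k" using N assms(1) by auto
    have Qk: "Q ^ k \<le> real N"
    proof -
      have "Q ^ k \<le> (real N powr (1 / real k)) ^ k" using hi Q by (intro power_mono) auto
      also have "\<dots> = real N" using N0 k0 by (simp add: powr_powr flip: powr_realpow)
      finally show ?thesis .
    qed
    \<comment> \<open>The lower bound on \<open>Q\<close> enters here; it yields
      \<open>1 \<le> \<delta> * X ^ k\<close>.\<close>
    have NQ: "real N \<le> Q ^ k * Q ^ k"
    proof -
      have "real N = (real N powr (1 / (2 * real k))) ^ (2 * k)" using N0 k0 by (simp add: powr_powr flip: powr_realpow)
      also have "\<dots> \<le> Q ^ (2 * k)" using lo by (intro power_mono) auto
      finally show ?thesis by (simp add: mult_2 power_add)
    qed
    \<comment> \<open>Rounding up at most doubles \<open>Q\<close>, which accounts for the factor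
      \<open>2 powr (1 + \<epsilon>)\<close> in \<open>C'\<close>.\<close>
    define X where "X = nat \<lceil>Q\<rceil>"
    have X: "Q \<le> real X" "real X \<le> 2 * Q" "1 \<le> X" using Q unfolding X_def by linarith+
    define \<delta> where "\<delta> = Q ^ k / real N"
    have \<delta>: "0 < \<delta>" "\<delta> \<le> 1" using Q Qk N0 by (auto simp: \<delta>_def)
    have dX: "1 \<le> \<delta> * real X ^ k"
    proof -
      have "1 \<le> Q ^ k * Q ^ k / real N" using NQ N0 by simp
      also have "\<dots> = \<delta> * Q ^ k" by (simp add: \<delta>_def)
      also have "\<dots> \<le> \<delta> * real X ^ k" using X Q \<delta> by (intro mult_left_mono power_mono) auto
      finally show ?thesis .
    qed
    let ?c = "1 / (real k * (real k + 1))"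
    define K where "K = C * real X powr (1 + \<epsilon>) * \<delta> powr ?c"
    define S where "S = (\<Sum>n = M + 1..M + N. (cmod (a n))\<^sup>2)"
    have S0: "0 \<le> S" by (simp add: S_def sum_nonneg)
    define I where "I = (SIGMA q:{q::nat. 1 \<le> q \<and> real q \<le> Q}. {b::nat. 1 \<le> b \<and> b \<le> q ^ k \<and> coprime b q})"
    have finq: "finite {q::nat. 1 \<le> q \<and> real q \<le> Q}"
      by (rule finite_subset[of _ "{..X}"]) (use X in auto)
    have finb: "finite {b::nat. 1 \<le> b \<and> b \<le> q ^ k \<and> coprime b q}" for q
      by (rule finite_subset[of _ "{..q ^ k}"]) auto
    have finI: "finite I" unfolding I_def using finq finb by (rule finite_SigmaI)
    have "(\<Sum>q \<in> {q::nat. 1 \<le> q \<and> real q \<le> Q}. \<Sum>b \<in> {b::nat. 1 \<le> b \<and> b \<le> q ^ k \<and> coprime b q}.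
           (cmod (\<Sum>n = M + 1..M + N. a n * e (real b / real (q ^ k) * real n)))\<^sup>2)
        = (\<Sum>i\<in>I. (cmod (\<Sum>n = M + 1..M + N. a n * e (real (snd i) / real (fst i ^ k) * real n)))\<^sup>2)"
      unfolding I_def using finq finb by (simp add: sum.Sigma case_prod_unfold)
    also have "\<dots> \<le> 16 * K * real N * S"
      unfolding S_def
    proof (rule large_sieve_local[OF N finI])
      fix \<beta>
      have "real (card {i \<in> I. frac (real (snd i) / real (fst i ^ k) - \<beta>) < 1 / real N}) \<le> real (card (near k \<beta> \<delta> X))"
        using card_fractions_le_near[OF assms(1) N Q Qk X(1)] unfolding I_def \<delta>_def by (simp only: of_nat_le_iff)
      also have "\<dots> \<le> K" unfolding K_def by (rule C(2)[OF X(3) \<delta> dX])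
      finally show "real (card {i \<in> I. frac (real (snd i) / real (fst i ^ k) - \<beta>) < 1 / real N}) \<le> K" .
    qed
    also have "16 * K * real N \<le> C' * (Q * real N) powr \<epsilon> * Q powr (1 + 1 / (real k + 1)) * real N powr (1 - ?c)"
    proof -
      \<comment> \<open>As k times \<open>?c\<close> is 1 / (k + 1), this one factor supplies the
        extra exponent of \<open>Q\<close> and the negative exponent of \<open>N\<close> in the
        theorem.\<close>
      have d: "\<delta> powr ?c = Q powr (1 / (real k + 1)) * real N powr (- ?c)"
      proof -
        have "\<delta> powr ?c = (Q powr real k) powr ?c / real N powr ?c"
          using Q N0 by (simp add: \<delta>_def powr_divide powr_realpow)
        also have "(Q powr real k) powr ?c = Q powr (1 / (real k + 1))" using k0 by (simp add: powr_powr)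
        finally show ?thesis by (simp add: powr_minus_divide)
      qed
      have "real X powr (1 + \<epsilon>) \<le> (2 * Q) powr (1 + \<epsilon>)" using X assms(2) by (intro powr_mono2) auto
      also have "\<dots> = 2 powr (1 + \<epsilon>) * Q powr \<epsilon> * Q" using Q by (simp add: powr_mult powr_add)
      also have "\<dots> \<le> 2 powr (1 + \<epsilon>) * (Q * real N) powr \<epsilon> * Q"
        using Q N assms(2) by (intro mult_right_mono mult_left_mono powr_mono2) auto
      finally have Xp: "real X powr (1 + \<epsilon>) \<le> 2 powr (1 + \<epsilon>) * (Q * real N) powr \<epsilon> * Q" .
      have "16 * K * real N = 16 * C * real X powr (1 + \<epsilon>) * (\<delta> powr ?c * real N)" by (simp add: K_def)
      also have "\<dots> \<le> 16 * C * (2 powr (1 + \<epsilon>) * (Q * real N) powr \<epsilon> * Q) * (\<delta> powr ?c * real N)"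
        using Xp C(1) by (intro mult_right_mono mult_left_mono) auto
      also have "\<dots> = C' * (Q * real N) powr \<epsilon> * (Q * Q powr (1 / (real k + 1))) * (real N * real N powr (- ?c))"
        unfolding d C'_def by (simp only: mult_ac)
      also have "Q * Q powr (1 / (real k + 1)) = Q powr (1 + 1 / (real k + 1))" using Q by (simp add: powr_add)
      also have "real N * real N powr (- ?c) = real N powr (1 - ?c)"
        using N0 powr_add[of "real N" 1 "- ?c"] by simp
      finally show ?thesis .
    qed
    then have "16 * K * real N * S \<le> C' * (Q * real N) powr \<epsilon> * Q powr (1 + 1 / (real k + 1)) * real N powr (1 - ?c) * S"
      using S0 by (rule mult_right_mono)
    finally show "(\<Sum>q \<in> {q::nat. 1 \<le> q \<and> real q \<le> Q}. \<Sum>b \<in> {b::nat. 1 \<le> b \<and> b \<le> q ^ k \<and> coprime b q}.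
           (cmod (\<Sum>n = M + 1..M + N. a n * e (real b / real (q ^ k) * real n)))\<^sup>2)
      \<le> C' * (Q * real N) powr \<epsilon> * Q powr (1 + 1 / (real k + 1)) * real N powr (1 - 1 / (real k * (real k + 1)))
          * (\<Sum>n = M + 1..M + N. (cmod (a n))\<^sup>2)"
      by (simp only: S_def)
  qed
qed

end
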